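(* Let $v:\mathbb{R}/\mathbb{Z}\to\mathbb{R}$ be analytic, $\alpha\in\mathrm{DC}$, $|\lambda|<\lambda_0(v)$ (setting as in the context). There exist constants $C,c>0$ depending only on $v,\lambda,\alpha$ such that the following holds for every $E\in\Sigma_{\lambda v,\alpha}$, with $\theta=\theta(E)$, $\{n_j\}$ the $\epsilon_0$-resonances of $\theta$, and $A=S_{\lambda v,E}$. Fix some $n=|n_j|+1<\infty$ and let $N=|n_{j+1}|$. Let $L^{-1}=\|2\theta-n_j\alpha\|_{\mathbb{R}/\mathbb{Z}}$ and assume $0<L^{-1}<c$. Then there exists an analytic $W:\mathbb{R}/\mathbb{Z}\to\mathrm{SL}(2,\mathbb{R})$ such that $|\deg W|\le Cn$, $\|W\|_c\le CL^C$ and, for one of the two choices of sign, $$\|W(x+\alpha)A(x)W(x)^{-1}-R_{\mp\theta}\|_c\le Ce^{-cN}.$$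
   Context: $\mathrm{DC}(\kappa,\tau)$ is the set of $\alpha\in\mathbb{R}$ with $|\alpha-p/q|\ge \kappa |q|^{-\tau}$ for all $p,q\in\mathbb{Z}$, $q\ne0$; $\mathrm{DC}=\bigcup_{\kappa>0,\tau>0}\mathrm{DC}(\kappa,\tau)$. $\|x\|_{\mathbb{R}/\mathbb{Z}}$ is the distance from $x$ to $\mathbb{Z}$. $\|f\|_\epsilon=\sup_{|\Im z|<\epsilon}\|f(z)\|$ for a function (scalar or matrix valued) that extends to a bounded holomorphic function on $\{|\Im z|<\epsilon\}$. $S_{\lambda v,E}(x)=\begin{pmatrix}E-\lambda v(x)&-1\\1&0\end{pmatrix}$, $R_\theta=\begin{pmatrix}\cos2\pi\theta&-\sin2\pi\theta\\ \sin2\pi\theta&\cos2\pi\theta\end{pmatrix}$. The degree $\deg W$ of a continuous $W:\mathbb{R}/\mathbb{Z}\to\mathrm{SL}(2,\mathbb{R})$ is the integer $m$ such that $W$ is homotopic to $x\mapsto R_{mx}$. $\Sigma_{\lambda v,\alpha}$ is the ($\theta$-independent) spectrum of $(H_{\lambda v,\alpha,\theta}u)_n=u_{n+1}+u_{n-1}+\lambda v(\theta+n\alpha)u_n$ on $\ell^2(\mathbb{Z})$. Dual model: with $v(x)=\sum_k \hat v_k e^{2\pi i kx}$, $(\hat H_{\lambda v,\alpha,\theta}\hat u)_n=\sum_{k}\lambda\hat v_k\hat u_{n-k}+2\cos(2\pi(\theta+n\alpha))\hat u_n$. Resonances: an integer $k$ is an $\epsilon_0$-resonance of $\theta$ if $\|2\theta-k\alpha\|_{\mathbb{R}/\mathbb{Z}}\le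 e^{-|k|\epsilon_0}$ and $\|2\theta-k\alpha\|_{\mathbb{R}/\mathbb{Z}}=\min_{|j|\le|k|}\|2\theta-j\alpha\|_{\mathbb{R}/\mathbb{Z}}$. They are ordered $0=n_0<|n_1|\le|n_2|\le\cdots$; if there are only finitely many, $n_0,\dots,n_j$, set $n_{j+1}=\infty$ (and then $e^{-c|n_{j+1}|}=0$). Almost localization with parameters $C_0,C_1,\epsilon_0,\epsilon_1>0$: for every $\theta,E\in\mathbb{R}$ and every solution $\hat u$ of $\hat H_{\lambda v,\alpha,\theta}\hat u=E\hat u$ with $\hat u_0=1$ and $|\hat u_k|\le 1+|k|$, one has $|\hat u_k|\le C_1e^{-\epsilon_1|k|}$ whenever $C_0(1+|n_j|)<|k|<C_0^{-1}|n_{j+1}|$ for some $j$, $\{n_j\}$ being the $\epsilon_0$-resonances of $\theta$. Setting: $\lambda_0(v)>0$ is a constant (it exists for every analytic $v$, and equals $1$ for $v(x)=2\cos 2\pi x$) such that for all $|\lambda|<\lambda_0(v)$ and $\alpha\in\mathrm{DC}$ the family $\{\hat H_{\lambda v,\alpha,\theta}\}_{\theta}$ is almost localized; for given $v,\lambda,\alpha$ fix parameters $(C_0,C_1,\epsilon_0,\epsilon_1)$ of almost localization. For $E\in\Sigma_{\lambda v,\alpha}$, $\theta(E)$ is some fixed choice (one always exists, not necessarily unique) of $\theta\in\mathbb{R}$ for which $\hat H_{\lambda v,\alpha,\theta}\hat u=E\hat u$ has a solution with $\hat u_0=1$ and $|\hat u_k|\le1$ for all $k$. The constants $C,c$ do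 not depend on $E$ or $\theta$. *)

theory Defs
  imports "HOL-Analysis.Analysis"
begin

text \<open>Functions on \<open>\<real>/\<int>\<close> are represented by 1-periodic functions on the real line.\<close>

definition periodic1 :: "(real \<Rightarrow> 'a) \<Rightarrow> bool" where
  "periodic1 f \<longleftrightarrow> (\<forall>x. f (x + 1) = f x)"

definition real_analytic :: "(real \<Rightarrow> real) \<Rightarrow> bool" where
  "real_analytic f \<longleftrightarrow>
     (\<forall>x. \<exists>r>0. \<exists>a :: nat \<Rightarrow> real. \<forall>y. \<bar>y - x\<bar> < r \<longrightarrow> (\<lambda>m. a m * (y - x) ^ m) sums f y)"

definition dist_Z :: "real \<Rightarrow> real" where
  "dist_Z x = infdist x \<int>"

definition DC_param :: "real \<Rightarrow> real \<Rightarrow> real set" where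
  "DC_param \<kappa> \<tau> =
     {\<alpha>. \<forall>p q :: int. q \<noteq> 0 \<longrightarrow>
        \<bar>\<alpha> - real_of_int p / real_of_int q\<bar> \<ge> \<kappa> * \<bar>real_of_int q\<bar> powr (- \<tau>)}"

definition DC :: "real set" where
  "DC = (\<Union>\<kappa>\<in>{0<..}. \<Union>\<tau>\<in>{0<..}. DC_param \<kappa> \<tau>)"


subsection \<open>The Schroedinger operator and its spectrum\<close>

definition l2 :: "(int \<Rightarrow> complex) set" where
  "l2 = {u. (\<lambda>n. (cmod (u n))\<^sup>2) summable_on UNIV}"

definition l2_norm :: "(int \<Rightarrow> complex) \<Rightarrow> real" where
  "l2_norm u = sqrt (\<Sum>\<^sub>\<infinity>n. (cmod (u n))\<^sup>2)"

definition l2_resolvent_set :: "((int \<Rightarrow> complex) \<Rightarrow> (int \<Rightarrow> complex)) \<Rightarrow> complex set" where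
  "l2_resolvent_set T =
     {z. bij_betw (\<lambda>u n. T u n - z * u n) l2 l2 \<and>
         (\<exists>B. \<forall>u\<in>l2. l2_norm u \<le> B * l2_norm (\<lambda>n. T u n - z * u n))}"

definition l2_spectrum :: "((int \<Rightarrow> complex) \<Rightarrow> (int \<Rightarrow> complex)) \<Rightarrow> complex set" where
  "l2_spectrum T = - l2_resolvent_set T"

definition schroedinger ::
  "(real \<Rightarrow> real) \<Rightarrow> real \<Rightarrow> real \<Rightarrow> real \<Rightarrow> (int \<Rightarrow> complex) \<Rightarrow> (int \<Rightarrow> complex)" where
  "schroedinger v lam \<alpha> \<theta> u =
     (\<lambda>n. u (n + 1) + u (n - 1) + complex_of_real (lam * v (\<theta> + real_of_int n * \<alpha>)) * u n)"

text \<open>For irrational \<open>\<alpha>\<close> the spectrum of \<open>schroedinger v lam \<alpha> \<theta>\<close> does not depend on \<open>\<theta>\<close>, so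
  the union below is this common set. The operators being self-adjoint, only real spectral values
  are recorded.\<close>

definition Sigma_spec :: "(real \<Rightarrow> real) \<Rightarrow> real \<Rightarrow> real \<Rightarrow> real set" where
  "Sigma_spec v lam \<alpha> =
     (\<Union>\<theta>. {E. complex_of_real E \<in> l2_spectrum (schroedinger v lam \<alpha> \<theta>)})"


subsection \<open>The dual model\<close>

definition fourier_coeff :: "(real \<Rightarrow> real) \<Rightarrow> int \<Rightarrow> complex" where
  "fourier_coeff v k = integral {0..1} (\<lambda>x. complex_of_real (v x) * cis (- 2 * pi * real_of_int k * x))"

text \<open>For analytic \<open>v\<close> the coefficients decay exponentially, so the sum converges absolutely for
  the polynomially bounded \<open>u\<close> to which the operator is applied below.\<close>

definition dual_op ::
  "(real \<Rightarrow> real) \<Rightarrow> real \<Rightarrow> real \<Rightarrow> real \<Rightarrow> (int \<Rightarrow> complex) \<Rightarrow> (int \<Rightarrow> complex)" where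
  "dual_op v lam \<alpha> \<theta> u =
     (\<lambda>n. (\<Sum>\<^sub>\<infinity>k. complex_of_real lam * fourier_coeff v k * u (n - k))
          + complex_of_real (2 * cos (2 * pi * (\<theta> + real_of_int n * \<alpha>))) * u n)"

definition dual_solution ::
  "(real \<Rightarrow> real) \<Rightarrow> real \<Rightarrow> real \<Rightarrow> real \<Rightarrow> real \<Rightarrow> (int \<Rightarrow> complex) \<Rightarrow> bool" where
  "dual_solution v lam \<alpha> \<theta> E u \<longleftrightarrow> (\<forall>n. dual_op v lam \<alpha> \<theta> u n = complex_of_real E * u n)"


subsection \<open>Resonances\<close>

definition resonances :: "real \<Rightarrow> real \<Rightarrow> real \<Rightarrow> int set" where
  "resonances \<alpha> \<epsilon>0 \<theta> =
     {k. dist_Z (2 * \<theta> - real_of_int k * \<alpha>) \<le> exp (- (real_of_int \<bar>k\<bar> * \<epsilon>0)) \<and>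
         dist_Z (2 * \<theta> - real_of_int k * \<alpha>)
           = Min ((\<lambda>j. dist_Z (2 * \<theta> - real_of_int j * \<alpha>)) ` {j. \<bar>j\<bar> \<le> \<bar>k\<bar>})}"

definition res_index :: "real \<Rightarrow> real \<Rightarrow> real \<Rightarrow> nat set" where
  "res_index \<alpha> \<epsilon>0 \<theta> =
     {j. finite (resonances \<alpha> \<epsilon>0 \<theta>) \<longrightarrow> j < card (resonances \<alpha> \<epsilon>0 \<theta>)}"

text \<open>\<open>r\<close> lists all resonances, without repetition, by non-decreasing absolute value (so
  \<open>r 0 = 0\<close>, as 0 is always a resonance). Two resonances of equal absolute value may be listed in
  either order. Values of \<open>r\<close> outside the index set are irrelevant.\<close>

definition res_enum :: "real \<Rightarrow> real \<Rightarrow> real \<Rightarrow> (nat \<Rightarrow> int) \<Rightarrow> bool" where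
  "res_enum \<alpha> \<epsilon>0 \<theta> r \<longleftrightarrow>
     bij_betw r (res_index \<alpha> \<epsilon>0 \<theta>) (resonances \<alpha> \<epsilon>0 \<theta>) \<and>
     (\<forall>i\<in>res_index \<alpha> \<epsilon>0 \<theta>. \<forall>j\<in>res_index \<alpha> \<epsilon>0 \<theta>. i \<le> j \<longrightarrow> \<bar>r i\<bar> \<le> \<bar>r j\<bar>)"

text \<open>The value \<open>|n\<^sub>j|\<close>, with \<open>|n\<^sub>j| = \<infinity>\<close> past the last resonance.\<close>

definition res_abs :: "real \<Rightarrow> real \<Rightarrow> real \<Rightarrow> (nat \<Rightarrow> int) \<Rightarrow> nat \<Rightarrow> ereal" where
  "res_abs \<alpha> \<epsilon>0 \<theta> r j =
     (if j \<in> res_index \<alpha> \<epsilon>0 \<theta> then ereal (real_of_int \<bar>r j\<bar>) else \<infinity>)"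

text \<open>\<open>e\<^sup>-\<^sup>c\<^sup>N\<close> for \<open>N \<in> [0, \<infinity>]\<close>.\<close>

definition exp_decay :: "real \<Rightarrow> ereal \<Rightarrow> real" where
  "exp_decay c N = (if N = \<infinity> then 0 else exp (- (c * real_of_ereal N)))"


subsection \<open>Almost localization\<close>

definition almost_localized ::
  "(real \<Rightarrow> real) \<Rightarrow> real \<Rightarrow> real \<Rightarrow> real \<Rightarrow> real \<Rightarrow> real \<Rightarrow> real \<Rightarrow> bool" where
  "almost_localized v lam \<alpha> C0 C1 \<epsilon>0 \<epsilon>1 \<longleftrightarrow>
     C0 > 0 \<and> C1 > 0 \<and> \<epsilon>0 > 0 \<and> \<epsilon>1 > 0 \<and>
     (\<forall>\<theta> E u r.
        dual_solution v lam \<alpha> \<theta> E u \<longrightarrow> u 0 = 1 \<longrightarrow>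
        (\<forall>k. cmod (u k) \<le> 1 + real_of_int \<bar>k\<bar>) \<longrightarrow>
        res_enum \<alpha> \<epsilon>0 \<theta> r \<longrightarrow>
        (\<forall>j\<in>res_index \<alpha> \<epsilon>0 \<theta>. \<forall>k.
           C0 * (1 + real_of_int \<bar>r j\<bar>) < real_of_int \<bar>k\<bar> \<longrightarrow>
           ereal (real_of_int \<bar>k\<bar>) < ereal (inverse C0) * res_abs \<alpha> \<epsilon>0 \<theta> r (Suc j) \<longrightarrow>
           cmod (u k) \<le> C1 * exp (- (\<epsilon>1 * real_of_int \<bar>k\<bar>))))"

text \<open>The defining property of the constant \<open>\<lambda>\<^sub>0(v)\<close>.\<close>

definition coupling_threshold :: "(real \<Rightarrow> real) \<Rightarrow> real \<Rightarrow> bool" where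
  "coupling_threshold v lam0 \<longleftrightarrow>
     lam0 > 0 \<and>
     (\<forall>lam \<alpha>. \<bar>lam\<bar> < lam0 \<longrightarrow> \<alpha> \<in> DC \<longrightarrow>
        (\<exists>C0 C1 \<epsilon>0 \<epsilon>1. almost_localized v lam \<alpha> C0 C1 \<epsilon>0 \<epsilon>1))"

text \<open>The property required of a choice \<open>\<theta> = \<theta>(E)\<close>.\<close>

definition dual_phase :: "(real \<Rightarrow> real) \<Rightarrow> real \<Rightarrow> real \<Rightarrow> real \<Rightarrow> real \<Rightarrow> bool" where
  "dual_phase v lam \<alpha> E \<theta> \<longleftrightarrow>
     (\<exists>u. dual_solution v lam \<alpha> \<theta> E u \<and> u 0 = 1 \<and> (\<forall>k. cmod (u k) \<le> 1))"


subsection \<open>Matrix-valued functions\<close>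

definition rot :: "real \<Rightarrow> real^2^2" where
  "rot \<theta> = vector [vector [cos (2 * pi * \<theta>), - sin (2 * pi * \<theta>)],
                   vector [sin (2 * pi * \<theta>), cos (2 * pi * \<theta>)]]"

definition schroedinger_cocycle :: "(real \<Rightarrow> real) \<Rightarrow> real \<Rightarrow> real \<Rightarrow> real \<Rightarrow> real^2^2" where
  "schroedinger_cocycle v lam E x = vector [vector [E - lam * v x, - 1], vector [1, 0]]"

definition SL2 :: "(real^2^2) set" where
  "SL2 = {M. det M = 1}"

definition analytic_SL2_loop :: "(real \<Rightarrow> real^2^2) \<Rightarrow> bool" where
  "analytic_SL2_loop W \<longleftrightarrow>
     periodic1 W \<and> range W \<subseteq> SL2 \<and> (\<forall>i j. real_analytic (\<lambda>x. W x $ i $ j))"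

text \<open>\<open>deg W = m\<close>; here \<open>W\<close> is 1-periodic and is regarded as a loop on \<open>[0, 1]\<close>.\<close>

definition has_degree :: "(real \<Rightarrow> real^2^2) \<Rightarrow> int \<Rightarrow> bool" where
  "has_degree W m \<longleftrightarrow> homotopic_loops SL2 W (\<lambda>x. rot (real_of_int m * x))"

definition strip :: "real \<Rightarrow> complex set" where
  "strip \<epsilon> = {z. \<bar>Im z\<bar> < \<epsilon>}"

definition strip_extension :: "real \<Rightarrow> (real \<Rightarrow> real^2^2) \<Rightarrow> (complex \<Rightarrow> complex^2^2) \<Rightarrow> bool" where
  "strip_extension \<epsilon> f F \<longleftrightarrow>
     (\<forall>i j. (\<lambda>z. F z $ i $ j) holomorphic_on strip \<epsilon>) \<and>
     bounded (F ` strip \<epsilon>) \<and>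
     (\<forall>x i j. F (complex_of_real x) $ i $ j = complex_of_real (f x $ i $ j))"

definition strip_extendable :: "real \<Rightarrow> (real \<Rightarrow> real^2^2) \<Rightarrow> bool" where
  "strip_extendable \<epsilon> f \<longleftrightarrow> (\<exists>F. strip_extension \<epsilon> f F)"

text \<open>\<open>\<parallel>f\<parallel>\<^sub>\<epsilon>\<close>, with the operator norm on matrices. By the identity theorem the extension is unique on
  the strip, so the choice operator is harmless. The value is meaningful only if \<open>f\<close> is
  \<open>strip_extendable \<epsilon>\<close>.\<close>

definition strip_norm :: "real \<Rightarrow> (real \<Rightarrow> real^2^2) \<Rightarrow> real" where
  "strip_norm \<epsilon> f = (SUP z\<in>strip \<epsilon>. onorm ((*v) ((SOME F. strip_extension \<epsilon> f F) z)))"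

end

theory Submission
  imports Defs "HOL-Complex_Analysis.Riemann_Mapping"
begin

text \<open>By Aubry duality, truncating the localised solution of the dual equation between two
  consecutive resonances to a sequence \<open>w\<close> gives a function \<open>u(z) = \<Sum>\<^sub>k w\<^sub>k exp(2\<pi>ikz)\<close> on a strip
  such that \<open>U(x) = (u(x), exp(-2\<pi>i\<theta>) u(x - \<alpha>))\<close> satisfies \<open>A(x) U(x) = exp(2\<pi>i\<theta>) U(x + \<alpha>)\<close> up to an
  error \<open>exp(-cN)\<close>. The Wronskian of \<open>U\<close> and its conjugate solves a cohomological equation with small
  right-hand side, hence is nearly constant. If it were much smaller than a power of \<open>1/L\<close>, then
  iterating the recurrence would make the measure \<open>\<Sum>\<^sub>l |w\<^sub>l|\<^sup>2 \<delta>(\<theta> + l\<alpha>)\<close> nearly symmetric when tested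
  against trigonometric polynomials of degree \<open>O(ln L)\<close>; a non-negative polynomial of this degree that
  peaks at \<open>\<theta>\<close> and nearly vanishes at all relevant reflected phases \<open>-\<theta> - l\<alpha>\<close> excludes this. So the
  real and imaginary parts of \<open>U\<close>, normalised, form the inverse of \<open>W\<close>. The degree of \<open>W\<close> is at most
  the number of zeros of one entry on a period, which a Blaschke product estimate bounds by \<open>O(n)\<close>. The
  Diophantine condition gives \<open>L \<le> C N\<^sup>\<tau>\<close>, so losses polynomial in \<open>L\<close> are absorbed by \<open>exp(-cN)\<close>.\<close>

section \<open>Fourier series on a strip\<close>

text \<open>Why the Wronskian cannot be tiny: if it vanished, \<open>u\<close> and its conjugate
  would be proportional, one wave would carry both Bloch phases \<theta> and -\<theta>, and the
  measure would be symmetric under x -> -x. The atom of mass 1 at \<theta> would need partners among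
  the points -\<theta> - l\<alpha>, and their distance from \<theta> modulo 1 is that of 2\<theta> +
  l\<alpha> from the integers. In a window of length O(ln L) all these distances are at least 1/L,
  and the product of the small ones other than the one at l = -n_j is controlled by the Diophantine
  condition; hence a power of L. A logarithmic window is enough because a resonance satisfies |n_j|
  <= ln L / \<epsilon>0. Almost localization says nothing for |k| <= C0 n, where the dual solution
  is only bounded, so its decay constant \<open>B\<close> is exp(O(n)): a power of L, which is what
  the norms tolerate, with a logarithm linear in n, which is what the degree needs. The undetermined
  sign of \<theta> is the sign of the determinant formed by the real and imaginary parts of
  U.\<close>

definition ee :: "complex \<Rightarrow> complex" where
  "ee z = exp (2 * of_real pi * \<i> * z)"

lemma ee_add: "ee (a + b) = ee a * ee b"
  by (simp add: ee_def distrib_left exp_add)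

lemma ee_0 [simp]: "ee 0 = 1"
  by (simp add: ee_def)

lemma ee_nonzero [simp]: "ee z \<noteq> 0"
  by (simp add: ee_def)

lemma ee_minus: "ee (- z) = inverse (ee z)"
  by (simp add: ee_def exp_minus)

lemma ee_diff: "ee (a - b) = ee a / ee b"
  using ee_add[of a "-b"] by (simp add: ee_minus field_simps)

lemma ee_of_int [simp]: "ee (of_int k) = 1"
proof -
  have "ee (of_int k) = exp (of_int k * (of_real (2 * pi) * \<i>))"
    by (simp add: ee_def algebra_simps)
  also have "\<dots> = 1"
    by (subst exp_eq_1) auto
  finally show ?thesis .
qed

lemma ee_1 [simp]: "ee 1 = 1"
  using ee_of_int[of 1] by simp

lemma ee_plus_1: "ee (z + 1) = ee z"
  by (simp add: ee_add)

lemma norm_ee: "norm (ee z) = exp (- (2 * pi * Im z))"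
  by (simp add: ee_def)

lemma cnj_ee: "cnj (ee z) = ee (- cnj z)"
  by (simp add: ee_def exp_cnj)

lemma ee_of_real: "ee (of_real x) = cis (2 * pi * x)"
  by (simp add: ee_def cis_conv_exp mult_ac)

lemma ee_int_mult_plus_1: "ee (of_int k * (z + 1)) = ee (of_int k * z)"
  by (simp add: distrib_left ee_add)

lemma norm_ee_int_mult_le:
  assumes "2 * pi * \<bar>Im z\<bar> \<le> s"
  shows "norm (ee (of_int k * z)) \<le> exp (s * \<bar>of_int k\<bar>)"
proof -
  have "- (2 * pi * (of_int k * Im z)) \<le> \<bar>2 * pi * (of_int k * Im z)\<bar>"
    by (rule abs_ge_minus_self)
  also have "\<dots> = \<bar>2 * pi * Im z\<bar> * \<bar>of_int k\<bar>"
    by (simp add: abs_mult)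
  also have "\<dots> \<le> s * \<bar>of_int k\<bar>"
    by (rule mult_right_mono) (use assms in \<open>auto simp: abs_mult\<close>)
  finally show ?thesis by (simp add: norm_ee)
qed

lemma holomorphic_ee [holomorphic_intros]:
  "f holomorphic_on A \<Longrightarrow> (\<lambda>z. ee (f z)) holomorphic_on A"
  unfolding ee_def by (intro holomorphic_intros)

lemma continuous_on_ee [continuous_intros]:
  "continuous_on A f \<Longrightarrow> continuous_on A (\<lambda>z. ee (f z))"
  unfolding ee_def by (intro continuous_intros)

definition exp_sum :: "real \<Rightarrow> real" where
  "exp_sum \<epsilon> = (\<Sum>\<^sub>\<infinity>k::int. exp (- (\<epsilon> * \<bar>of_int k\<bar>)))"

lemma summable_on_int_iff_nat:
  fixes f :: "int \<Rightarrow> real"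
  assumes "(\<lambda>n::nat. f (int n)) summable_on UNIV" "(\<lambda>n::nat. f (- int n)) summable_on UNIV"
  shows "f summable_on UNIV"
proof -
  have "f summable_on range int"
    using assms(1) summable_on_reindex[of int UNIV f] by (simp add: o_def)
  moreover have "f summable_on range (\<lambda>n. - int n)"
    using assms(2) summable_on_reindex[of "\<lambda>n. - int n" UNIV f] by (simp add: o_def inj_def)
  ultimately have "f summable_on (range int \<union> range (\<lambda>n. - int n))"
    by (rule summable_on_union)
  also have "range int \<union> range (\<lambda>n. - int n) = UNIV"
    by (auto intro: int_cases2)
  finally show ?thesis .
qed

lemma exp_sum_summable:
  fixes \<epsilon> :: real
  assumes "\<epsilon> > 0"
  shows "(\<lambda>k::int. exp (- (\<epsilon> * \<bar>of_int k\<bar>))) summable_on UNIV"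
proof (rule summable_on_int_iff_nat)
  have "summable (\<lambda>n::nat. exp (-\<epsilon>) ^ n)"
    by (rule summable_geometric) (use assms in auto)
  hence "(\<lambda>n::nat. exp (-\<epsilon>) ^ n) summable_on UNIV"
    by (subst summable_on_UNIV_nonneg_real_iff) auto
  moreover have "exp (-\<epsilon>) ^ n = exp (- (\<epsilon> * of_nat n))" for n
    by (simp flip: exp_of_nat_mult add: mult_ac)
  ultimately show "(\<lambda>n. exp (- (\<epsilon> * \<bar>of_int (int n)\<bar>))) summable_on UNIV"
    "(\<lambda>n. exp (- (\<epsilon> * \<bar>of_int (- int n)\<bar>))) summable_on UNIV"
    by simp_all
qed

lemma exp_sum_ge_1:
  assumes "\<epsilon> > 0"
  shows "exp_sum \<epsilon> \<ge> 1"
proof -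
  have "(\<Sum>\<^sub>\<infinity>k\<in>{0::int}. exp (- (\<epsilon> * \<bar>of_int k\<bar>))) \<le> exp_sum \<epsilon>"
    unfolding exp_sum_def
    by (intro infsum_mono_neutral exp_sum_summable assms) auto
  thus ?thesis by simp
qed

definition exp_decaying :: "real \<Rightarrow> real \<Rightarrow> (int \<Rightarrow> complex) \<Rightarrow> bool" where
  "exp_decaying B \<epsilon> c \<longleftrightarrow> (\<forall>k. norm (c k) \<le> B * exp (- (\<epsilon> * \<bar>of_int k\<bar>)))"

definition fser :: "(int \<Rightarrow> complex) \<Rightarrow> complex \<Rightarrow> complex" where
  "fser c z = (\<Sum>\<^sub>\<infinity>k. c k * ee (of_int k * z))"

lemma exp_decayingD: "exp_decaying B \<epsilon> c \<Longrightarrow> norm (c k) \<le> B * exp (- (\<epsilon> * \<bar>of_int k\<bar>))"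
  by (simp add: exp_decaying_def)

lemma exp_decaying_nonneg: "exp_decaying B \<epsilon> c \<Longrightarrow> B \<ge> 0"
  using exp_decayingD[of B \<epsilon> c 0] by (simp add: order_trans[OF norm_ge_zero])

lemma exp_decaying_mono:
  assumes "exp_decaying B \<epsilon> c" "B \<le> B'" "\<epsilon>' \<le> \<epsilon>"
  shows "exp_decaying B' \<epsilon>' c"
  unfolding exp_decaying_def
proof
  fix k :: int
  have "norm (c k) \<le> B * exp (- (\<epsilon> * \<bar>of_int k\<bar>))" by (rule exp_decayingD[OF assms(1)])
  also have "\<dots> \<le> B' * exp (- (\<epsilon>' * \<bar>of_int k\<bar>))"
    using assms exp_decaying_nonneg[OF assms(1)] by (intro mult_mono) (auto intro: mult_right_mono)
  finally show "norm (c k) \<le> B' * exp (- (\<epsilon>' * \<bar>of_int k\<bar>))" .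
qed

lemma norm_summable_on_bounded:
  fixes f :: "'a \<Rightarrow> complex"
  assumes "g summable_on A" "\<And>x. x \<in> A \<Longrightarrow> norm (f x) \<le> g x"
  shows "(\<lambda>x. norm (f x)) summable_on A" "f summable_on A" "norm (infsum f A) \<le> infsum g A"
proof -
  show *: "(\<lambda>x. norm (f x)) summable_on A"
    by (rule summable_on_comparison_test[OF assms(1)]) (use assms in auto)
  show "f summable_on A" by (rule abs_summable_summable[OF *])
  have "norm (infsum f A) \<le> (\<Sum>\<^sub>\<infinity>x\<in>A. norm (f x))"
    by (rule norm_infsum_bound[OF *])
  also have "\<dots> \<le> infsum g A"
    by (rule infsum_mono[OF * assms(1) assms(2)])
  finally show "norm (infsum f A) \<le> infsum g A" .
qed

lemma exp_decaying_summable: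
  assumes "exp_decaying B \<epsilon> c" "\<epsilon> > 0"
  shows "(\<lambda>k. norm (c k)) summable_on UNIV" "c summable_on UNIV" "norm (infsum c UNIV) \<le> B * exp_sum \<epsilon>"
proof -
  have s: "(\<lambda>k. B * exp (- (\<epsilon> * \<bar>of_int k\<bar>))) summable_on UNIV"
    by (intro summable_on_cmult_right exp_sum_summable assms)
  note * = norm_summable_on_bounded[of _ UNIV c, OF s exp_decayingD[OF assms(1)]]
  show "(\<lambda>k. norm (c k)) summable_on UNIV" "c summable_on UNIV" using * by auto
  show "norm (infsum c UNIV) \<le> B * exp_sum \<epsilon>"
    using *(3) exp_sum_summable[OF assms(2)] by (simp add: exp_sum_def infsum_cmult_right)
qed

text \<open>Half of the rate pays for the growth of the exponentials off the real axis, the other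
  half keeps the series summable. Hence the recurring hypothesis
  \<open>4 * pi * \<bar>Im z\<bar> \<le> \<epsilon>\<close>, half of the width that the decay would
  allow.\<close>

lemma fser_term_decaying:
  assumes "exp_decaying B \<epsilon> c" "4 * pi * \<bar>Im z\<bar> \<le> \<epsilon>"
  shows "exp_decaying B (\<epsilon>/2) (\<lambda>k. c k * ee (of_int k * z))"
  unfolding exp_decaying_def
proof
  fix k :: int
  have "norm (c k * ee (of_int k * z)) \<le> (B * exp (- (\<epsilon> * \<bar>of_int k\<bar>))) * exp ((\<epsilon>/2) * \<bar>of_int k\<bar>)"
    unfolding norm_mult
    by (intro mult_mono exp_decayingD[OF assms(1)] norm_ee_int_mult_le)
       (use assms exp_decaying_nonneg[OF assms(1)] in auto)
  also have "\<dots> = B * exp (- (\<epsilon>/2 * \<bar>of_int k\<bar>))"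
    by (simp add: mult.assoc flip: exp_add)
  finally show "norm (c k * ee (of_int k * z)) \<le> B * exp (- (\<epsilon>/2 * \<bar>of_int k\<bar>))" .
qed

lemma fser_summable:
  assumes "exp_decaying B \<epsilon> c" "\<epsilon> > 0" "4 * pi * \<bar>Im z\<bar> \<le> \<epsilon>"
  shows "(\<lambda>k. c k * ee (of_int k * z)) summable_on UNIV"
    "(\<lambda>k. norm (c k * ee (of_int k * z))) summable_on UNIV"
    "norm (fser c z) \<le> B * exp_sum (\<epsilon>/2)"
  using exp_decaying_summable[OF fser_term_decaying[OF assms(1,3)]] assms(2)
  by (auto simp: fser_def)

lemma open_strip: "open (strip s)"
  unfolding strip_def by (intro open_Collect_less continuous_intros)

lemma fser_uniform_limit:
  assumes "exp_decaying B \<epsilon> c" "\<epsilon> > 0"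
  shows "uniform_limit {z. 4 * pi * \<bar>Im z\<bar> \<le> \<epsilon>} (\<lambda>X z. \<Sum>k\<in>X. c k * ee (of_int k * z))
          (fser c) (finite_subsets_at_top UNIV)"
  unfolding fser_def
proof (rule Weierstrass_m_test_general[where M = "\<lambda>k. B * exp (- (\<epsilon>/2 * \<bar>of_int k\<bar>))"])
  show "norm (c k * ee (of_int k * z)) \<le> B * exp (- (\<epsilon>/2 * \<bar>of_int k\<bar>))"
    if "z \<in> {z. 4 * pi * \<bar>Im z\<bar> \<le> \<epsilon>}" for k z
    using fser_term_decaying[OF assms(1), of z] that by (intro exp_decayingD) auto
  show "(\<lambda>k::int. B * exp (- (\<epsilon>/2 * \<bar>of_int k\<bar>))) summable_on UNIV"
    using assms by (intro summable_on_cmult_right exp_sum_summable) auto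
qed

lemma fser_holomorphic:
  assumes "exp_decaying B \<epsilon> c" "\<epsilon> > 0" "4 * pi * s \<le> \<epsilon>"
  shows "fser c holomorphic_on strip s"
proof (rule analytic_imp_holomorphic, unfold analytic_on_def, safe)
  fix z assume "z \<in> strip s"
  then obtain r where r: "r > 0" "cball z r \<subseteq> strip s"
    using open_contains_cball open_strip by blast
  have sub: "cball z r \<subseteq> {z. 4 * pi * \<bar>Im z\<bar> \<le> \<epsilon>}"
  proof
    fix w assume "w \<in> cball z r"
    hence "\<bar>Im w\<bar> < s" using r by (auto simp: strip_def)
    hence "4 * pi * \<bar>Im w\<bar> \<le> 4 * pi * s" by (intro mult_left_mono) auto
    thus "w \<in> {z. 4 * pi * \<bar>Im z\<bar> \<le> \<epsilon>}"
      using assms(3) unfolding mem_Collect_eq by linarith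
  qed
  have ul: "uniform_limit (cball z r) (\<lambda>X z. \<Sum>k\<in>X. c k * ee (of_int k * z)) (fser c)
      (finite_subsets_at_top UNIV)"
    by (rule uniform_limit_on_subset[OF fser_uniform_limit[OF assms(1,2)] sub])
  have "\<forall>X. continuous_on (cball z r) (\<lambda>z. \<Sum>k\<in>X. c k * ee (of_int k * z)) \<and>
       (\<lambda>z. \<Sum>k\<in>X. c k * ee (of_int k * z)) holomorphic_on ball z r"
    by (auto intro!: continuous_intros holomorphic_intros)
  hence ev: "\<forall>\<^sub>F X in finite_subsets_at_top UNIV.
       continuous_on (cball z r) (\<lambda>z. \<Sum>k\<in>X. c k * ee (of_int k * z)) \<and>
       (\<lambda>z. \<Sum>k\<in>X. c k * ee (of_int k * z)) holomorphic_on ball z r"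
    by (rule always_eventually)
  have "fser c holomorphic_on ball z r"
    by (rule holomorphic_uniform_limit[OF ev ul finite_subsets_at_top_neq_bot])
  thus "\<exists>e>0. fser c holomorphic_on ball z e" using r by blast
qed

lemma fser_continuous_on_reals:
  assumes "exp_decaying B \<epsilon> c" "\<epsilon> > 0"
  shows "continuous_on A (\<lambda>x. fser c (of_real x))"
proof -
  have "fser c holomorphic_on strip (\<epsilon> / (4 * pi))"
    by (rule fser_holomorphic[OF assms]) auto
  hence "continuous_on (strip (\<epsilon> / (4 * pi))) (fser c)"
    by (rule holomorphic_on_imp_continuous_on)
  thus ?thesis
    by (rule continuous_on_compose2) (use assms in \<open>auto intro!: continuous_intros simp: strip_def\<close>)
qed

lemma fser_plus_1: "fser c (z + 1) = fser c z"
  by (simp add: fser_def ee_int_mult_plus_1)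

lemma fser_shift: "fser c (z + a) = fser (\<lambda>k. c k * ee (of_int k * a)) z"
  by (simp add: fser_def distrib_left ee_add mult_ac)

lemma fser_cnj: "cnj (fser c (cnj z)) = fser (\<lambda>k. cnj (c (- k))) z"
proof -
  have "cnj (fser c (cnj z)) = (\<Sum>\<^sub>\<infinity>k. cnj (c k * ee (of_int k * cnj z)))"
    by (simp only: fser_def infsum_cnj)
  also have "\<dots> = (\<Sum>\<^sub>\<infinity>k. cnj (c k) * ee (of_int (- k) * z))"
    by (simp add: cnj_ee)
  also have "\<dots> = (\<Sum>\<^sub>\<infinity>k. cnj (c (- k)) * ee (of_int k * z))"
    by (rule infsum_reindex_bij_witness[of _ uminus uminus]) auto
  finally show ?thesis by (simp add: fser_def)
qed

lemma exp_decaying_reflect: "exp_decaying B \<epsilon> c \<Longrightarrow> exp_decaying B \<epsilon> (\<lambda>k. cnj (c (- k)))"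
  unfolding exp_decaying_def by (metis abs_minus complex_mod_cnj of_int_minus)

lemma exp_decaying_mult:
  assumes "exp_decaying B \<epsilon> c" "\<And>k. norm (d k) \<le> K" "K \<ge> 0"
  shows "exp_decaying (B * K) \<epsilon> (\<lambda>k. c k * d k)"
  unfolding exp_decaying_def
proof
  fix k
  have "norm (c k) * norm (d k) \<le> (B * exp (- (\<epsilon> * \<bar>of_int k\<bar>))) * K"
    using assms exp_decaying_nonneg[OF assms(1)] by (intro mult_mono exp_decayingD) auto
  thus "norm (c k * d k) \<le> B * K * exp (- (\<epsilon> * \<bar>of_int k\<bar>))" by (simp add: norm_mult mult_ac)
qed

lemma exp_decaying_phase:
  assumes "exp_decaying B \<epsilon> c" "\<And>k. norm (d k) = 1"
  shows "exp_decaying B \<epsilon> (\<lambda>k. c k * d k)"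
  using exp_decaying_mult[OF assms(1), of d 1] assms(2) by simp

lemma exp_decaying_add:
  assumes "exp_decaying A \<epsilon> a" "exp_decaying B \<epsilon> b"
  shows "exp_decaying (A + B) \<epsilon> (\<lambda>k. a k + b k)"
  unfolding exp_decaying_def
proof
  fix k
  show "norm (a k + b k) \<le> (A + B) * exp (- (\<epsilon> * \<bar>of_int k\<bar>))"
    using norm_triangle_ineq[of "a k" "b k"] exp_decayingD[OF assms(1), of k] exp_decayingD[OF assms(2), of k]
    by (simp add: distrib_right)
qed

lemma exp_decaying_uminus: "exp_decaying A \<epsilon> a \<Longrightarrow> exp_decaying A \<epsilon> (\<lambda>k. - a k)"
  by (simp add: exp_decaying_def)

lemma fser_add:
  assumes "exp_decaying A \<epsilon> a" "exp_decaying B \<epsilon> b" "\<epsilon> > 0" "4 * pi * \<bar>Im z\<bar> \<le> \<epsilon>"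
  shows "fser (\<lambda>k. a k + b k) z = fser a z + fser b z"
  using fser_summable(1)[OF assms(1,3,4)] fser_summable(1)[OF assms(2,3,4)]
  by (simp add: fser_def distrib_right infsum_add)

lemma fser_cmult: "fser (\<lambda>k. x * c k) z = x * fser c z"
  by (simp add: fser_def mult.assoc infsum_cmult_right')

lemma fser_uminus: "fser (\<lambda>k. - c k) z = - fser c z"
  using fser_cmult[of "-1" c z] by simp

section \<open>Convolution of coefficient sequences and products of Fourier series\<close>

definition conv :: "(int \<Rightarrow> complex) \<Rightarrow> (int \<Rightarrow> complex) \<Rightarrow> int \<Rightarrow> complex" where
  "conv a b n = (\<Sum>\<^sub>\<infinity>k. a k * b (n - k))"

text \<open>The sum |k| + |n - k| is at least |n| and at least |k|, hence at least their mean. One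
  half yields decay in n, the other makes the sum over k converge; this is why every product of
  series halves the rate.\<close>

lemma conv_term_bound:
  assumes "exp_decaying A \<epsilon> a" "exp_decaying B \<epsilon> b" "\<epsilon> > 0"
  shows "exp_decaying (A * B * exp (- (\<epsilon>/2 * \<bar>of_int n\<bar>))) (\<epsilon>/2) (\<lambda>k. a k * b (n - k))"
  unfolding exp_decaying_def
proof
  fix k :: int
  have nn: "A \<ge> 0" "B \<ge> 0" using assms exp_decaying_nonneg by blast+
  have "norm (a k * b (n - k)) \<le> (A * exp (- (\<epsilon> * \<bar>of_int k\<bar>))) * (B * exp (- (\<epsilon> * \<bar>of_int (n - k)\<bar>)))"
    unfolding norm_mult by (intro mult_mono exp_decayingD assms) (use nn in auto)
  also have "\<dots> = A * B * (exp (- (\<epsilon> * \<bar>of_int k\<bar>)) * exp (- (\<epsilon> * \<bar>of_int (n - k)\<bar>)))"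
    by (simp only: mult_ac)
  also have "\<dots> = A * B * exp (- (\<epsilon> * (\<bar>of_int k\<bar> + \<bar>of_int (n - k)\<bar>)))"
    by (simp only: mult_exp_exp) (simp add: algebra_simps)
  also have "\<dots> \<le> A * B * exp (- (\<epsilon> * (\<bar>of_int n\<bar> / 2 + \<bar>of_int k\<bar> / 2)))"
    using nn \<open>\<epsilon> > 0\<close> by (intro mult_left_mono) (auto intro!: mult_left_mono)
  also have "\<dots> = A * B * exp (- (\<epsilon>/2 * \<bar>of_int n\<bar>)) * exp (- (\<epsilon>/2 * \<bar>of_int k\<bar>))"
    by (simp only: mult.assoc mult_exp_exp) (simp add: algebra_simps add_divide_distrib)
  finally show "norm (a k * b (n - k)) \<le> \<dots>" .
qed

lemma exp_decaying_conv:
  assumes "exp_decaying A \<epsilon> a" "exp_decaying B \<epsilon> b" "\<epsilon> > 0"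
  shows "exp_decaying (A * B * exp_sum (\<epsilon>/2)) (\<epsilon>/2) (conv a b)"
  unfolding exp_decaying_def conv_def
proof
  fix n :: int
  show "norm (\<Sum>\<^sub>\<infinity>k. a k * b (n - k)) \<le> A * B * exp_sum (\<epsilon>/2) * exp (- (\<epsilon>/2 * \<bar>of_int n\<bar>))"
    using exp_decaying_summable(3)[OF conv_term_bound[OF assms, of n]] assms(3) by (simp add: mult_ac)
qed

lemma infsum_mult_conv:
  assumes "exp_decaying A \<epsilon> a" "exp_decaying B \<epsilon> b" "\<epsilon> > 0"
  shows "infsum a UNIV * infsum b UNIV = (\<Sum>\<^sub>\<infinity>n. \<Sum>\<^sub>\<infinity>k. a k * b (n - k))"
proof -
  note sa = exp_decaying_summable[OF assms(1,3)] and sb = exp_decaying_summable[OF assms(2,3)]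
  have "(\<lambda>p. norm ((\<lambda>(k,m). a k * b m) p)) summable_on (UNIV \<times> UNIV)"
  proof (subst Infinite_Sum.abs_summable_on_Sigma_iff, intro conjI ballI)
    show "(\<lambda>m. norm (case (k, m) of (k, m) \<Rightarrow> a k * b m)) summable_on UNIV" for k
      using sb(1) by (simp add: norm_mult summable_on_cmult_right)
    have "(\<lambda>k. norm (a k) * (\<Sum>\<^sub>\<infinity>m. norm (b m))) summable_on UNIV"
      by (rule summable_on_cmult_left[OF sa(1)])
    thus "(\<lambda>k. norm (\<Sum>\<^sub>\<infinity>m. norm (case (k, m) of (k, m) \<Rightarrow> a k * b m))) summable_on UNIV"
      by (simp add: norm_mult infsum_cmult_right' abs_mult infsum_nonneg)
  qed
  hence s: "(\<lambda>(k,m). a k * b m) summable_on (UNIV \<times> UNIV)"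
    by (rule abs_summable_summable)
  have "infsum a UNIV * infsum b UNIV = (\<Sum>\<^sub>\<infinity>k. \<Sum>\<^sub>\<infinity>m. a k * b m)"
    by (simp add: infsum_cmult_right' infsum_cmult_left')
  also have "\<dots> = (\<Sum>\<^sub>\<infinity>(k,m)\<in>UNIV \<times> UNIV. a k * b m)"
    by (rule infsum_Sigma'_banach[OF s])
  also have "\<dots> = (\<Sum>\<^sub>\<infinity>(n,k)\<in>UNIV \<times> UNIV. a k * b (n - k))"
    by (rule infsum_reindex_bij_witness[of _ "\<lambda>(n,k). (k, n - k)" "\<lambda>(k,m). (k + m, k)"]) auto
  also have "\<dots> = (\<Sum>\<^sub>\<infinity>n. \<Sum>\<^sub>\<infinity>k. a k * b (n - k))"
  proof (rule infsum_Sigma'_banach[symmetric])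
    have "((\<lambda>(k,m). a k * b m) \<circ> (\<lambda>(n,k). (k, n - k))) summable_on UNIV \<times> UNIV"
    proof (subst summable_on_reindex[symmetric])
      show "inj_on (\<lambda>(n, k). (k, n - k)) (UNIV \<times> UNIV :: (int \<times> int) set)"
        by (auto simp: inj_on_def)
      have "(\<lambda>(n, k). (k, n - k)) ` (UNIV \<times> UNIV :: (int \<times> int) set) = UNIV"
      proof (intro equalityI subsetI)
        fix x :: "int \<times> int"
        have "x = (\<lambda>(n, k). (k, n - k)) (fst x + snd x, fst x)" by (cases x) auto
        thus "x \<in> (\<lambda>(n, k). (k, n - k)) ` (UNIV \<times> UNIV :: (int \<times> int) set)" by blast
      qed auto
      thus "(\<lambda>(k,m). a k * b m) summable_on (\<lambda>(n, k). (k, n - k)) ` (UNIV \<times> UNIV :: (int \<times> int) set)"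
        using s by simp
    qed
    thus "(\<lambda>(n, k). a k * b (n - k)) summable_on UNIV \<times> UNIV"
      by (simp add: o_def case_prod_unfold)
  qed
  finally show ?thesis .
qed

lemma fser_mult:
  assumes "exp_decaying A \<epsilon> a" "exp_decaying B \<epsilon> b" "\<epsilon> > 0" "4 * pi * \<bar>Im z\<bar> \<le> \<epsilon>"
  shows "fser a z * fser b z = fser (conv a b) z"
proof -
  have "fser a z * fser b z =
        (\<Sum>\<^sub>\<infinity>n. \<Sum>\<^sub>\<infinity>k. (a k * ee (of_int k * z)) * (b (n - k) * ee (of_int (n - k) * z)))"
    unfolding fser_def
    by (rule infsum_mult_conv[OF fser_term_decaying[OF assms(1,4)] fser_term_decaying[OF assms(2,4)]])
       (use assms in auto)
  also have "\<dots> = (\<Sum>\<^sub>\<infinity>n. \<Sum>\<^sub>\<infinity>k. (a k * b (n - k)) * ee (of_int n * z))"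
  proof (intro infsum_cong)
    fix n k :: int
    have "ee (of_int n * z) = ee (of_int k * z) * ee (of_int (n - k) * z)"
      by (simp add: ee_add[symmetric] algebra_simps)
    thus "(a k * ee (of_int k * z)) * (b (n - k) * ee (of_int (n - k) * z)) =
      (a k * b (n - k)) * ee (of_int n * z)" by simp
  qed
  also have "\<dots> = fser (conv a b) z"
    by (simp add: fser_def conv_def infsum_cmult_left')
  finally show ?thesis .
qed

section \<open>Means over a period and uniqueness of Fourier coefficients\<close>

lemma has_integral_ee:
  "((\<lambda>x. ee (of_int k * of_real x)) has_integral (if k = 0 then 1 else 0)) {0..1}"
proof (cases "k = 0")
  case False
  define F where "F = (\<lambda>x::real. ee (of_int k * of_real x) / (2 * of_real pi * \<i> * of_int k))"
  have "((\<lambda>x. ee (of_int k * of_real x)) has_integral (F 1 - F 0)) {0..1}"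
  proof (rule fundamental_theorem_of_calculus)
    show "(F has_vector_derivative ee (of_int k * of_real x)) (at x within {0..1})" for x
      unfolding F_def ee_def using False
      by (auto intro!: derivative_eq_intros has_vector_derivative_real_field
          simp: field_simps)
  qed auto
  thus ?thesis using False by (simp add: F_def)
next
  case True
  thus ?thesis using has_integral_const_real[of "1::complex" 0 1] by simp
qed

lemma fser_mean:
  assumes "exp_decaying B \<epsilon> c" "\<epsilon> > 0"
  shows "((\<lambda>x. fser c (of_real x)) has_integral c 0) {0..1}"
proof -
  have "uniform_limit (of_real ` {0..1}) (\<lambda>X z. \<Sum>k\<in>X. c k * ee (of_int k * z))
          (fser c) (finite_subsets_at_top UNIV)"
    by (rule uniform_limit_on_subset[OF fser_uniform_limit[OF assms]]) (use assms in auto)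
  hence ul: "uniform_limit {0..1} (\<lambda>X x. \<Sum>k\<in>X. c k * ee (of_int k * of_real x))
     (\<lambda>x. fser c (of_real x)) (finite_subsets_at_top UNIV)"
    by (auto simp: uniform_limit_iff)
  have cont: "continuous_on {0..1} (\<lambda>x::real. \<Sum>k\<in>X. c k * ee (of_int k * of_real x))" for X
    by (intro continuous_intros)
  obtain I J where I: "\<And>X. ((\<lambda>x. \<Sum>k\<in>X. c k * ee (of_int k * of_real x)) has_integral I X) {0..1}"
    and J: "((\<lambda>x. fser c (of_real x)) has_integral J) {0..1}"
    and lim: "(I \<longlongrightarrow> J) (finite_subsets_at_top UNIV)"
    using uniform_limit_integral[OF ul cont finite_subsets_at_top_neq_bot] by blast
  have IX: "I X = c 0" if "finite X" "{0} \<subseteq> X" for X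
  proof -
    have "((\<lambda>x. \<Sum>k\<in>X. c k * ee (of_int k * of_real x)) has_integral (\<Sum>k\<in>X. c k * (if k = 0 then 1 else 0)))
        {0..1}"
      by (intro has_integral_sum has_integral_mult_right has_integral_ee that)
    hence "I X = (\<Sum>k\<in>X. c k * (if k = 0 then 1 else 0))"
      using I has_integral_unique by blast
    also have "\<dots> = (\<Sum>k\<in>{0}. c k)"
      by (rule sum.mono_neutral_cong_right) (use that in auto)
    finally show ?thesis by simp
  qed
  have "\<forall>\<^sub>F X in finite_subsets_at_top UNIV. I X = c 0"
    unfolding eventually_finite_subsets_at_top using IX by (intro exI[of _ "{0}"]) auto
  hence "(I \<longlongrightarrow> c 0) (finite_subsets_at_top UNIV)"
    by (rule tendsto_eventually)
  with lim have "J = c 0"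
    using tendsto_unique[OF finite_subsets_at_top_neq_bot] by blast
  thus ?thesis using J by simp
qed

text \<open>Multiplication by the exponential of frequency -n moves the n-th coefficient to index 0,
  where \<open>fser_mean\<close> recovers it. This allows functional equations on the real axis to
  be read off coefficient by coefficient.\<close>

lemma fser_coeff_unique:
  assumes "exp_decaying A \<epsilon> a" "exp_decaying B \<epsilon>' b" "\<epsilon> > 0" "\<epsilon>' > 0"
    and "\<And>x::real. fser a (of_real x) = fser b (of_real x)"
  shows "a = b"
proof
  fix n
  have shift: "((\<lambda>x. fser c (of_real x) * ee (- (of_int n * of_real x))) has_integral c n) {0..1}"
    if c: "exp_decaying C \<delta> c" "\<delta> > 0" for C \<delta> c
  proof -
    have eq: "fser c z * ee (- (of_int n * z)) = fser (\<lambda>k. c (k + n)) z" for z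
    proof -
      have "fser c z * ee (- (of_int n * z)) = (\<Sum>\<^sub>\<infinity>k. (c k * ee (of_int k * z)) * ee (- (of_int n * z)))"
        by (simp only: fser_def infsum_cmult_left')
      also have "\<dots> = (\<Sum>\<^sub>\<infinity>k. c k * ee (of_int (k - n) * z))"
        by (simp only: mult.assoc ee_add[symmetric]) (simp add: algebra_simps)
      also have "\<dots> = (\<Sum>\<^sub>\<infinity>k. c (k + n) * ee (of_int k * z))"
        by (rule infsum_reindex_bij_witness[of _ "\<lambda>k. k + n" "\<lambda>k. k - n"]) auto
      finally show ?thesis by (simp add: fser_def)
    qed
    have "exp_decaying (C * exp (\<delta> * \<bar>of_int n\<bar>)) \<delta> (\<lambda>k. c (k + n))"
      unfolding exp_decaying_def
    proof
      fix k
      have "norm (c (k + n)) \<le> C * exp (- (\<delta> * \<bar>of_int (k + n)\<bar>))" by (rule exp_decayingD[OF c(1)])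
      also have "\<dots> \<le> C * exp (\<delta> * \<bar>of_int n\<bar> + - (\<delta> * \<bar>of_int k\<bar>))"
      proof -
        have "\<delta> * \<bar>of_int k\<bar> \<le> \<delta> * (\<bar>of_int n\<bar> + \<bar>of_int (k + n)\<bar>)"
          using c(2) by (intro mult_left_mono) auto
        hence "- (\<delta> * \<bar>of_int (k + n)\<bar>) \<le> \<delta> * \<bar>of_int n\<bar> + - (\<delta> * \<bar>of_int k\<bar>)"
          by (simp add: distrib_left)
        thus ?thesis using exp_decaying_nonneg[OF c(1)]
          by (intro mult_left_mono) (simp_all only: exp_le_cancel_iff)
      qed
      finally show "norm (c (k + n)) \<le> C * exp (\<delta> * \<bar>of_int n\<bar>) * exp (- (\<delta> * \<bar>of_int k\<bar>))"
        by (simp only: exp_add mult.assoc)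
    qed
    from fser_mean[OF this c(2)] show ?thesis by (simp add: eq)
  qed
  show "a n = b n"
    using shift[OF assms(1,3)] shift[OF assms(2,4)] unfolding assms(5) by (rule has_integral_unique)
qed

section \<open>Fourier expansion of periodic analytic functions\<close>

text \<open>A primitive \<open>P\<close> exists on the convex strip, and
  \<open>P (z + 1) - P z\<close> has derivative zero by periodicity. Both integrals equal this
  constant, so no contour has to be closed.\<close>

lemma strip_integral_shift:
  assumes hol: "G holomorphic_on strip s" and per: "\<And>z. z \<in> strip s \<Longrightarrow> G (z + 1) = G z"
    and a: "a \<in> strip s"
  shows "integral {0..1} (\<lambda>x. G (of_real x + a)) = integral {0..1} (\<lambda>x. G (of_real x))"
proof -
  have cvx: "convex (strip s)"
  proof -
    have "strip s = {z. Im z < s} \<inter> {z. Im z > - s}" by (auto simp: strip_def)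
    thus ?thesis by (simp add: convex_Int convex_halfspace_Im_lt convex_halfspace_Im_gt)
  qed
  obtain P where P: "\<And>z. z \<in> strip s \<Longrightarrow> (P has_field_derivative G z) (at z)"
    using holomorphic_convex_primitive'[OF cvx open_strip hol]
    by (metis at_within_open open_strip)
  have line: "((\<lambda>x. G (of_real x + t)) has_integral (P (1 + t) - P t)) {0..1}"
    if t: "t \<in> strip s" for t
  proof -
    have "((\<lambda>x. P (of_real x + t)) has_vector_derivative G (of_real x + t)) (at x within {0..1})" for x
    proof -
      have "((\<lambda>x. of_real x + t) has_vector_derivative 1) (at x within {0..1})"
        by (auto intro!: derivative_eq_intros)
      from field_vector_diff_chain_within[OF this, of P "G (of_real x + t)"]
      show ?thesis using P[of "of_real x + t"] t
        by (auto simp: strip_def o_def intro: has_field_derivative_at_within)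
    qed
    hence "((\<lambda>x. G (of_real x + t)) has_integral
       (P (of_real 1 + t) - P (of_real 0 + t))) {0..1}"
      by (intro fundamental_theorem_of_calculus) auto
    thus ?thesis by simp
  qed
  have const: "P (z + 1) - P z = P (0 + 1) - P 0" if "z \<in> strip s" for z
  proof -
    have z0: "0 \<in> strip s" using a by (auto simp: strip_def)
    have "\<exists>c. \<forall>z\<in>strip s. P (z + 1) - P z = c"
    proof (rule has_field_derivative_zero_constant[OF cvx])
      fix z assume z: "z \<in> strip s"
      hence z1: "z + 1 \<in> strip s" by (simp add: strip_def)
      have "((\<lambda>z. P (z + 1) - P z) has_field_derivative (G (z + 1) * (1 + 0) - G z)) (at z within strip s)"
        by (intro derivative_intros DERIV_chain2[where f = P and g = "\<lambda>z. z + 1", OF P[OF z1]]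
            has_field_derivative_at_within[OF P[OF z]])
      thus "((\<lambda>z. P (z + 1) - P z) has_field_derivative 0) (at z within strip s)"
        using per[OF z] by simp
    qed
    thus ?thesis using z0 that by metis
  qed
  show ?thesis
    using integral_unique[OF line[OF a]] integral_unique[OF line[of 0]] const[OF a] a
    by (simp add: strip_def add.commute)
qed

definition fcoeff :: "(complex \<Rightarrow> complex) \<Rightarrow> int \<Rightarrow> complex" where
  "fcoeff G k = integral {0..1} (\<lambda>x. G (of_real x) * ee (- (of_int k * of_real x)))"

lemma fcoeff_decaying:
  assumes hol: "G holomorphic_on strip s" and per: "\<And>z. z \<in> strip s \<Longrightarrow> G (z + 1) = G z"
    and bd: "\<And>x. x \<in> {0..1} \<Longrightarrow> norm (G (of_real x + \<i> * of_real y)) \<le> K"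
      "\<And>x. x \<in> {0..1} \<Longrightarrow> norm (G (of_real x + \<i> * of_real (- y))) \<le> K"
    and "0 < y" "y < s"
  shows "exp_decaying K (2 * pi * y) (fcoeff G)"
  unfolding exp_decaying_def
proof
  fix k :: int
  \<comment> \<open>The line of integration goes down for k >= 0 and up for k < 0, so that the
    exponential factor has modulus exp(-2 pi y |k|) on it.\<close>
  define t where "t = (if k \<ge> 0 then - y else y)"
  define H where "H = (\<lambda>z. G z * ee (- (of_int k * z)))"
  have t: "\<i> * of_real t \<in> strip s" unfolding strip_def using assms by (auto simp: t_def)
  have holH: "H holomorphic_on strip s"
    unfolding H_def by (intro holomorphic_intros hol)
  have "H (z + 1) = H z" if "z \<in> strip s" for z
    using per[OF that] by (simp add: H_def distrib_left ee_diff ee_minus field_simps ee_add)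
  from strip_integral_shift[OF holH this t]
  have eq: "fcoeff G k = integral {0..1} (\<lambda>x. H (of_real x + \<i> * of_real t))"
    by (simp add: fcoeff_def H_def)
  have kt: "of_int k * t = - (y * \<bar>of_int k\<bar>)" by (auto simp: t_def)
  have bound: "norm (H (of_real x + \<i> * of_real t)) \<le> K * exp (- (2 * pi * y * \<bar>of_int k\<bar>))"
    if x: "x \<in> {0..1}" for x
  proof -
    have "norm (H (of_real x + \<i> * of_real t)) =
       norm (G (of_real x + \<i> * of_real t)) * exp (2 * pi * (of_int k * t))"
      by (simp add: H_def norm_mult norm_ee)
    also have "\<dots> \<le> K * exp (2 * pi * (of_int k * t))"
      using bd[OF x] by (intro mult_right_mono) (auto simp: t_def)
    finally show ?thesis by (simp only: kt) (simp add: mult_ac)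
  qed
  have "continuous_on {0..1} (\<lambda>x. H (of_real x + \<i> * of_real t))"
    by (rule continuous_on_compose2[OF holomorphic_on_imp_continuous_on[OF holH]])
       (use t in \<open>auto intro!: continuous_intros simp: strip_def\<close>)
  hence "norm (integral {0..1} (\<lambda>x. H (of_real x + \<i> * of_real t)))
      \<le> K * exp (- (2 * pi * y * \<bar>of_int k\<bar>)) * (1 - 0)"
    by (intro integral_bound) (auto intro: bound)
  thus "norm (fcoeff G k) \<le> K * exp (- (2 * pi * y * \<bar>of_int k\<bar>))"
    by (simp add: eq)
qed

lemma fcoeff_decaying_ex:
  assumes hol: "G holomorphic_on strip s" and per: "\<And>z. z \<in> strip s \<Longrightarrow> G (z + 1) = G z"
    and y: "0 < y" "y < s"
  shows "\<exists>K. exp_decaying K (2 * pi * y) (fcoeff G)"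
proof -
  have "\<exists>K. \<forall>x\<in>{0..1}. norm (G (of_real x + \<i> * of_real t)) \<le> K" if "\<bar>t\<bar> < s" for t
  proof -
    have "continuous_on {0..1} (\<lambda>x. G (of_real x + \<i> * of_real t))"
      by (rule continuous_on_compose2[OF holomorphic_on_imp_continuous_on[OF hol]])
         (use that in \<open>auto intro!: continuous_intros simp: strip_def\<close>)
    hence "bounded ((\<lambda>x. G (of_real x + \<i> * of_real t)) ` {0..1})"
      by (intro compact_imp_bounded compact_continuous_image) auto
    thus ?thesis unfolding bounded_iff by blast
  qed
  from this[of y] this[of "- y"] y obtain K1 K2 where
    K: "\<forall>x\<in>{0..1}. norm (G (of_real x + \<i> * of_real y)) \<le> K1"
      "\<forall>x\<in>{0..1}. norm (G (of_real x + \<i> * of_real (- y))) \<le> K2" by auto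
  have "exp_decaying (max K1 K2) (2 * pi * y) (fcoeff G)"
    by (rule fcoeff_decaying[OF hol per _ _ y]) (use K in \<open>auto simp: le_max_iff_disj\<close>)
  thus ?thesis by blast
qed

lemma ee_eq_1_iff: "ee z = 1 \<longleftrightarrow> (\<exists>k::int. z = of_int k)"
proof -
  have "ee z = 1 \<longleftrightarrow> (\<exists>k::int. 2 * of_real pi * \<i> * z = of_int (2 * k) * of_real pi * \<i>)"
    unfolding ee_def exp_eq_1 by (auto simp: complex_eq_iff)
  also have "\<dots> \<longleftrightarrow> (\<exists>k::int. z = of_int k)" by (auto simp: field_simps)
  finally show ?thesis .
qed

text \<open>Chernoff's proof of Fourier inversion at a point: dividing \<open>G - G a\<close> by \<open>ee (z - a) - 1\<close> gives
  another periodic function on the strip, and the Fourier coefficients telescope.\<close>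

lemma chernoff_quotient:
  assumes hol: "G holomorphic_on strip s" and s: "s > 0"
    and per: "\<And>z. z \<in> strip s \<Longrightarrow> G (z + 1) = G z" and "G 0 = 0"
  obtains H where "H holomorphic_on strip s" "\<And>z. z \<in> strip s \<Longrightarrow> H (z + 1) = H z"
    "\<And>z. z \<in> strip s \<Longrightarrow> G z = H z * (ee z - 1)"
proof -
  define Q where "Q = (\<lambda>z. if z = 0 then deriv G 0 else (G z - G 0) / (z - 0))"
  define E where "E = (\<lambda>z. if z = 0 then deriv ee 0 else (ee z - ee 0) / (z - 0))"
  \<comment> \<open>At the integers this is the value of the removable singularity: the limit of
    \<open>G z / (ee z - 1)\<close> at 0, repeated by periodicity.\<close>
  define H where "H = (\<lambda>z. if ee z = 1 then deriv G 0 / (2 * of_real pi * \<i>) else G z / (ee z - 1))"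
  have Gint: "G (of_int k) = 0" for k :: int
  proof -
    have sI: "of_int k \<in> strip s" for k using s by (simp add: strip_def)
    show ?thesis
    proof (induction k rule: int_induct[where k = 0])
      case (step1 i) thus ?case using per[OF sI[of i]] by simp
    next
      case (step2 i) thus ?case using per[OF sI[of "i - 1"]] by simp
    qed (use \<open>G 0 = 0\<close> in auto)
  qed
  have dee: "deriv ee 0 = 2 * of_real pi * \<i>"
    unfolding ee_def[abs_def] by (rule DERIV_imp_deriv) (auto intro!: derivative_eq_intros)
  have Qhol: "Q holomorphic_on strip s"
    unfolding Q_def by (rule pole_lemma_open[OF hol open_strip])
  have Ehol: "E holomorphic_on UNIV"
    unfolding E_def by (rule pole_lemma_open) (auto intro!: holomorphic_intros)
  have Enz: "E z \<noteq> 0" if "z \<in> ball 0 1" for z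
  proof (cases "z = 0")
    case True thus ?thesis by (simp add: E_def dee)
  next
    case False
    have "ee z \<noteq> 1"
    proof
      assume "ee z = 1"
      then obtain k :: int where k: "z = of_int k" unfolding ee_eq_1_iff by blast
      thus False using False that by (auto simp: norm_of_int)
    qed
    thus ?thesis using False by (simp add: E_def)
  qed
  have Hper: "H (z + 1) = H z" if "z \<in> strip s" for z
    using per[OF that] by (simp add: H_def ee_plus_1)
  have HQE: "H z = Q z / E z" if z: "z \<in> ball 0 1" for z
  proof (cases "z = 0")
    case True thus ?thesis by (simp add: H_def Q_def E_def dee)
  next
    case False
    hence "ee z \<noteq> 1" using Enz[OF z] by (auto simp: E_def)
    thus ?thesis using False \<open>G 0 = 0\<close> by (simp add: H_def Q_def E_def)
  qed
  \<comment> \<open>Near 0, numerator and denominator are both divided by z, and \<open>E\<close>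
    has no zero in the unit disc. Translation by k carries this to the other integers.\<close>
  have H0: "\<exists>e>0. H holomorphic_on ball (of_int k) e" for k :: int
  proof -
    define r where "r = min 1 s"
    have r: "r > 0" "ball 0 r \<subseteq> ball 0 1" using s by (auto simp: r_def)
    have br: "ball 0 r \<subseteq> strip s"
    proof
      fix z :: complex assume "z \<in> ball 0 r"
      thus "z \<in> strip s" using abs_Im_le_cmod[of z] by (auto simp: strip_def r_def)
    qed
    have "(\<lambda>z. Q z / E z) holomorphic_on ball 0 r"
      by (intro holomorphic_on_divide holomorphic_on_subset[OF Qhol br] holomorphic_on_subset[OF Ehol])
         (use Enz subsetD[OF r(2)] in blast)+
    hence *: "H holomorphic_on ball 0 r"
      by (rule holomorphic_transform) (use HQE subsetD[OF r(2)] in metis)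
    have "(\<lambda>z. H (z - of_int k)) holomorphic_on ball (of_int k) r"
      by (rule holomorphic_on_compose_gen[OF _ *, unfolded o_def])
         (auto intro!: holomorphic_intros simp: dist_norm norm_minus_commute)
    moreover have "H (z - of_int k) = H z" if "z \<in> ball (of_int k) r" for z
    proof -
      have zs: "z - of_int j \<in> strip s" for j
      proof -
        have "z - of_int k \<in> strip s" using that br by (auto simp: dist_norm norm_minus_commute subset_iff)
        thus ?thesis by (simp add: strip_def)
      qed
      show ?thesis
      proof (induction k rule: int_induct[where k = 0])
        case (step1 i) thus ?case using Hper[OF zs[of "i + 1"]] by (simp add: algebra_simps)
      next
        case (step2 i) thus ?case using Hper[OF zs[of i]] by (simp add: algebra_simps)
      qed auto
    qed
    ultimately have "H holomorphic_on ball (of_int k) r" by (rule holomorphic_transform)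
    thus ?thesis using r by blast
  qed
  have "H holomorphic_on strip s"
  proof (rule analytic_imp_holomorphic, unfold analytic_on_def, intro ballI)
    fix z assume z: "z \<in> strip s"
    show "\<exists>e>0. H holomorphic_on ball z e"
    proof (cases "ee z = 1")
      case True thus ?thesis using H0 by (auto simp: ee_eq_1_iff)
    next
      case False
      have op: "open (strip s \<inter> {z. ee z \<noteq> 1})"
        by (intro open_Int open_strip open_Collect_neq continuous_intros)
      have "(\<lambda>z. G z / (ee z - 1)) holomorphic_on strip s \<inter> {z. ee z \<noteq> 1}"
        by (intro holomorphic_intros holomorphic_on_subset[OF hol]) auto
      hence *: "H holomorphic_on strip s \<inter> {z. ee z \<noteq> 1}"
        by (rule holomorphic_transform) (auto simp: H_def)
      obtain e where "e > 0" "ball z e \<subseteq> strip s \<inter> {z. ee z \<noteq> 1}"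
        using op z False open_contains_ball[of "strip s \<inter> {z. ee z \<noteq> 1}"] by blast
      thus ?thesis using holomorphic_on_subset[OF *] by blast
    qed
  qed
  moreover have "G z = H z * (ee z - 1)" if "z \<in> strip s" for z
    using Gint by (auto simp: H_def ee_eq_1_iff)
  ultimately show ?thesis using Hper that by blast
qed

lemma fourier_inversion_0:
  assumes hol: "G holomorphic_on strip s" and s: "s > 0" and per: "\<And>z. z \<in> strip s \<Longrightarrow> G (z + 1) = G z"
  shows "infsum (fcoeff G) UNIV = G 0"
proof -
  define \<delta> where "\<delta> = 2 * pi * (s/2)"
  have "\<delta> > 0" using s by (simp add: \<delta>_def)
  obtain KG where "exp_decaying KG \<delta> (fcoeff G)"
    using fcoeff_decaying_ex[OF hol per, of "s/2"] s by (auto simp: \<delta>_def)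
  hence summ: "fcoeff G summable_on UNIV" using \<open>\<delta> > 0\<close> by (rule exp_decaying_summable)
  define G' where "G' = (\<lambda>z. G z - G 0)"
  obtain H where H: "H holomorphic_on strip s" "\<And>z. z \<in> strip s \<Longrightarrow> H (z + 1) = H z"
    "\<And>z. z \<in> strip s \<Longrightarrow> G' z = H z * (ee z - 1)"
    by (rule chernoff_quotient[of G' s])
       (use per s in \<open>auto simp: G'_def intro!: holomorphic_intros hol\<close>)
  have cont: "continuous_on {0..1} (\<lambda>x. F (of_real x))" if "F holomorphic_on strip s" for F
    by (rule continuous_on_compose2[OF holomorphic_on_imp_continuous_on[OF that]])
       (use s in \<open>auto intro!: continuous_intros simp: strip_def\<close>)
  have intH: "(\<lambda>x. H (of_real x) * ee (- (of_int k * of_real x))) integrable_on {0..1}" for k :: int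
    by (intro integrable_continuous_real continuous_intros cont H)
  \<comment> \<open>The constant \<open>G 0\<close> only feeds the coefficient at 0, and the factor
    \<open>ee z - 1\<close> becomes a difference of neighbouring coefficients of
    \<open>H\<close>.\<close>
  have tele: "fcoeff G k = (if k = 0 then G 0 else 0) + (fcoeff H (k - 1) - fcoeff H k)" for k
  proof -
    have "G (of_real x) * ee (- (of_int k * of_real x)) = G 0 * ee (of_int (- k) * of_real x) +
       (H (of_real x) * ee (- (of_int (k - 1) * of_real x)) - H (of_real x) * ee (- (of_int k * of_real x)))"
           for x
    proof -
      have "G (of_real x) = G 0 + H (of_real x) * (ee (of_real x) - 1)"
        using H(3)[of "of_real x"] s by (simp add: G'_def strip_def algebra_simps)
      moreover have "ee (- (of_int (k - 1) * of_real x)) = ee (of_real x) * ee (- (of_int k * of_real x))"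
        by (simp add: ee_add[symmetric] algebra_simps)
      ultimately show ?thesis by (simp only: of_int_minus minus_mult_left[symmetric]) (simp add: algebra_simps)
    qed
    hence "fcoeff G k = integral {0..1} (\<lambda>x. G 0 * ee (of_int (- k) * of_real x) +
       (H (of_real x) * ee (- (of_int (k - 1) * of_real x)) - H (of_real x) * ee (- (of_int k * of_real x))))"
      by (simp add: fcoeff_def)
    also have "\<dots> = G 0 * (if - k = 0 then 1 else 0) + (fcoeff H (k - 1) - fcoeff H k)"
      unfolding fcoeff_def
      by (intro integral_unique has_integral_add has_integral_diff has_integral_mult_right
          has_integral_ee integrable_integral intH)
    finally show ?thesis by simp
  qed
  have partial: "(\<Sum>k\<in>{- int n..int n}. fcoeff G k) = G 0 + (fcoeff H (- int n - 1) - fcoeff H (int n))" for n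
  proof (induction n)
    case 0 show ?case using tele[of 0] by simp
  next
    case (Suc n)
    have "{- int (Suc n)..int (Suc n)} = insert (- int n - 1) (insert (int n + 1) {- int n..int n})" by auto
    hence "(\<Sum>k\<in>{- int (Suc n)..int (Suc n)}. fcoeff G k) =
        fcoeff G (- int n - 1) + (fcoeff G (int n + 1) + (\<Sum>k\<in>{- int n..int n}. fcoeff G k))" by simp
    also have "\<dots> = G 0 + (fcoeff H (- int n - 2) - fcoeff H (int n + 1))"
      using tele[of "- int n - 1"] tele[of "int n + 1"] unfolding Suc.IH by (simp add: diff_diff_eq)
    finally show ?case by (simp add: algebra_simps)
  qed
  obtain KH where dec: "exp_decaying KH \<delta> (fcoeff H)"
    using fcoeff_decaying_ex[OF H(1,2), of "s/2"] s by (auto simp: \<delta>_def)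
  have lim0: "(\<lambda>n. fcoeff H (f n)) \<longlonglongrightarrow> 0" if f: "\<And>n. \<bar>f n\<bar> \<ge> int n" for f
  proof (rule Lim_null_comparison)
    have "norm (fcoeff H (f n)) \<le> KH * exp (- \<delta>) ^ n" for n
    proof -
      have "norm (fcoeff H (f n)) \<le> KH * exp (- (\<delta> * \<bar>of_int (f n)\<bar>))"
        by (rule exp_decayingD[OF dec])
      also have "\<dots> \<le> KH * exp (- (\<delta> * of_nat n))"
      proof -
        have "real n \<le> \<bar>of_int (f n)\<bar>" using f[of n] by linarith
        thus ?thesis using exp_decaying_nonneg[OF dec] \<open>\<delta> > 0\<close> by (intro mult_left_mono) auto
      qed
      finally show ?thesis by (simp flip: exp_of_nat_mult add: mult_ac)
    qed
    thus "\<forall>\<^sub>F n in sequentially. norm (fcoeff H (f n)) \<le> KH * exp (- \<delta>) ^ n" by simp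
    show "(\<lambda>n. KH * exp (- \<delta>) ^ n) \<longlonglongrightarrow> 0"
      using \<open>\<delta> > 0\<close> by (auto intro!: tendsto_mult_right_zero LIMSEQ_realpow_zero)
  qed
  have "(\<lambda>n. G 0 + (fcoeff H (- int n - 1) - fcoeff H (int n))) \<longlonglongrightarrow> G 0 + (0 - 0)"
    by (intro tendsto_intros lim0) auto
  hence l1: "(\<lambda>n. \<Sum>k\<in>{- int n..int n}. fcoeff G k) \<longlonglongrightarrow> G 0" by (simp add: partial)
  have "(fcoeff G has_sum infsum (fcoeff G) UNIV) UNIV" using summ by (rule has_sum_infsum)
  hence "((\<lambda>X. sum (fcoeff G) X) \<longlongrightarrow> infsum (fcoeff G) UNIV) (finite_subsets_at_top UNIV)"
    by (simp add: has_sum_def)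
  \<comment> \<open>Unordered summability permits evaluation along symmetric intervals, where the
    sum has just been seen to telescope.\<close>
  moreover have "filterlim (\<lambda>n. {- int n..int n}) (finite_subsets_at_top UNIV) sequentially"
    unfolding filterlim_def le_filter_def eventually_filtermap
  proof (intro allI impI)
    fix P assume "eventually P (finite_subsets_at_top (UNIV :: int set))"
    then obtain X where X: "finite X" "\<And>Y. finite Y \<Longrightarrow> X \<subseteq> Y \<Longrightarrow> P Y"
      unfolding eventually_finite_subsets_at_top by auto
    have "X \<subseteq> {- int n..int n}" if "n \<ge> nat (Max (insert 0 (abs ` X)))" for n
    proof
      fix x assume "x \<in> X"
      hence "\<bar>x\<bar> \<le> Max (insert 0 (abs ` X))" using X by (intro Max_ge) auto
      thus "x \<in> {- int n..int n}" using that by auto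
    qed
    thus "\<forall>\<^sub>F n in sequentially. P {- int n..int n}"
      using X(2) unfolding eventually_sequentially by blast
  qed
  ultimately have "(\<lambda>n. \<Sum>k\<in>{- int n..int n}. fcoeff G k) \<longlonglongrightarrow> infsum (fcoeff G) UNIV"
    by (rule filterlim_compose)
  with l1 show ?thesis using LIMSEQ_unique by blast
qed

text \<open>Translation moves the point to 0; shifting the period of integration back multiplies the
  k-th coefficient by \<open>ee (of_int k * of_real x0)\<close>, which is the k-th term of the
  series there.\<close>

lemma fourier_inversion:
  assumes hol: "G holomorphic_on strip s" and s: "s > 0" and per: "\<And>z. z \<in> strip s \<Longrightarrow> G (z + 1) = G z"
  shows "fser (fcoeff G) (of_real x0) = G (of_real x0)"
proof -
  define F where "F = (\<lambda>z. G (z + of_real x0))"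
  have F: "F holomorphic_on strip s"
    unfolding F_def by (rule holomorphic_on_compose_gen[OF _ hol, unfolded o_def])
       (auto intro!: holomorphic_intros simp: strip_def)
  have Fper: "F (z + 1) = F z" if "z \<in> strip s" for z
    using per[of "z + of_real x0"] that by (simp add: F_def strip_def algebra_simps)
  have "fcoeff F k = fcoeff G k * ee (of_int k * of_real x0)" for k
  proof -
    define H where "H = (\<lambda>z. G z * ee (- (of_int k * z)))"
    have holH: "H holomorphic_on strip s"
      unfolding H_def by (intro holomorphic_intros hol)
    have "H (z + 1) = H z" if "z \<in> strip s" for z
      using per[OF that] by (simp add: H_def distrib_left ee_diff ee_minus field_simps ee_add)
    from strip_integral_shift[OF holH this, of "of_real x0"] s
    have "integral {0..1} (\<lambda>x. H (of_real x + of_real x0)) = fcoeff G k"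
      by (simp add: fcoeff_def H_def strip_def)
    also have "(\<lambda>x. H (of_real x + of_real x0)) =
      (\<lambda>x. (F (of_real x) * ee (- (of_int k * of_real x))) * ee (- (of_int k * of_real x0)))"
      by (simp add: H_def F_def fun_eq_iff mult.assoc ee_add[symmetric] algebra_simps)
    finally have "fcoeff F k * ee (- (of_int k * of_real x0)) = fcoeff G k"
      by (simp add: fcoeff_def integral_mult_left)
    thus ?thesis by (simp add: ee_minus field_simps)
  qed
  hence "fser (fcoeff G) (of_real x0) = infsum (fcoeff F) UNIV"
    unfolding fser_def by (intro infsum_cong) simp
  also have "\<dots> = F 0" by (rule fourier_inversion_0[OF F s Fper])
  finally show ?thesis by (simp add: F_def)
qed

text \<open>Local power series are glued along the real axis: two extensions agree wherever both are defined,
  since the intersection of two balls centred on the real axis is convex and meets the axis in an interval.\<close>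

lemma real_analytic_local_extension:
  assumes "real_analytic f"
  obtains r F where "r > 0" "F holomorphic_on ball (of_real x) r"
    "\<And>y. \<bar>y - x\<bar> < r \<Longrightarrow> F (of_real y) = of_real (f y)"
proof -
  from assms obtain r a where r: "r > 0"
    and a: "\<And>y. \<bar>y - x\<bar> < r \<Longrightarrow> (\<lambda>m::nat. a m * (y - x) ^ m) sums f y"
    unfolding real_analytic_def by metis
  have sumc: "summable (\<lambda>m. of_real (a m) * (w - of_real x) ^ m :: complex)" if w: "w \<in> ball (of_real x) r"
      for w
  proof -
    define t where "t = (norm (w - of_real x) + r) / 2"
    have t: "norm (w - of_real x) < t" "t < r" "t \<ge> 0" using w r
      by (auto simp: t_def dist_norm norm_minus_commute)
    have "(\<lambda>m. a m * (x + t - x) ^ m) sums f (x + t)" by (rule a) (use t in auto)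
    hence "summable (\<lambda>m. a m * t ^ m)"
      by (simp add: sums_iff)
    hence "summable (\<lambda>m. of_real (a m * t ^ m) :: complex)"
      by (rule summable_of_real)
    hence "summable (\<lambda>m. of_real (a m) * (of_real t) ^ m :: complex)"
      by simp
    thus ?thesis by (rule powser_inside) (use t in auto)
  qed
  define F where "F = (\<lambda>w. \<Sum>m. of_real (a m) * (w - of_real x) ^ m :: complex)"
  have "F holomorphic_on ball (of_real x) r"
    by (rule power_series_holomorphic[where a = "\<lambda>m. of_real (a m)"])
       (use sumc in \<open>auto simp: F_def summable_sums\<close>)
  moreover have "F (of_real y) = of_real (f y)" if "\<bar>y - x\<bar> < r" for y
    using sums_of_real[OF a[OF that], where ?'a = complex] by (simp add: F_def sums_iff)
  ultimately show ?thesis using that r by blast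
qed

lemma holomorphic_eq_on_reals:
  assumes "F holomorphic_on S" "G holomorphic_on S" "open S" "connected S"
    and p: "of_real p \<in> S" and "\<And>x. of_real x \<in> S \<Longrightarrow> F (of_real x) = G (of_real x)"
    and "z \<in> S"
  shows "F z = G z"
proof -
  obtain d where d: "d > 0" "ball (of_real p) d \<subseteq> S" using \<open>open S\<close> p open_contains_ball by blast
  define U where "U = S \<inter> range of_real"
  have "of_real p islimpt U"
    unfolding islimpt_approachable
  proof (intro allI impI)
    fix e :: real assume e: "e > 0"
    define t where "t = p + min e d / 2"
    have "dist (of_real t) (of_real p :: complex) = min e d / 2"
      using e d by (simp add: t_def dist_norm)
    moreover have "min e d / 2 < e" "min e d / 2 < d" "min e d / 2 > 0" using e d by auto
    ultimately show "\<exists>x'\<in>U. x' \<noteq> of_real p \<and> dist x' (of_real p) < e"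
      using d by (intro bexI[of _ "of_real t"]) (auto simp: U_def dist_commute)
  qed
  hence "F z - G z = 0"
    by (intro analytic_continuation[of "\<lambda>z. F z - G z" S U "of_real p" z])
       (use assms in \<open>auto simp: U_def intro!: holomorphic_intros\<close>)
  thus ?thesis by simp
qed

lemma balls_agree:
  assumes "F1 holomorphic_on ball (of_real x1) r" "F2 holomorphic_on ball (of_real x2) r"
    and 1: "\<And>y. \<bar>y - x1\<bar> < r \<Longrightarrow> F1 (of_real y) = of_real (f y)"
    and 2: "\<And>y. \<bar>y - x2\<bar> < r \<Longrightarrow> F2 (of_real y) = of_real (f y)"
    and z: "z \<in> ball (of_real x1) r" "z \<in> ball (of_real x2) r"
  shows "F1 z = F2 z"
proof (rule holomorphic_eq_on_reals[where p = "Re z" and F = F1 and G = F2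
      and S = "ball (of_real x1) r \<inter> ball (of_real x2) r"])
  let ?S = "ball (of_real x1) r \<inter> ball (of_real x2) r :: complex set"
  have "norm (of_real x - of_real (Re z) :: complex) \<le> norm (of_real x - z)" for x
    using abs_Re_le_cmod[of "of_real x - z"] by (simp flip: of_real_diff)
  thus "of_real (Re z) \<in> ?S" using z by (auto simp: dist_norm intro: le_less_trans)
  show "F1 holomorphic_on ?S" "F2 holomorphic_on ?S" using assms holomorphic_on_subset by blast+
  show "connected ?S" by (intro convex_connected convex_Int convex_ball)
  show "F1 (of_real x) = F2 (of_real x)" if "of_real x \<in> ?S" for x
    using that 1[of x] 2[of x] by (simp add: dist_norm abs_minus_commute flip: of_real_diff)
qed (use z in \<open>auto intro: open_Int\<close>)

text \<open>Compactness of a period: finitely many balls of half the local radius cover [0, 1], so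
  around each point there is room for the smallest of these half radii. Integer translations
  transfer this to the whole line.\<close>

lemma real_analytic_uniform_extension:
  assumes "real_analytic f" "periodic1 f"
  obtains \<delta> where "\<delta> > 0" "\<And>x. \<exists>F. F holomorphic_on ball (of_real x) \<delta> \<and>
    (\<forall>y. \<bar>y - x\<bar> < \<delta> \<longrightarrow> F (of_real y) = of_real (f y))"
proof -
  obtain r where r: "\<And>x. r x > 0" and F: "\<And>x. \<exists>F. F holomorphic_on ball (of_real x) (r x) \<and>
    (\<forall>y. \<bar>y - x\<bar> < r x \<longrightarrow> F (of_real y) = of_real (f y))"
  proof -
    have "\<exists>r. r > 0 \<and> (\<exists>F. F holomorphic_on ball (of_real x) r \<and>
      (\<forall>y. \<bar>y - x\<bar> < r \<longrightarrow> F (of_real y) = of_real (f y)))" for x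
      by (rule real_analytic_local_extension[OF assms(1), of x]) blast
    thus ?thesis using that by metis
  qed
  obtain X where X: "X \<subseteq> {0..1}" "finite X" "{0..1} \<subseteq> (\<Union>x\<in>X. ball x (r x / 2))"
  proof (rule compactE_image[of "{0..1::real}" "{0..1}" "\<lambda>x. ball x (r x / 2)"])
    show "{0..1} \<subseteq> (\<Union>x\<in>{0..1}. ball x (r x / 2))"
      using r by (intro subsetI UN_I) auto
  qed auto
  define \<delta> where "\<delta> = Min (insert 1 ((\<lambda>x. r x / 2) ` X))"
  have \<delta>: "\<delta> > 0" using X(2) r by (auto simp: \<delta>_def)
  have \<delta>_le: "\<delta> \<le> r x / 2" if "x \<in> X" for x
    unfolding \<delta>_def by (rule Min_le) (use X(2) that in auto)
  have per: "f (y + of_int k) = f y" for y and k :: int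
  proof (induction k rule: int_induct[where k = 0])
    case (step1 i) thus ?case using assms(2) by (simp add: periodic1_def add.assoc[symmetric])
  next
    case (step2 i)
    have "f (y + of_int (i - 1)) = f (y + of_int (i - 1) + 1)"
      using assms(2) unfolding periodic1_def by metis
    also have "y + of_int (i - 1) + 1 = y + of_int i" by simp
    finally show ?case using step2 by simp
  qed auto
  have "\<exists>F. F holomorphic_on ball (of_real x) \<delta> \<and>
    (\<forall>y. \<bar>y - x\<bar> < \<delta> \<longrightarrow> F (of_real y) = of_real (f y))" for x
  proof -
    define k where "k = \<lfloor>x\<rfloor>"
    have "x - of_int k \<in> {0..1}" unfolding k_def by (simp add: less_imp_le) linarith
    hence "x - of_int k \<in> (\<Union>x\<in>X. ball x (r x / 2))" using X(3) by (rule rev_subsetD)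
    then obtain t where t: "t \<in> X" "\<bar>x - of_int k - t\<bar> < r t / 2"
      by (auto simp: dist_real_def abs_minus_commute)
    obtain G where G: "G holomorphic_on ball (of_real t) (r t)"
      "\<And>y. \<bar>y - t\<bar> < r t \<Longrightarrow> G (of_real y) = of_real (f y)" using F[of t] by blast
    have sub: "z - of_int k \<in> ball (of_real t) (r t)" if "z \<in> ball (of_real x) \<delta>" for z :: complex
    proof -
      have "norm (z - of_int k - of_real t)
          \<le> norm (z - of_real x) + norm (of_real (x - of_int k - t) :: complex)"
        by (rule order_trans[OF _ norm_triangle_ineq]) (simp add: algebra_simps)
      also have "\<dots> < r t / 2 + r t / 2"
        using that \<delta>_le[OF t(1)] t(2) unfolding norm_of_real
        by (intro add_strict_mono) (auto simp: dist_norm norm_minus_commute)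
      finally show ?thesis by (simp add: dist_norm norm_minus_commute)
    qed
    have "(\<lambda>z. G (z - of_int k)) holomorphic_on ball (of_real x) \<delta>"
      by (rule holomorphic_on_compose_gen[OF _ G(1), unfolded o_def])
         (use sub in \<open>auto intro!: holomorphic_intros\<close>)
    moreover have "G (of_real y - of_int k) = of_real (f y)" if "\<bar>y - x\<bar> < \<delta>" for y
    proof -
      have "of_real y - of_int k \<in> ball (of_real t :: complex) (r t)"
        by (rule sub) (use that in \<open>simp add: dist_real_def abs_minus_commute\<close>)
      hence "of_real (y - of_int k) \<in> ball (of_real t :: complex) (r t)" by simp
      hence "\<bar>y - of_int k - t\<bar> < r t"
        unfolding mem_ball dist_of_real dist_real_def by (simp only: abs_minus_commute)
      from G(2)[OF this] show ?thesis using per[of y "- k"] by simp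
    qed
    ultimately show ?thesis by blast
  qed
  thus ?thesis using \<delta> that by blast
qed

text \<open>The value at z comes from the local extension centred at Re z. On a small ball around z
  it may be compared with one fixed local extension by \<open>balls_agree\<close>, which gives
  holomorphy; comparing the centres Re z and Re z + 1 gives periodicity.\<close>

lemma real_analytic_strip_extension:
  assumes "real_analytic f" "periodic1 f"
  obtains \<delta> F where "\<delta> > 0" "F holomorphic_on strip \<delta>" "\<And>z. z \<in> strip \<delta> \<Longrightarrow> F (z + 1) = F z"
    "\<And>x. F (of_real x) = of_real (f x)"
proof -
  obtain \<delta> where \<delta>: "\<delta> > 0" "\<And>x. \<exists>F. F holomorphic_on ball (of_real x) \<delta> \<and>
    (\<forall>y. \<bar>y - x\<bar> < \<delta> \<longrightarrow> F (of_real y) = of_real (f y))"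
    by (rule real_analytic_uniform_extension[OF assms]) (rule that)
  then obtain G where G: "\<And>x. G x holomorphic_on ball (of_real x) \<delta>"
    "\<And>x y. \<bar>y - x\<bar> < \<delta> \<Longrightarrow> G x (of_real y) = of_real (f y)" by metis
  define F where "F = (\<lambda>z. G (Re z) z)"
  have in_ball: "z \<in> ball (of_real (Re z)) \<delta>" if "z \<in> strip \<delta>" for z
  proof -
    have "norm (z - of_real (Re z)) = \<bar>Im z\<bar>" by (simp add: cmod_def)
    thus ?thesis using that by (simp add: strip_def dist_norm norm_minus_commute)
  qed
  have "F holomorphic_on strip \<delta>"
  proof (rule analytic_imp_holomorphic, unfold analytic_on_def, intro ballI)
    fix z assume z: "z \<in> strip \<delta>"
    have "open (strip \<delta> \<inter> ball (of_real (Re z)) \<delta>)" by (intro open_Int open_strip open_ball)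
    then obtain e where e: "e > 0" "ball z e \<subseteq> strip \<delta> \<inter> ball (of_real (Re z)) \<delta>"
      using z in_ball[OF z] open_contains_ball by blast
    have "G (Re z) holomorphic_on ball z e" using e holomorphic_on_subset[OF G(1)] by blast
    moreover have "G (Re z) w = F w" if "w \<in> ball z e" for w
      unfolding F_def
      by (rule balls_agree[of _ "Re z" \<delta> _ "Re w" f]) (use G e(2) that in_ball in auto)
    ultimately have "F holomorphic_on ball z e" by (rule holomorphic_transform)
    thus "\<exists>e>0. F holomorphic_on ball z e" using e by blast
  qed
  moreover have "F (z + 1) = F z" if z: "z \<in> strip \<delta>" for z
  proof -
    have "(\<lambda>w. G (Re z + 1) (w + 1)) holomorphic_on ball (of_real (Re z)) \<delta>"
      by (rule holomorphic_on_compose_gen[OF _ G(1), unfolded o_def])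
         (auto intro!: holomorphic_intros simp: dist_norm norm_minus_commute)
    moreover have "G (Re z + 1) (of_real y + 1) = of_real (f y)" if "\<bar>y - Re z\<bar> < \<delta>" for y
      using G(2)[of "y + 1" "Re z + 1"] that assms(2) by (simp add: periodic1_def)
    ultimately have "G (Re z + 1) (z + 1) = G (Re z) z"
      by (intro balls_agree[where ?F1.0 = "\<lambda>w. G (Re z + 1) (w + 1)" and ?F2.0 = "G (Re z)" and ?x1.0 = "Re z"
            and ?x2.0 = "Re z" and r = \<delta> and f = f and z = z] in_ball z G)
    thus ?thesis by (simp add: F_def)
  qed
  moreover have "F (of_real x) = of_real (f x)" for x using G(2)[of x x] \<delta> by (simp add: F_def)
  ultimately show ?thesis using that \<delta>(1) by blast
qed

lemma fourier_coeff_analytic: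
  assumes "real_analytic f" "periodic1 f"
  obtains B \<epsilon> where "\<epsilon> > 0" "exp_decaying B \<epsilon> (fourier_coeff f)"
    "\<And>x. fser (fourier_coeff f) (of_real x) = of_real (f x)"
proof -
  obtain \<delta> F where F: "\<delta> > 0" "F holomorphic_on strip \<delta>" "\<And>z. z \<in> strip \<delta> \<Longrightarrow> F (z + 1) = F z"
    "\<And>x. F (of_real x) = of_real (f x)"
    by (rule real_analytic_strip_extension[OF assms]) (rule that)
  have eq: "fcoeff F = fourier_coeff f"
  proof
    fix k
    have "ee (- (of_int k * of_real x)) = cis (- 2 * pi * real_of_int k * x)" for x
      using ee_of_real[of "- (of_int k * x)"] by (simp add: mult_ac)
    thus "fcoeff F k = fourier_coeff f k" by (simp add: fcoeff_def fourier_coeff_def F(4))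
  qed
  obtain K where "exp_decaying K (2 * pi * (\<delta>/2)) (fcoeff F)"
    using fcoeff_decaying_ex[OF F(2,3), of "\<delta>/2"] F(1) by auto
  moreover have "2 * pi * (\<delta>/2) > 0" using F(1) by simp
  ultimately show ?thesis
    using that[of "2 * pi * (\<delta>/2)" K] fourier_inversion[OF F(2,1,3)] by (simp add: eq F(4))
qed

section \<open>Approximate Bloch waves\<close>

lemma infsum_diff':
  fixes f g :: "'a \<Rightarrow> complex"
  assumes "f summable_on A" "g summable_on A"
  shows "infsum (\<lambda>x. f x - g x) A = infsum f A - infsum g A"
  using infsum_add[OF assms(1) summable_on_uminus[THEN iffD2, OF assms(2)]] by (simp add: infsum_uminus)

lemma fser_diff:
  assumes "exp_decaying A \<epsilon> a" "exp_decaying B \<epsilon> b" "\<epsilon> > 0" "4 * pi * \<bar>Im z\<bar> \<le> \<epsilon>"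
  shows "fser (\<lambda>k. a k - b k) z = fser a z - fser b z"
  using fser_add[OF assms(1) exp_decaying_uminus[OF assms(2)] assms(3,4)] by (simp add: fser_uminus)

lemma exp_decaying_diff:
  assumes "exp_decaying A \<epsilon> a" "exp_decaying B \<epsilon> b"
  shows "exp_decaying (A + B) \<epsilon> (\<lambda>k. a k - b k)"
  using exp_decaying_add[OF assms(1) exp_decaying_uminus[OF assms(2)]] by simp

lemma norm_ee_of_real [simp]: "norm (ee (of_real x)) = 1"
  by (simp add: norm_ee)

lemma norm_ee_real_mult [simp]: "norm (ee (of_int k * of_real x)) = 1"
  by (simp add: norm_ee)

text \<open>This is ln y <= y at y = a x / \<tau>. It serves throughout to absorb polynomial losses
  into a fraction of an exponential rate.\<close>

lemma powr_le_exp: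
  fixes x a \<tau> :: real
  assumes "x > 0" "a > 0" "\<tau> > 0"
  shows "x powr \<tau> \<le> (\<tau> / a) powr \<tau> * exp (a * x)"
proof -
  define y where "y = a * x / \<tau>"
  have y: "y > 0" using assms by (simp add: y_def)
  have "ln y \<le> y" using ln_le_minus_one[OF y] by simp
  hence "y powr \<tau> \<le> exp (\<tau> * y)" using y assms by (simp add: powr_def)
  moreover have "\<tau> * y = a * x" using assms by (simp add: y_def)
  moreover have "x = (\<tau> / a) * y" using assms by (simp add: y_def)
  ultimately show ?thesis using y assms
      by (metis divide_pos_pos less_imp_le mult_left_mono powr_ge_zero powr_mult)
qed

text \<open>The estimate behind the cohomological equation: small divisors of polynomial size cost a
  constant and half of the rate. The index 0, where the divisor vanishes, is set aside.\<close>

lemma exp_decaying_divide: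
  assumes g: "\<And>k. k \<noteq> 0 \<Longrightarrow> norm (g k) * (\<kappa> * \<bar>of_int k\<bar> powr (- \<tau>)) \<le> norm (d k)"
    and d: "exp_decaying A \<epsilon> d" and pos: "\<kappa> > 0" "\<tau> > 0" "\<epsilon> > 0"
  shows "exp_decaying (A * ((2 * \<tau> / \<epsilon>) powr \<tau> / \<kappa>)) (\<epsilon>/2) (\<lambda>k. if k = 0 then 0 else g k)"
  unfolding exp_decaying_def
proof
  fix k :: int
  have A: "A \<ge> 0" using d by (rule exp_decaying_nonneg)
  show "norm (if k = 0 then 0 else g k) \<le> A * ((2 * \<tau> / \<epsilon>) powr \<tau> / \<kappa>) * exp (- (\<epsilon>/2 * \<bar>of_int k\<bar>))"
  proof (cases "k = 0")
    case True thus ?thesis using A pos by simp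
  next
    case False
    define x where "x = \<bar>real_of_int k\<bar>"
    have x: "x > 0" using False by (simp add: x_def)
    have "norm (g k) * \<kappa> = norm (g k) * (\<kappa> * x powr (- \<tau>)) * x powr \<tau>"
      using x by (simp add: powr_minus)
    also have "\<dots> \<le> norm (d k) * x powr \<tau>"
      using g[OF False] by (intro mult_right_mono) (auto simp: x_def)
    also have "\<dots> \<le> (A * exp (- (\<epsilon> * x))) * ((\<tau> / (\<epsilon>/2)) powr \<tau> * exp (\<epsilon>/2 * x))"
      using exp_decayingD[OF d, of k] powr_le_exp[OF x, of "\<epsilon>/2" \<tau>] pos A
      by (intro mult_mono) (auto simp: x_def)
    also have "\<dots> = A * (\<tau> / (\<epsilon>/2)) powr \<tau> * (exp (- (\<epsilon> * x)) * exp (\<epsilon>/2 * x))"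
      by (simp only: mult_ac)
    also have "exp (- (\<epsilon> * x)) * exp (\<epsilon>/2 * x) = exp (- (\<epsilon>/2 * x))"
      unfolding mult_exp_exp by simp
    finally show ?thesis using False pos by (simp add: x_def field_simps)
  qed
qed

text \<open>\<open>w\<close> is the (possibly truncated) solution of the dual equation, \<open>r\<close> the error in the equation.\<close>

locale dual_quasi =
  fixes \<alpha> \<theta> E \<epsilon> B \<eta> BV :: real and V w r :: "int \<Rightarrow> complex"
  assumes \<epsilon>_pos: "\<epsilon> > 0"
    and V_dec: "exp_decaying BV \<epsilon> V" and w_dec: "exp_decaying B \<epsilon> w" and r_dec: "exp_decaying \<eta> \<epsilon> r"
    and V_real: "\<And>k. V (- k) = cnj (V k)"
    and w_0: "w 0 = 1"
    and w_eq: "\<And>n. conv V w n + of_real (2 * cos (2 * pi * (\<theta> + of_int n * \<alpha>))) * w n - of_real E * w n = r n"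
begin

text \<open>The starred objects replace complex conjugates, which are not holomorphic, by their
  holomorphic continuations from the real axis; see \<open>fser_cnj\<close>.\<close>

definition ws :: "int \<Rightarrow> complex" where "ws = (\<lambda>k. cnj (w (- k)))"
definition rs :: "int \<Rightarrow> complex" where "rs = (\<lambda>k. cnj (r (- k)))"
definition u :: "complex \<Rightarrow> complex" where "u = fser w"
definition us :: "complex \<Rightarrow> complex" where "us = fser ws"
definition \<rho> :: "complex \<Rightarrow> complex" where "\<rho> = fser r"
definition \<rho>s :: "complex \<Rightarrow> complex" where "\<rho>s = fser rs"

lemma ws_dec: "exp_decaying B \<epsilon> ws"
  unfolding ws_def by (rule exp_decaying_reflect[OF w_dec])

lemma rs_dec: "exp_decaying \<eta> \<epsilon> rs"
  unfolding rs_def by (rule exp_decaying_reflect[OF r_dec])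

lemma us_cnj: "us z = cnj (u (cnj z))"
  by (simp add: us_def ws_def u_def fser_cnj)

lemma \<rho>s_cnj: "\<rho>s z = cnj (\<rho> (cnj z))"
  by (simp add: \<rho>s_def rs_def \<rho>_def fser_cnj)

lemma V_cnj: "cnj (fser V (cnj z)) = fser V z"
proof -
  have "(\<lambda>k. cnj (V (- k))) = V" by (simp add: V_real)
  thus ?thesis by (simp add: fser_cnj)
qed

text \<open>Aubry duality: the cosine in the dual equation is the sum of two phases, and multiplying
  the k-th coefficient by \<open>ee\<close> of \<plusminus>(\<theta> + k\<alpha>) is a translation
  by \<plusminus>\<alpha> with the factor \<open>ee\<close> of \<plusminus>\<theta>. The convolution
  with \<open>V\<close> becomes multiplication; it decays at rate \<epsilon>/2 only, whence the
  factor 8.\<close>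

lemma u_eq:
  fixes z :: complex
  assumes z: "8 * pi * \<bar>Im z\<bar> \<le> \<epsilon>"
  shows "fser V z * u z + ee \<theta> * u (z + \<alpha>) + ee (- of_real \<theta>) * u (z - \<alpha>) - E * u z = \<rho> z"
proof -
  have z': "4 * pi * \<bar>Im z\<bar> \<le> \<epsilon>" "4 * pi * \<bar>Im z\<bar> \<le> \<epsilon>/2"
    using z \<epsilon>_pos by auto
  have e2: "\<epsilon>/2 > 0" "\<epsilon>/2 \<le> \<epsilon>" using \<epsilon>_pos by auto
  note w2 = exp_decaying_mono[OF w_dec order_refl e2(2)]
  define p where "p = (\<lambda>k. w k * (ee \<theta> * ee (of_int k * of_real \<alpha>)))"
  define m where "m = (\<lambda>k. w k * (ee (- of_real \<theta>) * ee (of_int k * of_real (- \<alpha>))))"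
  define q where "q = (\<lambda>k. - of_real E * w k)"
  have nt: "norm (ee (- of_real \<theta>)) = 1" using norm_ee_of_real[of "- \<theta>"] by simp
  have p: "exp_decaying B (\<epsilon>/2) p"
    unfolding p_def by (rule exp_decaying_phase[OF w2]) (simp add: norm_mult)
  have m: "exp_decaying B (\<epsilon>/2) m"
    unfolding m_def by (rule exp_decaying_phase[OF w2]) (simp only: norm_mult nt norm_ee_real_mult mult_1)
  have q: "exp_decaying (B * \<bar>E\<bar>) (\<epsilon>/2) q"
    using exp_decaying_mult[OF w2, of "\<lambda>_. - of_real E" "\<bar>E\<bar>"] by (simp add: q_def mult.commute)
  note c = exp_decaying_conv[OF V_dec w_dec \<epsilon>_pos]
  have coeff: "r k = ((conv V w k + p k) + m k) + q k" for k
  proof -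
    have "ee \<theta> * ee (of_int k * of_real \<alpha>) + ee (- of_real \<theta>) * ee (of_int k * of_real (- \<alpha>))
        = cis (2 * pi * (\<theta> + k * \<alpha>)) + cis (- (2 * pi * (\<theta> + k * \<alpha>)))"
      using ee_of_real[of "\<theta> + k * \<alpha>"] ee_of_real[of "- (\<theta> + k * \<alpha>)"]
      by (simp add: ee_add[symmetric] algebra_simps)
    also have "\<dots> = of_real (2 * cos (2 * pi * (\<theta> + of_int k * \<alpha>)))"
      by (simp add: complex_eq_iff)
    finally have "p k + m k = of_real (2 * cos (2 * pi * (\<theta> + of_int k * \<alpha>))) * w k"
      by (simp only: p_def m_def distrib_left[symmetric] mult.commute)
    hence "r k = conv V w k + (p k + m k) + q k" using w_eq[of k] by (simp only: q_def) simp
    thus ?thesis by (simp only: add.assoc)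
  qed
  have "\<rho> z = fser (\<lambda>k. ((conv V w k + p k) + m k) + q k) z"
    unfolding \<rho>_def using coeff by (simp add: fser_def)
  also have "\<dots> = fser (conv V w) z + fser p z + fser m z + fser q z"
    using fser_add[OF exp_decaying_add[OF exp_decaying_add[OF c p] m] q e2(1) z'(2)]
      fser_add[OF exp_decaying_add[OF c p] m e2(1) z'(2)] fser_add[OF c p e2(1) z'(2)] by simp
  also have "fser (conv V w) z = fser V z * u z"
    unfolding u_def by (rule fser_mult[OF V_dec w_dec \<epsilon>_pos z'(1), symmetric])
  also have "fser p z = ee \<theta> * u (z + \<alpha>)"
    unfolding p_def u_def fser_shift fser_cmult[symmetric] by (simp only: mult_ac)
  also have "fser m z = ee (- of_real \<theta>) * u (z - \<alpha>)"
  proof -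
    have eq: "z - of_real \<alpha> = z + of_real (- \<alpha>)" by simp
    show ?thesis unfolding m_def u_def eq fser_shift fser_cmult[symmetric] by (simp only: mult_ac)
  qed
  also have "fser q z = - of_real E * u z"
    unfolding q_def u_def by (rule fser_cmult)
  finally show ?thesis by simp
qed

text \<open>The potential is real on the real axis, so reflecting the equation for \<open>u\<close>
  only exchanges \<theta> and -\<theta>.\<close>

lemma us_eq:
  fixes z :: complex
  assumes z: "8 * pi * \<bar>Im z\<bar> \<le> \<epsilon>"
  shows "fser V z * us z + ee (- of_real \<theta>) * us (z + \<alpha>) + ee \<theta> * us (z - \<alpha>) - E * us z = \<rho>s z"
proof -
  have "\<rho>s z = cnj (\<rho> (cnj z))" by (rule \<rho>s_cnj)
  also have "\<rho> (cnj z) = fser V (cnj z) * u (cnj z) + ee \<theta> * u (cnj z + \<alpha>) +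
     ee (- of_real \<theta>) * u (cnj z - \<alpha>) - E * u (cnj z)"
    by (rule u_eq[symmetric]) (use z in simp)
  also have "cnj \<dots> = fser V z * us z + ee (- of_real \<theta>) * us (z + \<alpha>) + ee \<theta> * us (z - \<alpha>) - E * us z"
    using V_cnj[of z] by (simp add: us_cnj cnj_ee)
  finally show ?thesis by simp
qed

text \<open>The determinant of U = (u, ee(-\<theta>) u(. - \<alpha>)) and its starred companion (us,
  ee(\<theta>) us(. - \<alpha>)).\<close>

definition wr :: "complex \<Rightarrow> complex" where
  "wr z = ee \<theta> * u z * us (z - \<alpha>) - ee (- of_real \<theta>) * u (z - \<alpha>) * us z"

text \<open>The Schroedinger cocycle has determinant 1 and the Bloch phases of \<open>u\<close> and
  \<open>us\<close> are inverse to each other, so only the residuals of the dual equation can change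
  the Wronskian.\<close>

lemma wr_step:
  fixes z :: complex
  assumes z: "8 * pi * \<bar>Im z\<bar> \<le> \<epsilon>"
  shows "wr (z + \<alpha>) - wr z = \<rho> z * us z - \<rho>s z * u z"
proof -
  have 1: "ee \<theta> * u (z + \<alpha>) = (E - fser V z) * u z - ee (- of_real \<theta>) * u (z - \<alpha>) + \<rho> z"
    using u_eq[OF z] by (simp add: algebra_simps)
  have 2: "ee (- of_real \<theta>) * us (z + \<alpha>) = (E - fser V z) * us z - ee \<theta> * us (z - \<alpha>) + \<rho>s z"
    using us_eq[OF z] by (simp add: algebra_simps)
  have "wr (z + \<alpha>) = (ee \<theta> * u (z + \<alpha>)) * us z - (ee (- of_real \<theta>) * us (z + \<alpha>)) * u z"
    by (simp add: wr_def)
  thus ?thesis unfolding 1 2 by (simp add: wr_def algebra_simps)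
qed

text \<open>The Fourier coefficients of \<open>wr\<close> (see \<open>wr_fser\<close>);
  \<open>gw 0\<close> is the constant that \<open>wr\<close> stays close to.\<close>

definition gw :: "int \<Rightarrow> complex" where
  "gw k = ee \<theta> * conv w (\<lambda>k. ws k * ee (of_int k * of_real (- \<alpha>))) k -
          ee (- of_real \<theta>) * conv (\<lambda>k. w k * ee (of_int k * of_real (- \<alpha>))) ws k"

lemma norm_ee_uminus [simp]: "norm (ee (- of_real x)) = 1"
  by (simp add: norm_ee)

lemma gw_dec: "exp_decaying (2 * (B * B * exp_sum (\<epsilon>/2))) (\<epsilon>/2) gw"
proof -
  let ?a = "\<lambda>k. ee \<theta> * conv w (\<lambda>k. ws k * ee (of_int k * of_real (- \<alpha>))) k"
  let ?b = "\<lambda>k. ee (- of_real \<theta>) * conv (\<lambda>k. w k * ee (of_int k * of_real (- \<alpha>))) ws k"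
  have ws': "exp_decaying B \<epsilon> (\<lambda>k. ws k * ee (of_int k * of_real (- \<alpha>)))"
    by (rule exp_decaying_phase[OF ws_dec norm_ee_real_mult])
  have w': "exp_decaying B \<epsilon> (\<lambda>k. w k * ee (of_int k * of_real (- \<alpha>)))"
    by (rule exp_decaying_phase[OF w_dec norm_ee_real_mult])
  have "exp_decaying (B * B * exp_sum (\<epsilon>/2)) (\<epsilon>/2) ?a"
    by (subst mult.commute, rule exp_decaying_phase[OF exp_decaying_conv[OF w_dec ws' \<epsilon>_pos]]) simp
  moreover have "exp_decaying (B * B * exp_sum (\<epsilon>/2)) (\<epsilon>/2) ?b"
    by (subst mult.commute, rule exp_decaying_phase[OF exp_decaying_conv[OF w' ws_dec \<epsilon>_pos]]) simp
  ultimately have "exp_decaying (B * B * exp_sum (\<epsilon>/2) + B * B * exp_sum (\<epsilon>/2)) (\<epsilon>/2) (\<lambda>k. ?a k - ?b k)"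
    by (rule exp_decaying_diff)
  thus ?thesis unfolding gw_def[abs_def] mult_2 .
qed

lemma wr_fser:
  assumes z: "8 * pi * \<bar>Im z\<bar> \<le> \<epsilon>"
  shows "wr z = fser gw z"
proof -
  have z': "4 * pi * \<bar>Im z\<bar> \<le> \<epsilon>" "4 * pi * \<bar>Im z\<bar> \<le> \<epsilon>/2" using z \<epsilon>_pos by auto
  let ?ws = "\<lambda>k. ws k * ee (of_int k * of_real (- \<alpha>))"
  let ?w = "\<lambda>k. w k * ee (of_int k * of_real (- \<alpha>))"
  have ws': "exp_decaying B \<epsilon> ?ws"
    by (rule exp_decaying_phase[OF ws_dec norm_ee_real_mult])
  have w': "exp_decaying B \<epsilon> ?w"
    by (rule exp_decaying_phase[OF w_dec norm_ee_real_mult])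
  have d1: "exp_decaying (B * B * exp_sum (\<epsilon>/2)) (\<epsilon>/2) (\<lambda>k. ee \<theta> * conv w ?ws k)"
    by (subst mult.commute, rule exp_decaying_phase[OF exp_decaying_conv[OF w_dec ws' \<epsilon>_pos]]) simp
  have d2: "exp_decaying (B * B * exp_sum (\<epsilon>/2)) (\<epsilon>/2) (\<lambda>k. ee (- of_real \<theta>) * conv ?w ws k)"
    by (subst mult.commute, rule exp_decaying_phase[OF exp_decaying_conv[OF w' ws_dec \<epsilon>_pos]]) simp
  have "fser gw z = ee \<theta> * fser (conv w ?ws) z - ee (- of_real \<theta>) * fser (conv ?w ws) z"
    unfolding gw_def[abs_def]
    by (subst fser_diff[OF d1 d2]) (use z' \<epsilon>_pos in \<open>auto simp: fser_cmult\<close>)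
  also have "fser (conv w ?ws) z = u z * us (z + of_real (- \<alpha>))"
    unfolding u_def us_def fser_shift by (rule fser_mult[OF w_dec ws' \<epsilon>_pos z'(1), symmetric])
  also have "fser (conv ?w ws) z = u (z + of_real (- \<alpha>)) * us z"
    unfolding u_def us_def fser_shift by (rule fser_mult[OF w' ws_dec \<epsilon>_pos z'(1), symmetric])
  finally show ?thesis by (simp add: wr_def mult.assoc)
qed

definition dw :: "int \<Rightarrow> complex" where
  "dw k = conv r ws k - conv rs w k"

lemma dw_dec: "exp_decaying (2 * (\<eta> * B * exp_sum (\<epsilon>/2))) (\<epsilon>/2) dw"
  using exp_decaying_diff[OF exp_decaying_conv[OF r_dec ws_dec \<epsilon>_pos] exp_decaying_conv[OF rs_dec w_dec \<epsilon>_pos]]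
  unfolding dw_def[abs_def] mult_2 .

text \<open>The cohomological equation \<open>wr_step\<close>, compared coefficient by coefficient
  on the real axis; \<open>dw\<close> collects the coefficients of its right-hand side.\<close>

lemma gw_dw: "gw k * (ee (of_int k * of_real \<alpha>) - 1) = dw k"
proof -
  have "exp_decaying (2 * (B * B * exp_sum (\<epsilon>/2))) (\<epsilon>/2) (\<lambda>k. gw k * ee (of_int k * of_real \<alpha>))"
    by (rule exp_decaying_phase[OF gw_dec norm_ee_real_mult])
  note 1 = exp_decaying_diff[OF this gw_dec]
  have "(\<lambda>k. gw k * ee (of_int k * of_real \<alpha>) - gw k) = dw"
  proof (rule fser_coeff_unique[OF 1 dw_dec])
    fix x :: real
    have x: "8 * pi * \<bar>Im (complex_of_real x)\<bar> \<le> \<epsilon>" "4 * pi * \<bar>Im (complex_of_real x)\<bar> \<le> \<epsilon>/2"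
      "4 * pi * \<bar>Im (complex_of_real x)\<bar> \<le> \<epsilon>" "8 * pi * \<bar>Im (complex_of_real x + \<alpha>)\<bar> \<le> \<epsilon>"
      using \<epsilon>_pos by auto
    have "fser (\<lambda>k. gw k * ee (of_int k * of_real \<alpha>) - gw k) x = wr (of_real x + of_real \<alpha>) - wr x"
      using fser_diff[OF exp_decaying_phase[OF gw_dec norm_ee_real_mult] gw_dec _ x(2)] \<epsilon>_pos
      by (simp add: wr_fser[OF x(1)] wr_fser[OF x(4)] fser_shift)
    also have "\<dots> = \<rho> x * us x - \<rho>s x * u x"
      by (rule wr_step[OF x(1)])
    also have "\<rho> x * us x = fser (conv r ws) x"
      unfolding \<rho>_def us_def by (rule fser_mult[OF r_dec ws_dec \<epsilon>_pos x(3)])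
    also have "\<rho>s x * u x = fser (conv rs w) x"
      unfolding \<rho>s_def u_def by (rule fser_mult[OF rs_dec w_dec \<epsilon>_pos x(3)])
    also have "fser (conv r ws) x - fser (conv rs w) x = fser dw x"
      unfolding dw_def[abs_def] using fser_diff[OF exp_decaying_conv[OF r_dec ws_dec \<epsilon>_pos]
          exp_decaying_conv[OF rs_dec w_dec \<epsilon>_pos] _ x(2)] \<epsilon>_pos by simp
    finally show "fser (\<lambda>k. gw k * ee (of_int k * of_real \<alpha>) - gw k) (of_real x) = fser dw (of_real x)" .
  qed (use \<epsilon>_pos in auto)
  thus ?thesis by (simp add: fun_eq_iff algebra_simps)
qed

text \<open>Every coefficient of \<open>wr\<close> except the mean is \<open>dw k\<close> over a
  small divisor. The rate is \<epsilon>/2 for \<open>dw\<close>, \<epsilon>/4 after the division,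
  and evaluation off the real axis takes half of the rest: hence the factor 16.\<close>

lemma wr_near_const:
  fixes z :: complex
  assumes dc: "\<And>k. k \<noteq> 0 \<Longrightarrow> \<kappa> * \<bar>of_int k\<bar> powr (- \<tau>) \<le> norm (ee (of_int k * of_real \<alpha>) - 1)"
    and pos: "\<kappa> > 0" "\<tau> > 0" and z: "16 * pi * \<bar>Im z\<bar> \<le> \<epsilon>"
  shows "norm (wr z - gw 0) \<le> (2 * exp_sum (\<epsilon>/2) * ((4 * \<tau> / \<epsilon>) powr \<tau> / \<kappa>) * exp_sum (\<epsilon>/8)) * (\<eta> * B)"
proof -
  let ?g = "\<lambda>k. if k = 0 then 0 else gw k"
  have z': "8 * pi * \<bar>Im z\<bar> \<le> \<epsilon>" "4 * pi * \<bar>Im z\<bar> \<le> \<epsilon>/4" "4 * pi * \<bar>Im z\<bar> \<le> \<epsilon>/2"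
    using z \<epsilon>_pos by auto
  have "exp_decaying (2 * (\<eta> * B * exp_sum (\<epsilon>/2)) * ((2 * \<tau> / (\<epsilon>/2)) powr \<tau> / \<kappa>)) (\<epsilon>/2/2) ?g"
  proof (rule exp_decaying_divide[OF _ dw_dec pos])
    fix k :: int assume k: "k \<noteq> 0"
    have "norm (gw k) * (\<kappa> * \<bar>of_int k\<bar> powr (- \<tau>)) \<le> norm (gw k) * norm (ee (of_int k * of_real \<alpha>) - 1)"
      using dc[OF k] by (intro mult_left_mono) auto
    also have "\<dots> = norm (dw k)" by (simp add: gw_dw[symmetric] norm_mult)
    finally show "norm (gw k) * (\<kappa> * \<bar>of_int k\<bar> powr (- \<tau>)) \<le> norm (dw k)" .
  qed (use \<epsilon>_pos in auto)
  hence g: "exp_decaying (2 * (\<eta> * B * exp_sum (\<epsilon>/2)) * ((4 * \<tau> / \<epsilon>) powr \<tau> / \<kappa>)) (\<epsilon>/4) ?g"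
    by simp
  let ?c = "\<lambda>k. if k = (0::int) then gw 0 else 0"
  have c: "exp_decaying (norm (gw 0)) (\<epsilon>/4) ?c"
    by (auto simp: exp_decaying_def)
  have "wr z = fser (\<lambda>k. ?g k + ?c k) z"
    unfolding wr_fser[OF z'(1)] by (rule arg_cong[where f = "\<lambda>f. fser f z"]) (auto simp: fun_eq_iff)
  also have "\<dots> = fser ?g z + fser ?c z"
    by (rule fser_add[OF g c]) (use z' \<epsilon>_pos in auto)
  also have "fser ?c z = gw 0"
  proof -
    have "fser ?c z = (\<Sum>\<^sub>\<infinity>k\<in>{0}. ?c k * ee (of_int k * z))"
      unfolding fser_def by (rule infsum_cong_neutral) auto
    thus ?thesis by simp
  qed
  finally have "norm (wr z - gw 0) = norm (fser ?g z)" by simp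
  also have "\<dots> \<le> 2 * (\<eta> * B * exp_sum (\<epsilon>/2)) * ((4 * \<tau> / \<epsilon>) powr \<tau> / \<kappa>) * exp_sum (\<epsilon>/4/2)"
    by (rule fser_summable(3)[OF g]) (use z' \<epsilon>_pos in auto)
  finally show ?thesis by (simp add: mult_ac)
qed

lemma u_bound:
  assumes "4 * pi * \<bar>Im z\<bar> \<le> \<epsilon>"
  shows "norm (u z) \<le> B * exp_sum (\<epsilon>/2)" "norm (us z) \<le> B * exp_sum (\<epsilon>/2)"
    "norm (\<rho> z) \<le> \<eta> * exp_sum (\<epsilon>/2)" "norm (\<rho>s z) \<le> \<eta> * exp_sum (\<epsilon>/2)"
    "norm (fser V z) \<le> BV * exp_sum (\<epsilon>/2)"
  unfolding u_def us_def \<rho>_def \<rho>s_def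
  using fser_summable(3)[OF _ \<epsilon>_pos assms] w_dec ws_dec r_dec rs_dec V_dec by blast+

text \<open>The commutator of the solution with its conjugate obeys the same second order recurrence.\<close>

definition wk :: "nat \<Rightarrow> real \<Rightarrow> complex" where
  "wk k x = ee (of_real (k * \<theta>)) * u (x + k * \<alpha>) * us x - ee (of_real (- (k * \<theta>))) * u x * us (x + k * \<alpha>)"

text \<open>For fixed x, \<open>u\<close> and \<open>us\<close> along the orbit, multiplied by
  \<open>ee\<close> of k\<theta> and of -k\<theta>, both solve the Schroedinger recurrence in k up
  to residuals; the factors \<open>us x\<close> and \<open>u x\<close> do not depend on k.\<close>

lemma wk_rec:
  "wk (Suc (Suc k)) x = (E - fser V (x + Suc k * \<alpha>)) * wk (Suc k) x - wk k x +
     (ee (of_real (Suc k * \<theta>)) * \<rho> (x + Suc k * \<alpha>) * us x - ee (of_real (- (Suc k * \<theta>))) * u x * \<rho>s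
         (x + Suc k * \<alpha>))"
proof -
  define y :: complex where "y = of_real (x + Suc k * \<alpha>)"
  have y: "8 * pi * \<bar>Im y\<bar> \<le> \<epsilon>" using \<epsilon>_pos by (simp add: y_def)
  have 1: "ee \<theta> * u (y + \<alpha>) = (E - fser V y) * u y - ee (- of_real \<theta>) * u (y - \<alpha>) + \<rho> y"
    using u_eq[OF y] by (simp add: algebra_simps)
  have 2: "ee (- of_real \<theta>) * us (y + \<alpha>) = (E - fser V y) * us y - ee \<theta> * us (y - \<alpha>) + \<rho>s y"
    using us_eq[OF y] by (simp add: algebra_simps)
  define e f where "e = ee (of_real (Suc k * \<theta>))" and "f = ee (of_real (- (Suc k * \<theta>)))"
  have a: "ee (of_real (Suc (Suc k) * \<theta>)) = e * ee \<theta>" "ee (of_real (k * \<theta>)) = e * ee (- of_real \<theta>)"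
    "ee (of_real (- (Suc (Suc k) * \<theta>))) = f * ee (- of_real \<theta>)" "ee (of_real (- (k * \<theta>))) = f * ee \<theta>"
    unfolding e_def f_def ee_add[symmetric] of_real_add[symmetric] of_real_minus[symmetric]
    by (rule arg_cong[where f = ee], rule arg_cong[where f = of_real], simp add: algebra_simps)+
  have b: "complex_of_real (x + Suc (Suc k) * \<alpha>) = y + \<alpha>" "complex_of_real (x + k * \<alpha>) = y - \<alpha>"
    by (simp_all add: y_def algebra_simps)
  have "wk (Suc (Suc k)) x = e * (ee \<theta> * u (y + \<alpha>)) * us x - f * (ee (- of_real \<theta>) * us (y + \<alpha>)) * u x"
    unfolding wk_def a b by (simp only: mult_ac)
  also have "\<dots> = (E - fser V y) * (e * u y * us x - f * u x * us y) -
      (e * ee (- of_real \<theta>) * u (y - \<alpha>) * us x - f * ee \<theta> * u x * us (y - \<alpha>)) +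
          (e * \<rho> y * us x - f * u x * \<rho>s y)"
    unfolding 1 2 by (simp add: algebra_simps)
  also have "e * u y * us x - f * u x * us y = wk (Suc k) x"
    by (simp add: wk_def e_def f_def y_def)
  also have "e * ee (- of_real \<theta>) * u (y - \<alpha>) * us x - f * ee \<theta> * u x * us (y - \<alpha>) = wk k x"
    unfolding wk_def a b by simp
  finally show ?thesis by (simp add: e_def f_def y_def)
qed

text \<open>The recurrence starts from 0 and from \<open>wr (x + \<alpha>)\<close>. The 2 by which
  \<open>M\<close> exceeds the coefficient pays for the term \<open>wk k\<close> and for the
  residual, each of which is at most \<open>M ^ Suc k * \<delta>\<close>.\<close>

lemma wk_bound:
  assumes M: "\<bar>E\<bar> + BV * exp_sum (\<epsilon>/2) + 2 \<le> M"
    and \<delta>: "\<And>x::real. norm (wr x) \<le> \<delta>" "2 * (\<eta> * B) * exp_sum (\<epsilon>/2) ^ 2 \<le> \<delta>"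
  shows "norm (wk k x) \<le> M ^ k * \<delta>"
proof -
  have real: "4 * pi * \<bar>Im (complex_of_real x)\<bar> \<le> \<epsilon>" for x using \<epsilon>_pos by simp
  have nn: "\<eta> \<ge> 0" "B \<ge> 0" "BV \<ge> 0" "exp_sum (\<epsilon>/2) \<ge> 0"
    using r_dec w_dec V_dec exp_decaying_nonneg exp_sum_ge_1[of "\<epsilon>/2"] \<epsilon>_pos by auto
  have \<delta>0: "\<delta> \<ge> 0" using \<delta>(1)[of 0] norm_ge_zero order_trans by blast
  have M2: "M \<ge> 2" using M nn by (smt (verit) mult_nonneg_nonneg)
  have "norm (wk k x) \<le> M ^ k * \<delta> \<and> norm (wk (Suc k) x) \<le> M ^ Suc k * \<delta>"
  proof (induction k)
    case 0
    have "wk 1 x = wr (x + \<alpha>)" by (simp add: wk_def wr_def)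
    hence "norm (wk (Suc 0) x) \<le> \<delta>" using \<delta>(1)[of "x + \<alpha>"] by simp
    also have "\<dots> \<le> M * \<delta>" using M2 \<delta>0 by (simp add: mult_le_cancel_right1)
    finally show ?case using \<delta>0 by (simp add: wk_def)
  next
    case (Suc k)
    let ?y = "x + Suc k * \<alpha>"
    have "norm (wk (Suc (Suc k)) x) \<le> norm ((E - fser V ?y) * wk (Suc k) x) + norm (wk k x) +
       (norm (ee (of_real (Suc k * \<theta>)) * \<rho> ?y * us x) + norm (ee (of_real (- (Suc k * \<theta>))) * u x * \<rho>s ?y))"
      unfolding wk_rec by (rule order_trans[OF norm_triangle_ineq add_mono[OF norm_triangle_ineq4
          norm_triangle_ineq4]])
    also have "\<dots> \<le> (M - 2) * (M ^ Suc k * \<delta>) + M ^ k * \<delta> + \<delta>"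
    proof (intro add_mono)
      have "norm (E - fser V ?y) \<le> \<bar>E\<bar> + BV * exp_sum (\<epsilon>/2)"
        using norm_triangle_ineq4[of "of_real E" "fser V ?y"] u_bound(5)[OF real[of ?y]] by simp
      hence "norm (E - fser V ?y) \<le> M - 2" using M by simp
      thus "norm ((E - fser V ?y) * wk (Suc k) x) \<le> (M - 2) * (M ^ Suc k * \<delta>)"
        unfolding norm_mult using Suc.IH M2 by (intro mult_mono) auto
      show "norm (wk k x) \<le> M ^ k * \<delta>" using Suc.IH by blast
      have "norm (\<rho> ?y) * norm (us x) \<le> (\<eta> * exp_sum (\<epsilon>/2)) * (B * exp_sum (\<epsilon>/2))"
        by (intro mult_mono u_bound real) (use nn in auto)
      moreover have "norm (u x) * norm (\<rho>s ?y) \<le> (B * exp_sum (\<epsilon>/2)) * (\<eta> * exp_sum (\<epsilon>/2))"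
        by (intro mult_mono u_bound real) (use nn in auto)
      ultimately have "norm (\<rho> ?y) * norm (us x) + norm (u x) * norm (\<rho>s ?y) \<le> 2 * (\<eta> * B) * exp_sum (\<epsilon>/2) ^ 2"
        by (simp add: power2_eq_square mult_ac)
      also have "\<dots> \<le> \<delta>" by (rule \<delta>)
      finally show "norm (ee (of_real (Suc k * \<theta>)) * \<rho> ?y * us x) + norm (ee (of_real (- (Suc k * \<theta>))) * u x
          * \<rho>s ?y) \<le> \<delta>"
        by (simp only: norm_mult norm_ee_of_real mult_1)
    qed
    also have "\<dots> \<le> M ^ Suc (Suc k) * \<delta>"
    proof -
      have "1 \<le> M ^ Suc k" "M ^ k \<le> M ^ Suc k"
        using M2 by (intro one_le_power power_increasing; simp)+
      hence "M ^ k * \<delta> + 1 * \<delta> \<le> M ^ Suc k * \<delta> + M ^ Suc k * \<delta>"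
        using \<delta>0 by (intro add_mono mult_right_mono)
      thus ?thesis by (simp add: algebra_simps)
    qed
    finally show ?case using Suc.IH by blast
  qed
  thus ?thesis by blast
qed

definition w2 :: "int \<Rightarrow> real" where "w2 l = (norm (w l))\<^sup>2"

lemma w_cnj_w: "w l * cnj (w l) = of_real (w2 l)" "cnj (w l) * w l = of_real (w2 l)"
  unfolding w2_def complex_norm_square by (simp_all only: mult.commute)

text \<open>Parseval: only squared moduli survive in the zeroth coefficient of the convolutions. The
  mean is the k-th minus the (-k)-th Fourier moment of the measure with mass \<open>w2 l\<close> at
  \<theta> + l\<alpha>, so it measures the failure of symmetry under reflection.\<close>

lemma wk_mean:
  "((\<lambda>x. wk k x) has_integral
     (\<Sum>\<^sub>\<infinity>l. of_real (w2 l) * (ee (of_real (k * (\<theta> + of_int l * \<alpha>))) - ee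
         (of_real (- (k * (\<theta> + of_int l * \<alpha>))))))) {0..1}"
proof -
  have wd: "exp_decaying B \<epsilon> (\<lambda>l. w l * ee (of_int l * of_real y))" for y
    by (rule exp_decaying_phase[OF w_dec norm_ee_real_mult])
  have mean: "((\<lambda>x. u (of_real x + of_real y) * us (of_real x)) has_integral (\<Sum>\<^sub>\<infinity>l. of_real (w2 l)
      * ee (of_int l * of_real y))) {0..1}"
    and mean': "((\<lambda>x. u (of_real x) * us (of_real x + of_real y)) has_integral (\<Sum>\<^sub>\<infinity>l. of_real (w2 l)
        * ee (- (of_int l * of_real y)))) {0..1}" for y :: real
  proof -
    have eq: "u (of_real x + of_real y) * us (of_real x)
        = fser (conv (\<lambda>l. w l * ee (of_int l * of_real y)) ws) x" for x :: real
      unfolding u_def us_def fser_shift by (rule fser_mult[OF wd ws_dec \<epsilon>_pos]) (use \<epsilon>_pos in auto)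
    have "((\<lambda>x. u (of_real x + of_real y) * us (of_real x)) has_integral conv (\<lambda>l. w l
        * ee (of_int l * of_real y)) ws 0) {0..1}"
      unfolding eq by (rule fser_mean[OF exp_decaying_conv[OF wd ws_dec \<epsilon>_pos]]) (use \<epsilon>_pos in auto)
    moreover have "w l * ee (of_int l * of_real y) * cnj (w l) = of_real (w2 l) * ee (of_int l * of_real y)"
        for l
      by (simp only: w_cnj_w[symmetric] mult_ac)
    ultimately show "((\<lambda>x. u (of_real x + of_real y) * us (of_real x)) has_integral (\<Sum>\<^sub>\<infinity>l. of_real (w2 l)
        * ee (of_int l * of_real y))) {0..1}"
      by (simp add: conv_def ws_def)
    have wsd: "exp_decaying B \<epsilon> (\<lambda>l. ws l * ee (of_int l * of_real y))"
      by (rule exp_decaying_phase[OF ws_dec norm_ee_real_mult])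
    have eq: "u (of_real x) * us (of_real x + of_real y)
        = fser (conv w (\<lambda>l. ws l * ee (of_int l * of_real y))) x" for x :: real
      unfolding u_def us_def fser_shift by (rule fser_mult[OF w_dec wsd \<epsilon>_pos]) (use \<epsilon>_pos in auto)
    have "((\<lambda>x. u (of_real x) * us (of_real x + of_real y)) has_integral conv w (\<lambda>l. ws l
        * ee (of_int l * of_real y)) 0) {0..1}"
      unfolding eq by (rule fser_mean[OF exp_decaying_conv[OF w_dec wsd \<epsilon>_pos]]) (use \<epsilon>_pos in auto)
    moreover have "w l * (cnj (w l) * ee (- (of_int l * of_real y)))
        = of_real (w2 l) * ee (- (of_int l * of_real y))" for l
      by (simp only: w_cnj_w[symmetric] mult_ac)
    ultimately show "((\<lambda>x. u (of_real x) * us (of_real x + of_real y)) has_integral (\<Sum>\<^sub>\<infinity>l. of_real (w2 l)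
        * ee (- (of_int l * of_real y)))) {0..1}"
      by (simp add: conv_def ws_def)
  qed
  have summ: "(\<lambda>l. of_real (w2 l) * ee (of_real (f l))) summable_on UNIV" for f
  proof (rule norm_summable_on_bounded(2))
    show "(\<lambda>l. (B * B) * exp (- (\<epsilon> * \<bar>of_int l\<bar>))) summable_on (UNIV :: int set)"
      by (intro summable_on_cmult_right exp_sum_summable \<epsilon>_pos)
    fix l
    have B0: "B \<ge> 0" using w_dec by (rule exp_decaying_nonneg)
    have "norm (w l) \<le> B * 1"
      by (rule order_trans[OF exp_decayingD[OF w_dec] mult_left_mono[OF _ B0]]) (use \<epsilon>_pos in auto)
    hence "norm (w l) * norm (w l) \<le> B * (B * exp (- (\<epsilon> * \<bar>of_int l\<bar>)))"
      using exp_decayingD[OF w_dec, of l] B0 by (intro mult_mono) auto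
    thus "norm (of_real (w2 l) * ee (of_real (f l))) \<le> B * B * exp (- (\<epsilon> * \<bar>of_int l\<bar>))"
      by (simp add: norm_mult w2_def power2_eq_square mult_ac)
  qed
  have "((\<lambda>x. ee (of_real (k * \<theta>)) * (u (of_real x + of_real (k * \<alpha>)) * us (of_real x))
      - ee (of_real (- (k * \<theta>))) * (u (of_real x) * us (of_real x + of_real (k * \<alpha>)))) has_integral
     ee (of_real (k * \<theta>)) * (\<Sum>\<^sub>\<infinity>l. of_real (w2 l) * ee (of_int l * of_real (k * \<alpha>))) -
     ee (of_real (- (k * \<theta>))) * (\<Sum>\<^sub>\<infinity>l. of_real (w2 l) * ee (- (of_int l * of_real (k * \<alpha>))))) {0..1}"
    by (intro has_integral_diff has_integral_mult_right mean mean')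
  moreover have "ee (of_real (k * \<theta>)) * (\<Sum>\<^sub>\<infinity>l. of_real (w2 l) * ee (of_int l * of_real (k * \<alpha>))) =
     (\<Sum>\<^sub>\<infinity>l. of_real (w2 l) * ee (of_real (k * (\<theta> + of_int l * \<alpha>))))"
  proof -
    have "ee (of_real (k * \<theta>)) * (of_real (w2 l) * ee (of_int l * of_real (k * \<alpha>))) =
       of_real (w2 l) * ee (of_real (k * (\<theta> + of_int l * \<alpha>)))" for l
    proof -
      have "ee (of_real (k * \<theta>)) * ee (of_int l * of_real (k * \<alpha>)) = ee (of_real (k * (\<theta> + of_int l * \<alpha>)))"
        by (simp add: ee_add[symmetric] algebra_simps)
      thus ?thesis by (metis mult.left_commute)
    qed
    thus ?thesis by (simp only: infsum_cmult_right'[symmetric])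
  qed
  moreover have "ee (of_real (- (k * \<theta>))) * (\<Sum>\<^sub>\<infinity>l. of_real (w2 l) * ee (- (of_int l * of_real (k * \<alpha>)))) =
     (\<Sum>\<^sub>\<infinity>l. of_real (w2 l) * ee (of_real (- (k * (\<theta> + of_int l * \<alpha>)))))"
  proof -
    have "ee (of_real (- (k * \<theta>))) * (of_real (w2 l) * ee (- (of_int l * of_real (k * \<alpha>)))) =
       of_real (w2 l) * ee (of_real (- (k * (\<theta> + of_int l * \<alpha>))))" for l
    proof -
      have "ee (of_real (- (k * \<theta>))) * ee (- (of_int l * of_real (k * \<alpha>)))
          = ee (of_real (- (k * (\<theta> + of_int l * \<alpha>))))"
        by (simp add: ee_add[symmetric] algebra_simps)
      thus ?thesis by (metis mult.left_commute)
    qed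
    thus ?thesis by (simp only: infsum_cmult_right'[symmetric])
  qed
  ultimately have H: "((\<lambda>x. ee (of_real (k * \<theta>)) * (u (of_real x + of_real (k * \<alpha>)) * us (of_real x)) -
      ee (of_real (- (k * \<theta>))) * (u (of_real x) * us (of_real x + of_real (k * \<alpha>)))) has_integral
     (\<Sum>\<^sub>\<infinity>l. of_real (w2 l) * ee (of_real (k * (\<theta> + of_int l * \<alpha>)))) -
     (\<Sum>\<^sub>\<infinity>l. of_real (w2 l) * ee (of_real (- (k * (\<theta> + of_int l * \<alpha>)))))) {0..1}"
    by (simp only:)
  show ?thesis
    using H unfolding infsum_diff'[OF summ summ, symmetric] right_diff_distrib[symmetric] wk_def
    by (simp only: of_real_add mult.assoc)
qed

lemma wk_mean_bound:
  assumes M: "\<bar>E\<bar> + BV * exp_sum (\<epsilon>/2) + 2 \<le> M"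
    and \<delta>: "\<And>x::real. norm (wr x) \<le> \<delta>" "2 * (\<eta> * B) * exp_sum (\<epsilon>/2) ^ 2 \<le> \<delta>"
  shows "norm (\<Sum>\<^sub>\<infinity>l. of_real (w2 l) * (ee (of_real (k * (\<theta> + of_int l * \<alpha>)))
      - ee (of_real (- (k * (\<theta> + of_int l * \<alpha>))))))
     \<le> M ^ k * \<delta>"
proof -
  have "norm (integral {0..1} (\<lambda>x. wk k x)) \<le> integral {0..1::real} (\<lambda>x. M ^ k * \<delta>)"
    by (rule integral_norm_bound_integral)
        (use wk_mean wk_bound[OF assms] in \<open>auto intro: has_integral_integrable\<close>)
  thus ?thesis using integral_unique[OF wk_mean] by simp
qed

end

section \<open>Products of small divisors\<close>

lemma dist_Z_le: "dist_Z x \<le> \<bar>x - of_int k\<bar>"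
proof -
  have "infdist x \<int> \<le> dist x (of_int k)" by (rule infdist_le) auto
  thus ?thesis by (simp add: dist_Z_def dist_real_def)
qed

lemma dist_Z_nonneg: "dist_Z x \<ge> 0"
  by (simp add: dist_Z_def infdist_nonneg)

lemma dist_Z_eq_round: "dist_Z x = \<bar>x - of_int (round x)\<bar>"
proof (rule antisym[OF dist_Z_le])
  have "\<bar>x - of_int (round x)\<bar> \<le> dist x a" if "a \<in> \<int>" for a
  proof -
    from that obtain k where "a = of_int k" by (auto elim: Ints_cases)
    thus ?thesis using round_diff_minimal[of x k] by (simp add: dist_real_def)
  qed
  thus "\<bar>x - of_int (round x)\<bar> \<le> dist_Z x"
    unfolding dist_Z_def infdist_def by (auto intro!: cINF_greatest)
qed

lemma dist_Z_minus [simp]: "dist_Z (- x) = dist_Z x"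
proof -
  have "dist_Z (- y) \<le> dist_Z y" for y
    using dist_Z_le[of "- y" "- round y"] by (simp add: dist_Z_eq_round[of y])
  from this[of x] this[of "- x"] show ?thesis by simp
qed

lemma dist_Z_triangle: "dist_Z (x + y) \<le> dist_Z x + dist_Z y"
  using dist_Z_le[of "x + y" "round x + round y"] by (simp add: dist_Z_eq_round[of x] dist_Z_eq_round[of y])

lemma dist_Z_diff: "dist_Z (x - y) \<le> dist_Z x + dist_Z y"
  using dist_Z_triangle[of x "- y"] by simp

lemma dist_Z_le_half: "dist_Z x \<le> 1/2"
  unfolding dist_Z_eq_round using of_int_round_abs_le[of x] by (simp add: abs_minus_commute)

text \<open>A weak Jordan inequality: up to pi/6 the derivative is at least 1/2, and afterwards the
  sine is at least 1/2 while y/pi is at most 1/2.\<close>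

lemma sin_ge_half:
  assumes "0 \<le> y" "y \<le> pi / 2"
  shows "y / pi \<le> sin (y :: real)"
proof (cases "y \<le> pi / 6")
  case True
  show ?thesis
  proof -
    have "\<exists>z. z \<in> {0..y} \<and> sin y - sin 0 = (y - 0) * cos z"
    proof (cases "y = 0")
      case False
      obtain z where "0 < z" "z < y" "sin y - sin 0 = (y - 0) * cos z"
        using MVT2[of 0 y sin cos] False assms DERIV_sin by fastforce
      thus ?thesis by (intro exI[of _ z]) auto
    qed auto
    then obtain z where z: "0 \<le> z" "z \<le> y" "sin y = y * cos z" by auto
    have "cos (pi/3) \<le> cos z" using z True pi_gt_zero by (intro cos_monotone_0_pi_le) auto
    hence "1/2 \<le> cos z" by (simp add: cos_60)
    hence "y * (1/2) \<le> sin y" unfolding z using assms by (intro mult_left_mono)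
    moreover have "y / pi \<le> y / 2" using assms pi_gt3 by (intro divide_left_mono) auto
    ultimately show ?thesis by linarith
  qed
next
  case False
  have "sin (pi/6) \<le> sin y" using False assms pi_gt_zero by (intro sin_monotone_2pi_le) auto
  hence "1/2 \<le> sin y" by (simp add: sin_30)
  moreover have "y / pi \<le> 1/2" using assms by (simp add: field_simps)
  ultimately show ?thesis by linarith
qed

lemma abs_sin_pi_ge: "dist_Z x \<le> \<bar>sin (pi * x)\<bar>"
proof -
  define t where "t = x - of_int (round x)"
  have t: "dist_Z x = \<bar>t\<bar>" "\<bar>t\<bar> \<le> 1/2" using dist_Z_le_half[of x] by (simp_all add: t_def dist_Z_eq_round)
  have "pi * x = pi * t + of_int (round x) * pi" by (simp add: t_def algebra_simps)
  moreover have "sin (of_int (round x) * pi) = 0"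
    using sin_npi_int[of "round x"] by (simp add: mult.commute)
  moreover from this have "\<bar>cos (of_int (round x) * pi)\<bar> = 1" by (rule sin_zero_abs_cos_one)
  ultimately have "\<bar>sin (pi * x)\<bar> = \<bar>sin (pi * t)\<bar>"
    by (simp add: sin_add abs_mult)
  also have "\<dots> = sin (pi * \<bar>t\<bar>)"
  proof -
    have "sin (pi * \<bar>t\<bar>) \<ge> 0" using t(2) by (intro sin_ge_zero) (auto simp: mult_le_cancel_left1)
    thus ?thesis by (cases "t \<ge> 0") (auto simp: abs_if)
  qed
  also have "\<dots> \<ge> (pi * \<bar>t\<bar>) / pi"
    by (rule sin_ge_half) (use t in \<open>auto simp: field_simps\<close>)
  finally show ?thesis using t by simp
qed

lemma norm_ee_minus_1: "norm (ee (of_real x) - 1) = 2 * \<bar>sin (pi * x)\<bar>"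
proof -
  have "norm (ee (of_real x) - 1) ^ 2 = (cos (2 * (pi * x)) - 1)\<^sup>2 + (sin (2 * (pi * x)))\<^sup>2"
    by (simp add: ee_of_real cmod_power2 mult.assoc)
  also have "\<dots> = (2 * \<bar>sin (pi * x)\<bar>)\<^sup>2"
    unfolding cos_double_sin sin_double using sin_cos_squared_add[of "pi * x"]
    by (simp add: power2_eq_square) algebra
  finally show ?thesis by (rule power2_eq_imp_eq) auto
qed

lemma DC_dist_Z:
  assumes "\<alpha> \<in> DC"
  obtains \<kappa> \<tau> where "\<kappa> > 0" "\<tau> > 0" "\<And>k::int. k \<noteq> 0 \<Longrightarrow> \<kappa> * \<bar>of_int k\<bar> powr (- \<tau>) \<le> dist_Z (of_int k * \<alpha>)"
proof -
  obtain \<kappa> \<tau> where pos: "\<kappa> > 0" "\<tau> > 0" and dc: "\<And>p q :: int. q \<noteq> 0 \<Longrightarrow>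
        \<bar>\<alpha> - real_of_int p / real_of_int q\<bar> \<ge> \<kappa> * \<bar>real_of_int q\<bar> powr (- \<tau>)"
    using assms unfolding DC_def DC_param_def by auto
  have "\<kappa> * \<bar>of_int k\<bar> powr (- \<tau>) \<le> dist_Z (of_int k * \<alpha>)" if k: "k \<noteq> 0" for k :: int
  proof -
    define p where "p = round (of_int k * \<alpha>)"
    have k1: "\<bar>real_of_int k\<bar> \<ge> 1" using k by linarith
    have "\<kappa> * \<bar>of_int k\<bar> powr (- \<tau>) \<le> \<bar>of_int k\<bar> * \<bar>\<alpha> - of_int p / of_int k\<bar>"
      using mult_mono[OF k1 dc[OF k, of p]] pos by simp
    also have "\<dots> = \<bar>of_int k * \<alpha> - of_int p\<bar>"
      using k by (simp add: abs_mult[symmetric] right_diff_distrib)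
    also have "\<dots> = dist_Z (of_int k * \<alpha>)" by (simp add: dist_Z_eq_round p_def)
    finally show ?thesis .
  qed
  thus ?thesis using pos that by blast
qed

lemma separated_card_le:
  fixes T :: "int set" and G :: real
  assumes "finite T" "T \<noteq> {}" "\<And>a b. a \<in> T \<Longrightarrow> b \<in> T \<Longrightarrow> a \<noteq> b \<Longrightarrow> G \<le> \<bar>of_int (a - b)\<bar>"
  shows "(real (card T) - 1) * G \<le> of_int (Max T - Min T)"
  using assms
proof (induction T rule: finite_linorder_max_induct)
  case (insert b A)
  show ?case
  proof (cases "A = {}")
    case False
    have "Max A \<in> A" "Min A \<in> A" using False insert.hyps by auto
    have b: "Max A < b" using insert.hyps \<open>Max A \<in> A\<close> by auto
    have "G \<le> \<bar>of_int (b - Max A)\<bar>" by (rule insert.prems) (use \<open>Max A \<in> A\<close> b in auto)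
    hence G: "G \<le> of_int (b - Max A)" using b by simp
    have mm: "Max (insert b A) = b" "Min (insert b A) = Min A"
      using False insert.hyps b \<open>Min A \<in> A\<close> by (auto intro!: Max_eqI min_absorb2 less_imp_le)
    have IH: "(real (card A) - 1) * G \<le> of_int (Max A - Min A)"
      using insert.IH False insert.prems by auto
    have "(real (card (insert b A)) - 1) * G = (real (card A) - 1) * G + G"
      using insert.hyps by (subst card_insert_disjoint) (auto simp: algebra_simps)
    thus ?thesis using IH G unfolding mm by simp
  qed auto
qed auto

text \<open>Removing a point where \<open>f\<close> is largest splits off the factor with index
  \<open>card S\<close>. The ranks of the other points cannot increase and \<open>b\<close> is
  monotone, so the hypothesis passes to the smaller set.\<close>

lemma prod_ge_of_counting:
  fixes f :: "'a \<Rightarrow> real" and b :: "nat \<Rightarrow> real"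
  assumes "finite S" "mono b" "\<And>i. b i \<ge> 0"
    and "\<And>l. l \<in> S \<Longrightarrow> b (card {l' \<in> S. f l' \<le> f l}) \<le> f l"
  shows "(\<Prod>i\<in>{1..card S}. b i) \<le> (\<Prod>l\<in>S. f l)"
  using assms(1,4)
proof (induction "card S" arbitrary: S)
  case (Suc n)
  have ne: "S \<noteq> {}" using Suc.hyps(2) by auto
  obtain l where l: "l \<in> S" "\<And>l'. l' \<in> S \<Longrightarrow> f l' \<le> f l"
  proof -
    have "Max (f ` S) \<in> f ` S" using Suc.prems(1) ne by (intro Max_in) auto
    then obtain l where "l \<in> S" "f l = Max (f ` S)" by auto
    thus ?thesis using Suc.prems(1) that[of l] by simp
  qed
  have fn: "f l' \<ge> 0" if "l' \<in> S" for l'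
    using Suc.prems(2)[OF that] assms(3) order_trans by blast
  have cS: "card (S - {l}) = n" using l Suc by simp
  have "(\<Prod>i\<in>{1..card (S - {l})}. b i) \<le> (\<Prod>l\<in>S - {l}. f l)"
  proof (rule Suc.hyps(1))
    show "n = card (S - {l})" by (simp add: cS)
    fix k assume k: "k \<in> S - {l}"
    have "card {l' \<in> S - {l}. f l' \<le> f k} \<le> card {l' \<in> S. f l' \<le> f k}"
      using Suc.prems by (intro card_mono) auto
    hence "b (card {l' \<in> S - {l}. f l' \<le> f k}) \<le> b (card {l' \<in> S. f l' \<le> f k})"
      using assms(2) by (simp add: mono_def)
    also have "\<dots> \<le> f k" using Suc.prems(2) k by auto
    finally show "b (card {l' \<in> S - {l}. f l' \<le> f k}) \<le> f k" .
  qed (use Suc.prems in auto)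
  moreover have "b (card S) \<le> f l"
  proof -
    have "{l' \<in> S. f l' \<le> f l} = S" using l by auto
    thus ?thesis using Suc.prems(2)[OF l(1)] by simp
  qed
  ultimately have "(\<Prod>i\<in>{1..n}. b i) * b (Suc n) \<le> (\<Prod>l\<in>S - {l}. f l) * f l"
    unfolding cS using Suc.hyps(2) assms(3) fn by (intro mult_mono prod_nonneg) auto
  moreover have "(\<Prod>l\<in>S. f l) = (\<Prod>l\<in>S - {l}. f l) * f l"
    using l Suc.prems by (subst prod.remove[of S l]) auto
  moreover have "(\<Prod>i\<in>{1..card S}. b i) = (\<Prod>i\<in>{1..n}. b i) * b (Suc n)"
    using Suc.hyps(2) by (simp flip: Suc.hyps(2))
  ultimately show ?case by simp
qed auto

text \<open>The crude half of Stirling's formula, from (1 + 1/m)^m <= e. It turns the product of the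
  lower bounds in \<open>near_product\<close> into an exponential.\<close>

lemma power_self_le_fact_exp: "real m ^ m \<le> fact m * exp (real m)"
proof (induction m)
  case (Suc m)
  have "(real (Suc m)) ^ m \<le> exp 1 * real m ^ m"
  proof (cases "m = 0")
    case False
    have "(1 + 1 / real m) ^ m \<le> exp (1 / real m) ^ m"
      using False by (intro power_mono exp_ge_add_one_self) auto
    also have "\<dots> = exp 1" using False by (simp flip: exp_of_nat_mult)
    finally have "(1 + 1 / real m) ^ m * real m ^ m \<le> exp 1 * real m ^ m" by (intro mult_right_mono) auto
    moreover have "(1 + 1 / real m) ^ m * real m ^ m = (real (Suc m)) ^ m"
      using False by (simp flip: power_mult_distrib add: field_simps)
    ultimately show ?thesis by simp
  qed auto
  hence "real (Suc m) ^ Suc m \<le> real (Suc m) * (exp 1 * real m ^ m)"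
    by (simp only: power_Suc) (intro mult_left_mono; simp)
  also have "\<dots> \<le> real (Suc m) * (exp 1 * (fact m * exp (real m)))"
    using Suc.IH by (intro mult_left_mono) auto
  also have "\<dots> = fact (Suc m) * exp (real (Suc m))" by (simp add: exp_add algebra_simps)
  finally show ?case .
qed auto

text \<open>Abstracts the distances y l of 2\<theta> + l\<alpha> from the integers in the window |l|
  <= d. The index m of the smallest one is kept out of S because the Diophantine condition gives no
  lower bound for y m itself: it bounds sums of two distances, being applied to the difference of
  two phases.\<close>

definition spaced :: "real \<Rightarrow> real \<Rightarrow> real \<Rightarrow> nat \<Rightarrow> int \<Rightarrow> int set \<Rightarrow> (int \<Rightarrow> real) \<Rightarrow> bool" where
  "spaced \<kappa> \<tau> \<rho> d m S y \<longleftrightarrow>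
     S \<subseteq> {- int d..int d} \<and> m \<in> {- int d..int d} \<and> m \<notin> S \<and>
     (\<forall>l\<in>S. y m \<le> y l \<and> 0 < y l \<and> y l \<le> \<rho>) \<and>
     (\<forall>l\<in>insert m S. \<forall>l'\<in>insert m S. l \<noteq> l' \<longrightarrow> \<kappa> * \<bar>of_int (l - l')\<bar> powr (- \<tau>) \<le> y l + y l')"

text \<open>If i of the distances are at most t, so is y m, and these i + 1 indices are separated by
  (\<kappa>/(2t))^(1/\<tau>). In a window of length 2d the i-th smallest distance is therefore at
  least \<open>b i\<close>. When all distances in S are below \<rho>, S fills only a small fraction
  of the window, and the product of the \<open>b i\<close> loses an arbitrarily small exponential
  rate.\<close>

lemma near_product:
  fixes \<kappa> \<tau> \<sigma> :: real
  assumes pos: "\<kappa> > 0" "\<tau> > 0" "\<sigma> > 0"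
  obtains \<rho> where "\<rho> > 0" "\<And>d S m y. spaced \<kappa> \<tau> \<rho> d m S y \<Longrightarrow> exp (- (\<sigma> * real d)) \<le> (\<Prod>l\<in>S. y l)"
proof -
  define A where "A = \<bar>ln (2 / \<kappa>)\<bar> + 3 * \<tau> + 1"
  have A: "A \<ge> 1" using pos by (simp add: A_def)
  \<comment> \<open>With x = card S / (2d) the exponent to be controlled is at most 2 d A sqrt x,
    which is at most \<sigma> d for x <= x0. The next definition chooses \<rho> so that counting up
    to \<rho> gives exactly x <= x0.\<close>
  define x0 where "x0 = min 1 ((\<sigma> / (2 * A))\<^sup>2)"
  have x0: "x0 > 0" "x0 \<le> 1" using pos A by (auto simp: x0_def)
  define \<rho> where "\<rho> = (\<kappa>/2) * x0 powr \<tau>"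
  have "\<rho> > 0" using pos x0 by (simp add: \<rho>_def)
  have main: "exp (- (\<sigma> * real d)) \<le> (\<Prod>l\<in>S. y l)"
    if sp: "spaced \<kappa> \<tau> \<rho> d m S y" for d S m and y :: "int \<Rightarrow> real"
  proof (cases "S = {}")
    case True thus ?thesis using pos by simp
  next
    case False
    have S: "S \<subseteq> {- int d..int d}" and m: "m \<in> {- int d..int d}" "m \<notin> S"
      and yb: "\<forall>l\<in>S. y m \<le> y l \<and> 0 < y l \<and> y l \<le> \<rho>"
      and sep': "\<forall>l\<in>insert m S. \<forall>l'\<in>insert m S. l \<noteq> l' \<longrightarrow> \<kappa> * \<bar>of_int (l - l')\<bar> powr (- \<tau>) \<le> y l + y l'"
      using sp unfolding spaced_def by simp_all
    have ym: "y m \<le> y l" and ypos: "0 < y l" and y\<rho>: "y l \<le> \<rho>" if "l \<in> S" for l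
      using yb that by simp_all
    have sep: "\<kappa> * \<bar>of_int (l - l')\<bar> powr (- \<tau>) \<le> y l + y l'"
      if "l \<in> insert m S" "l' \<in> insert m S" "l \<noteq> l'" for l l'
      using bspec[OF bspec[OF sep' that(1)] that(2)] that(3) by (rule mp)
    note S = finite_subset[OF S finite_atLeastAtMost_int] S
    have d: "d > 0"
    proof (rule ccontr)
      assume "\<not> d > 0"
      thus False using S m False by auto
    qed
    define b where "b = (\<lambda>i::nat. (\<kappa>/2) * (real i / (2 * real d)) powr \<tau>)"
    have monob: "mono b"
      unfolding b_def mono_def using pos d
      by (auto intro!: mult_left_mono powr_mono2 divide_right_mono)
    have b0: "b i \<ge> 0" for i using pos by (simp add: b_def)
    have count: "real i / (2 * real d) \<le> (2 * t / \<kappa>) powr (1 / \<tau>)"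
      if i: "i = card {l' \<in> S. y l' \<le> t}" and t: "t > 0" "i > 0" for i t
    proof -
      \<comment> \<open>Adding m gives i + 1 separated points and hence i gaps, so the count below
        has no loss of one.\<close>
      define T where "T = insert m {l' \<in> S. y l' \<le> t}"
      define G where "G = (\<kappa> / (2 * t)) powr (1 / \<tau>)"
      have G: "G > 0" using pos t by (simp add: G_def)
      have yT: "y l \<le> t" if "l \<in> T" for l
      proof -
        have "{l' \<in> S. y l' \<le> t} \<noteq> {}" using t(2) i by (intro notI) simp
        then obtain l' where "l' \<in> S" "y l' \<le> t" by blast
        thus ?thesis using that ym[of l'] by (auto simp: T_def)
      qed
      have "(real (card T) - 1) * G \<le> of_int (Max T - Min T)"
      proof (rule separated_card_le)
        fix a c assume ac: "a \<in> T" "c \<in> T" "a \<noteq> c"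
        define k where "k = \<bar>real_of_int (a - c)\<bar>"
        have k: "k > 0" using ac by (simp add: k_def)
        have "\<kappa> * k powr (- \<tau>) \<le> y a + y c" unfolding k_def by (rule sep) (use ac in \<open>auto simp: T_def\<close>)
        also have "\<dots> \<le> 2 * t" using yT[OF ac(1)] yT[OF ac(2)] by simp
        finally have "\<kappa> / (2 * t) \<le> k powr \<tau>" using k t pos by (simp add: powr_minus field_simps)
        hence "G \<le> (k powr \<tau>) powr (1/\<tau>)" unfolding G_def using pos t by (intro powr_mono2) auto
        thus "G \<le> \<bar>real_of_int (a - c)\<bar>" using k pos by (simp add: powr_powr k_def)
      qed (use S in \<open>auto simp: T_def\<close>)
      also have "Max T - Min T \<le> int d - (- int d)"
      proof -
        have "T \<subseteq> {- int d..int d}" "finite T" "T \<noteq> {}" using S m by (auto simp: T_def)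
        hence "Max T \<in> {- int d..int d}" "Min T \<in> {- int d..int d}" by (meson Max_in Min_in subsetD)+
        thus ?thesis by auto
      qed
      finally have "(real (card T) - 1) * G \<le> 2 * real d" by simp
      moreover have "card T = Suc i" using S m i by (simp add: T_def)
      ultimately have "real i * G \<le> 2 * real d" by simp
      hence "real i / (2 * real d) \<le> 1 / G" using d G by (simp add: field_simps)
      also have "1 / G = (2 * t / \<kappa>) powr (1 / \<tau>)"
        using pos t by (simp add: G_def powr_divide)
      finally show ?thesis .
    qed
    have "(\<Prod>i\<in>{1..card S}. b i) \<le> (\<Prod>l\<in>S. y l)"
    proof (rule prod_ge_of_counting[OF S(1) monob b0])
      fix l assume l: "l \<in> S"
      define i where "i = card {l' \<in> S. y l' \<le> y l}"
      have "i > 0" unfolding i_def using l S by (auto simp: card_gt_0_iff)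
      from count[OF i_def ypos[OF l] this]
      have "(real i / (2 * real d)) powr \<tau> \<le> ((2 * y l / \<kappa>) powr (1 / \<tau>)) powr \<tau>"
        using pos d by (intro powr_mono2) auto
      also have "\<dots> = 2 * y l / \<kappa>" using pos ypos[OF l] by (simp add: powr_powr)
      finally show "b (card {l' \<in> S. y l' \<le> y l}) \<le> y l"
        using pos by (simp add: b_def i_def[symmetric] field_simps)
    qed
    moreover have "exp (- (\<sigma> * real d)) \<le> (\<Prod>i\<in>{1..card S}. b i)"
    proof -
      define n where "n = card S"
      have n: "n > 0" using False S by (simp add: n_def card_gt_0_iff)
      define x where "x = real n / (2 * real d)"
      have x: "x > 0" using n d by (simp add: x_def)
      have "{l' \<in> S. y l' \<le> \<rho>} = S" using y\<rho> by auto
      hence "x \<le> (2 * \<rho> / \<kappa>) powr (1 / \<tau>)"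
        unfolding x_def by (intro count) (use \<open>\<rho> > 0\<close> n in \<open>auto simp: n_def\<close>)
      also have "\<dots> = x0" using pos x0 by (simp add: \<rho>_def powr_powr)
      finally have xx0: "x \<le> x0" .
      have "(\<Prod>i\<in>{1..n}. b i) = (\<kappa>/2) ^ n * (\<Prod>i\<in>{1..n}. (real i / (2 * real d)) powr \<tau>)"
        unfolding b_def prod.distrib by simp
      also have "(\<Prod>i\<in>{1..n}. (real i / (2 * real d)) powr \<tau>) = (\<Prod>i\<in>{1..n}. real i / (2 * real d)) powr \<tau>"
        by (rule prod_powr_distrib[symmetric])
      also have "(\<Prod>i\<in>{1..n}. real i / (2 * real d)) = fact n / (2 * real d) ^ n"
        by (simp add: prod_dividef fact_prod)
      finally have prod: "(\<Prod>i\<in>{1..n}. b i) = (\<kappa>/2) ^ n * (fact n / (2 * real d) ^ n) powr \<tau>" .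
      have "(x * exp (-1)) ^ n \<le> fact n / (2 * real d) ^ n"
      proof -
        have "(x * exp (-1)) ^ n = (real n ^ n / exp (real n)) / (2 * real d) ^ n"
          by (simp add: x_def power_mult_distrib power_divide exp_minus field_simps flip: exp_of_nat_mult)
        also have "\<dots> \<le> fact n / (2 * real d) ^ n"
          using power_self_le_fact_exp[of n] by (intro divide_right_mono) (auto simp: field_simps)
        finally show ?thesis .
      qed
      hence "((x * exp (-1)) ^ n) powr \<tau> \<le> (fact n / (2 * real d) ^ n) powr \<tau>"
        using x pos by (intro powr_mono2) auto
      hence f1: "(\<kappa>/2) ^ n * ((x * exp (-1)) ^ n) powr \<tau> \<le> (\<Prod>i\<in>{1..n}. b i)"
        unfolding prod using pos by (intro mult_left_mono) auto
      have f2: "(\<kappa>/2) ^ n * ((x * exp (-1)) ^ n) powr \<tau> = exp (- (real n * (ln (2/\<kappa>) + \<tau> * (1 - ln x))))"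
      proof -
        have "ln ((\<kappa>/2) ^ n * ((x * exp (-1)) ^ n) powr \<tau>) = real n * ln (\<kappa>/2) + \<tau> * (real n * (ln x - 1))"
          using pos x by (simp add: ln_mult ln_realpow ln_powr)
        also have "\<dots> = - (real n * (ln (2/\<kappa>) + \<tau> * (1 - ln x)))"
          using pos by (simp add: ln_div algebra_simps)
        finally have "exp (ln ((\<kappa>/2) ^ n * ((x * exp (-1)) ^ n) powr \<tau>)) =
            exp (- (real n * (ln (2/\<kappa>) + \<tau> * (1 - ln x))))" by simp
        moreover have "(\<kappa>/2) ^ n * ((x * exp (-1)) ^ n) powr \<tau> > 0" using pos x by simp
        ultimately show ?thesis by simp
      qed
      have f3: "real n * (ln (2/\<kappa>) + \<tau> * (1 - ln x)) \<le> \<sigma> * real d"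
      proof -
        have "sqrt x \<le> sqrt 1" using xx0 x0 by (intro real_sqrt_le_mono) linarith
        hence sx: "sqrt x > 0" "sqrt x \<le> 1" using x by simp_all
        \<comment> \<open>The number of factors is proportional to x, so bounding the logarithm by a
          multiple of 1 / sqrt x leaves a factor sqrt x, which x0 makes small.\<close>
        have "- ln x = 2 * ln (1 / sqrt x)" using x by (simp add: ln_div ln_sqrt)
        also have "ln (1 / sqrt x) \<le> 1 / sqrt x" using ln_le_minus_one[of "1 / sqrt x"] sx by simp
        finally have lnx: "- ln x \<le> 2 / sqrt x" by simp
        have s1: "1 \<le> 1 / sqrt x" using sx by simp
        have "ln (2/\<kappa>) + \<tau> * (1 - ln x) \<le> \<bar>ln (2/\<kappa>)\<bar> * (1 / sqrt x) + \<tau> * (1 / sqrt x + 2 / sqrt x)"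
        proof (rule add_mono)
          have "\<bar>ln (2/\<kappa>)\<bar> * 1 \<le> \<bar>ln (2/\<kappa>)\<bar> * (1 / sqrt x)" using s1 by (intro mult_left_mono) auto
          thus "ln (2/\<kappa>) \<le> \<bar>ln (2/\<kappa>)\<bar> * (1 / sqrt x)" by simp
          show "\<tau> * (1 - ln x) \<le> \<tau> * (1 / sqrt x + 2 / sqrt x)" using s1 lnx pos by (intro mult_left_mono) auto
        qed
        also have "\<dots> \<le> A / sqrt x" using sx by (simp add: A_def field_simps)
        finally have "real n * (ln (2/\<kappa>) + \<tau> * (1 - ln x)) \<le> real n * (A / sqrt x)"
          by (intro mult_left_mono) auto
        also have "\<dots> = 2 * real d * A * sqrt x"
        proof -
          have "real n = 2 * real d * x" using d by (simp add: x_def)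
          moreover have "x / sqrt x = sqrt x" using x by (intro real_div_sqrt) auto
          ultimately show ?thesis by (metis mult.assoc mult.commute times_divide_eq_left)
        qed
        also have "\<dots> \<le> 2 * real d * A * (\<sigma> / (2 * A))"
        proof (rule mult_left_mono)
          have "sqrt x \<le> sqrt ((\<sigma> / (2 * A))\<^sup>2)" using xx0 by (intro real_sqrt_le_mono) (auto simp: x0_def)
          thus "sqrt x \<le> \<sigma> / (2 * A)" using pos A by simp
        qed (use A in auto)
        also have "\<dots> = \<sigma> * real d" using A by simp
        finally show ?thesis .
      qed
      have "exp (- (\<sigma> * real d)) \<le> (\<Prod>i\<in>{1..n}. b i)"
        by (rule order_trans[OF _ f1]) (use f3 in \<open>simp only: f2 exp_le_cancel_iff neg_le_iff_le\<close>)
      thus ?thesis by (simp add: n_def)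
    qed
    ultimately show ?thesis by (rule order_trans[rotated])
  qed
  show ?thesis by (rule that[OF \<open>\<rho> > 0\<close> main])
qed

section \<open>A lower bound for the Wronskian\<close>

text \<open>A trigonometric polynomial is represented by the list of its coefficients and frequencies;
  repetitions are allowed, so that products are obtained by concatenation.\<close>

definition trig_poly :: "nat \<Rightarrow> real \<Rightarrow> (real \<Rightarrow> real) \<Rightarrow> bool" where
  "trig_poly K A P \<longleftrightarrow> (\<exists>L :: (complex \<times> int) list.
     (\<forall>x. of_real (P x) = (\<Sum>(c, n)\<leftarrow>L. c * ee (of_real (of_int n * x)))) \<and>
     (\<forall>(c, n)\<in>set L. \<bar>n\<bar> \<le> int K) \<and> (\<Sum>(c, n)\<leftarrow>L. norm c) \<le> A)"

lemma trig_poly_1: "trig_poly 0 1 (\<lambda>_. 1)"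
  unfolding trig_poly_def by (rule exI[of _ "[(1, 0)]"]) auto

lemma trig_poly_mult_elem:
  assumes "trig_poly K A P"
    and f: "\<And>x. of_real (f x) = a * ee (of_real x) + b + c * ee (of_real (- x))" "norm a + norm b + norm c \<le> C"
  shows "trig_poly (Suc K) (C * A) (\<lambda>x. f x * P x)"
proof -
  obtain L where L': "\<forall>x. of_real (P x) = (\<Sum>(c, n)\<leftarrow>L. c * ee (of_real (of_int n * x)))"
    "\<forall>(c, n)\<in>set L. \<bar>n\<bar> \<le> int K" "(\<Sum>(c, n)\<leftarrow>L. norm c) \<le> A"
    using assms(1) unfolding trig_poly_def by blast
  have L: "of_real (P x) = (\<Sum>(c, n)\<leftarrow>L. c * ee (of_real (of_int n * x)))"
    "(c, n) \<in> set L \<Longrightarrow> \<bar>n\<bar> \<le> int K" "(\<Sum>(c, n)\<leftarrow>L. norm c) \<le> A" for x c n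
    using L' by auto
  define sh where "sh = (\<lambda>(d::complex) (j::int) (L :: (complex \<times> int) list). map (\<lambda>(c, n). (d * c, n + j)) L)"
  define L' where "L' = sh a 1 L @ sh b 0 L @ sh c (-1) L"
  have sum1: "(\<Sum>(c, n)\<leftarrow>sh d j L. c * ee (of_real (of_int n * x))) =
      d * ee (of_real (of_int j * x)) * (\<Sum>(c, n)\<leftarrow>L. c * ee (of_real (of_int n * x)))" for d j x and L
    unfolding sh_def by (induction L) (auto simp: algebra_simps ee_add)
  have sum2: "(\<Sum>(c, n)\<leftarrow>sh d j L. norm c) = norm d * (\<Sum>(c, n)\<leftarrow>L. norm c)" for d j and L
    unfolding sh_def by (induction L) (auto simp: algebra_simps norm_mult)
  have nn: "0 \<le> (\<Sum>(c, n)\<leftarrow>L. norm c)" by (rule sum_list_nonneg) auto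
  show ?thesis
    unfolding trig_poly_def
  proof (intro exI[of _ L'] conjI allI)
    fix x
    have "(\<Sum>(c, n)\<leftarrow>L'. c * ee (of_real (of_int n * x))) =
        (a * ee (of_real x) + b + c * ee (of_real (- x))) * of_real (P x)"
      unfolding L'_def map_append sum_list_append sum1 L(1) by (simp add: distrib_right)
    thus "complex_of_real (f x * P x) = (\<Sum>(c, n)\<leftarrow>L'. c * ee (of_real (of_int n * x)))"
      by (simp only: f(1)[symmetric] of_real_mult)
    show "\<forall>(c, n)\<in>set L'. \<bar>n\<bar> \<le> int (Suc K)"
      using L(2) unfolding L'_def sh_def by fastforce
    have "(\<Sum>(c, n)\<leftarrow>L'. norm c) = (norm a + norm b + norm c) * (\<Sum>(c, n)\<leftarrow>L. norm c)"
      unfolding L'_def map_append sum_list_append sum2 by (simp add: distrib_right)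
    also have "\<dots> \<le> C * A"
      using f(2) L(3) nn by (intro mult_mono) (auto intro: order_trans[rotated])
    finally show "(\<Sum>(c, n)\<leftarrow>L'. norm c) \<le> C * A" .
  qed
qed

lemma cos_sq_elem:
  "complex_of_real ((cos (pi * (x - y)))\<^sup>2)
      = (ee (of_real (- y)) / 4) * ee (of_real x) + 1/2 + (ee (of_real y) / 4) * ee (of_real (- x))"
  "complex_of_real ((sin (pi * (x - y)))\<^sup>2)
      = (- ee (of_real (- y)) / 4) * ee (of_real x) + 1/2 + (- ee (of_real y) / 4) * ee (of_real (- x))"
proof -
  have e: "ee (of_real (- y)) * ee (of_real x) = cis (2 * (pi * (x - y)))"
    "ee (of_real y) * ee (of_real (- x)) = cis (- (2 * (pi * (x - y))))"
    unfolding ee_add[symmetric] of_real_add[symmetric] unfolding ee_of_real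
    by (rule arg_cong[where f = cis], simp add: algebra_simps)+
  have "ee (of_real (- y)) * ee (of_real x) + ee (of_real y) * ee (of_real (- x))
      = of_real (2 * cos (2 * (pi * (x - y))))"
    unfolding e by (simp add: complex_eq_iff)
  hence s: "ee (of_real (- y)) * ee (of_real x) / 4 + ee (of_real y) * ee (of_real (- x)) / 4
      = of_real (cos (2 * (pi * (x - y))) / 2)"
    by (simp add: field_simps)
  have "(cos (pi * (x - y)))\<^sup>2 = 1/2 + cos (2 * (pi * (x - y))) / 2"
    using cos_double_cos[of "pi * (x - y)"] by linarith
  hence r: "complex_of_real ((cos (pi * (x - y)))\<^sup>2) = 1/2 + of_real (cos (2 * (pi * (x - y))) / 2)"
    by (simp only: of_real_add) simp
  show "complex_of_real ((cos (pi * (x - y)))\<^sup>2)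
      = (ee (of_real (- y)) / 4) * ee (of_real x) + 1/2 + (ee (of_real y) / 4) * ee (of_real (- x))"
    unfolding r s[symmetric] by (simp add: algebra_simps)
  have "(sin (pi * (x - y)))\<^sup>2 = 1/2 - cos (2 * (pi * (x - y))) / 2"
    using cos_double_sin[of "pi * (x - y)"] by linarith
  hence r: "complex_of_real ((sin (pi * (x - y)))\<^sup>2) = 1/2 - of_real (cos (2 * (pi * (x - y))) / 2)"
    by (simp only: of_real_diff) simp
  show "complex_of_real ((sin (pi * (x - y)))\<^sup>2)
      = (- ee (of_real (- y)) / 4) * ee (of_real x) + 1/2 + (- ee (of_real y) / 4) * ee (of_real (- x))"
    unfolding r s[symmetric] by (simp add: algebra_simps)
qed

lemma trig_poly_mult_cos:
  assumes "trig_poly K A P"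
  shows "trig_poly (Suc K) A (\<lambda>x. (cos (pi * (x - y)))\<^sup>2 * P x)"
  using trig_poly_mult_elem[OF assms cos_sq_elem(1), of y 1] norm_ee_of_real[of y] norm_ee_of_real[of "- y"]
  by (simp add: norm_divide)

lemma trig_poly_mult_sin:
  assumes "trig_poly K A P" "q > 0"
  shows "trig_poly (Suc K) ((1 / q) * A) (\<lambda>x. (sin (pi * (x - y)))\<^sup>2 / q * P x)"
proof (rule trig_poly_mult_elem[OF assms(1)])
  show "complex_of_real ((sin (pi * (x - y)))\<^sup>2 / q)
      = (- ee (of_real (- y)) / 4 / of_real q) * ee (of_real x) + 1/2/of_real q
     + (- ee (of_real y) / 4 / of_real q) * ee (of_real (- x))" for x
    unfolding of_real_divide cos_sq_elem(2) using assms(2) by (simp add: field_simps)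
  show "norm (- ee (of_real (- y)) / 4 / of_real q) + norm (1/2/of_real q :: complex)
      + norm (- ee (of_real y) / 4 / of_real q) \<le> 1/q"
    using norm_ee_of_real[of y] norm_ee_of_real[of "- y"] assms(2) by (simp add: norm_divide field_simps)
qed

text \<open>A squared sine or cosine has coefficients of modulus 1/4, 1/2, 1/4 with sum 1. Each
  factor thus raises the degree by one and multiplies the coefficient sum by 1/q or by 1.\<close>

lemma trig_poly_product:
  assumes "finite S" "\<And>l. l \<in> S \<Longrightarrow> q l > 0"
  shows "trig_poly (card S + T) (\<Prod>l\<in>S. 1 / q l)
    (\<lambda>x. (\<Prod>l\<in>S. (sin (pi * (x - y l)))\<^sup>2 / q l) * ((cos (pi * (x - z)))\<^sup>2) ^ T)"
  using assms
proof (induction S rule: finite_induct)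
  case empty
  have "trig_poly T 1 (\<lambda>x. ((cos (pi * (x - z)))\<^sup>2) ^ T)"
  proof (induction T)
    case 0 thus ?case using trig_poly_1 by simp
  next
    case (Suc T) from trig_poly_mult_cos[OF this] show ?case by simp
  qed
  thus ?case by simp
next
  case (insert a S)
  from trig_poly_mult_sin[OF insert.IH, of "q a" "y a"] insert.prems insert.hyps
  show ?case by (simp add: mult.assoc)
qed

section \<open>Testing the measure of squared coefficients against trigonometric polynomials\<close>

context dual_quasi
begin

lemma w2_nonneg: "w2 l \<ge> 0"
  by (simp add: w2_def)

lemma w2_0: "w2 0 = 1"
  by (simp add: w2_def w_0)

lemma w2_bound: "w2 l \<le> B\<^sup>2 * exp (- (2 * \<epsilon> * \<bar>of_int l\<bar>))"
proof -
  have "w2 l \<le> (B * exp (- (\<epsilon> * \<bar>of_int l\<bar>)))\<^sup>2"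
    unfolding w2_def by (intro power_mono exp_decayingD[OF w_dec]) auto
  also have "\<dots> = B\<^sup>2 * exp (- (2 * \<epsilon> * \<bar>of_int l\<bar>))"
    by (simp add: power_mult_distrib flip: exp_of_nat_mult)
  finally show ?thesis .
qed

lemma w2_summable:
  assumes "\<And>l. norm (f l) \<le> C"
  shows "(\<lambda>l. of_real (w2 l) * f l :: complex) summable_on UNIV"
proof (rule norm_summable_on_bounded(2))
  show "(\<lambda>l. (B\<^sup>2 * C) * exp (- ((2 * \<epsilon>) * \<bar>of_int l\<bar>))) summable_on (UNIV :: int set)"
    using \<epsilon>_pos by (intro summable_on_cmult_right exp_sum_summable) auto
  fix l
  have C: "C \<ge> 0" using assms[of 0] norm_ge_zero order_trans by blast
  have "w2 l * norm (f l) \<le> (B\<^sup>2 * exp (- (2 * \<epsilon> * \<bar>of_int l\<bar>))) * C"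
    by (intro mult_mono w2_bound assms) (use w2_nonneg C in auto)
  thus "norm (of_real (w2 l) * f l) \<le> B\<^sup>2 * C * exp (- ((2 * \<epsilon>) * \<bar>of_int l\<bar>))"
    using w2_nonneg by (simp add: norm_mult mult_ac)
qed

definition \<phi> :: "int \<Rightarrow> real" where "\<phi> l = \<theta> + of_int l * \<alpha>"

text \<open>By linearity single frequencies suffice. They are bounded by
  \<open>wk_mean_bound\<close>, negative ones after a change of sign, and M >= 1 allows every power
  to be replaced by the K-th.\<close>

lemma trig_poly_functional:
  assumes M: "\<bar>E\<bar> + BV * exp_sum (\<epsilon>/2) + 2 \<le> M"
    and \<delta>: "\<And>x::real. norm (wr x) \<le> \<delta>" "2 * (\<eta> * B) * exp_sum (\<epsilon>/2) ^ 2 \<le> \<delta>"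
    and P: "trig_poly K A P"
  shows "norm (\<Sum>\<^sub>\<infinity>l. of_real (w2 l) * of_real (P (\<phi> l) - P (- \<phi> l)) :: complex) \<le> A * (M ^ K * \<delta>)"
proof -
  obtain L where L': "\<forall>x. of_real (P x) = (\<Sum>(c, n)\<leftarrow>L. c * ee (of_real (of_int n * x)))"
    "\<forall>(c, n)\<in>set L. \<bar>n\<bar> \<le> int K" "(\<Sum>(c, n)\<leftarrow>L. norm c) \<le> A"
    using P unfolding trig_poly_def by blast
  have L: "of_real (P x) = (\<Sum>(c, n)\<leftarrow>L. c * ee (of_real (of_int n * x)))"
    "(c, n) \<in> set L \<Longrightarrow> \<bar>n\<bar> \<le> int K" "(\<Sum>(c, n)\<leftarrow>L. norm c) \<le> A" for x c n
    using L' by auto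
  have nn: "exp_sum (\<epsilon>/2) \<ge> 0" "BV \<ge> 0"
    using V_dec exp_decaying_nonneg exp_sum_ge_1[of "\<epsilon>/2"] \<epsilon>_pos by auto
  have M1: "M \<ge> 1" using M nn mult_nonneg_nonneg[OF nn(2,1)] by linarith
  have \<delta>0: "\<delta> \<ge> 0" using \<delta>(1)[of 0] norm_ge_zero order_trans by blast
  define D where "D = (\<lambda>n l. ee (of_real (of_int n * \<phi> l)) - ee (of_real (of_int n * (- \<phi> l))))"
  have Dn: "norm (D n l) \<le> 2" for n l
    unfolding D_def by (rule order_trans[OF norm_triangle_ineq4]) (simp only: norm_ee_of_real)
  have Dsum: "(\<lambda>l. of_real (w2 l) * D n l) summable_on UNIV" for n
    by (rule w2_summable[OF Dn])
  have bound: "norm (\<Sum>\<^sub>\<infinity>l. of_real (w2 l) * D n l) \<le> M ^ K * \<delta>" if n: "\<bar>n\<bar> \<le> int K" for n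
  proof -
    define k where "k = nat \<bar>n\<bar>"
    have "norm (\<Sum>\<^sub>\<infinity>l. of_real (w2 l) * D (int k) l) \<le> M ^ k * \<delta>"
      using wk_mean_bound[OF M \<delta>, of k] unfolding D_def \<phi>_def by (simp only: of_int_of_nat_eq mult_minus_right)
    also have "\<dots> \<le> M ^ K * \<delta>"
      using M1 \<delta>0 n by (intro mult_right_mono power_increasing) (auto simp: k_def)
    finally have *: "norm (\<Sum>\<^sub>\<infinity>l. of_real (w2 l) * D (int k) l) \<le> M ^ K * \<delta>" .
    show ?thesis
    proof (cases "n \<ge> 0")
      case True thus ?thesis using * by (simp add: k_def)
    next
      case False
      hence "D n l = - D (int k) l" for l by (simp add: D_def k_def)
      hence "(\<Sum>\<^sub>\<infinity>l. of_real (w2 l) * D n l) = - (\<Sum>\<^sub>\<infinity>l. of_real (w2 l) * D (int k) l)"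
        by (simp add: infsum_uminus)
      thus ?thesis using * by simp
    qed
  qed
  have main: "(\<lambda>l. of_real (w2 l) * (\<Sum>(c, n)\<leftarrow>L. c * D n l)) summable_on UNIV \<and>
     norm (\<Sum>\<^sub>\<infinity>l. of_real (w2 l) * (\<Sum>(c, n)\<leftarrow>L. c * D n l)) \<le> (\<Sum>(c, n)\<leftarrow>L. norm c) * (M ^ K * \<delta>)"
    using L(2)
  proof (induction L)
    case (Cons p L)
    obtain c n where p: "p = (c, n)" by (cases p)
    have IH: "(\<lambda>l. of_real (w2 l) * (\<Sum>(c, n)\<leftarrow>L. c * D n l)) summable_on UNIV"
      "norm (\<Sum>\<^sub>\<infinity>l. of_real (w2 l) * (\<Sum>(c, n)\<leftarrow>L. c * D n l)) \<le> (\<Sum>(c, n)\<leftarrow>L. norm c) * (M ^ K * \<delta>)"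
      using Cons.IH Cons.prems by auto
    have s: "(\<lambda>l. c * (of_real (w2 l) * D n l)) summable_on UNIV"
      by (intro summable_on_cmult_right Dsum)
    have eq: "of_real (w2 l) * (\<Sum>(c, n)\<leftarrow>p # L. c * D n l) =
       c * (of_real (w2 l) * D n l) + of_real (w2 l) * (\<Sum>(c, n)\<leftarrow>L. c * D n l)" for l
      by (simp add: p algebra_simps)
    have "(\<Sum>\<^sub>\<infinity>l. of_real (w2 l) * (\<Sum>(c, n)\<leftarrow>p # L. c * D n l)) =
        c * (\<Sum>\<^sub>\<infinity>l. of_real (w2 l) * D n l) + (\<Sum>\<^sub>\<infinity>l. of_real (w2 l) * (\<Sum>(c, n)\<leftarrow>L. c * D n l))"
      unfolding eq infsum_add[OF s IH(1)] by (simp add: infsum_cmult_right')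
    also have "norm \<dots> \<le> norm c * (M ^ K * \<delta>) + (\<Sum>(c, n)\<leftarrow>L. norm c) * (M ^ K * \<delta>)"
      by (rule order_trans[OF norm_triangle_ineq])
         (use IH(2) bound[of n] Cons.prems[of c n] in \<open>auto simp: p norm_mult intro!: add_mono mult_left_mono\<close>)
    finally show ?case unfolding eq using summable_on_add[OF s IH(1)] by (simp add: p distrib_right)
  qed auto
  have "of_real (P (\<phi> l) - P (- \<phi> l)) = (\<Sum>(c, n)\<leftarrow>L. c * D n l)" for l
    unfolding of_real_diff L(1) D_def by (induction L) (auto simp: algebra_simps)
  hence "norm (\<Sum>\<^sub>\<infinity>l. of_real (w2 l) * of_real (P (\<phi> l) - P (- \<phi> l)) :: complex)
      \<le> (\<Sum>(c, n)\<leftarrow>L. norm c) * (M ^ K * \<delta>)"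
    using main by simp
  also have "\<dots> \<le> A * (M ^ K * \<delta>)"
    using L(3) M1 \<delta>0 by (intro mult_right_mono) auto
  finally show ?thesis .
qed

text \<open>\<open>P\<close> is 1 at \<theta> and vanishes at the reflected phases with index in S.
  The power of the squared cosine damps the other reflected phases in the window, all at distance at
  least \<open>rad\<close> from \<theta> modulo 1, and beyond the window the decay of
  \<open>w2\<close> takes over. As \<open>w2 0 = 1\<close>, near symmetry would be contradictory for
  small \<delta>. \<open>Q\<close> bounds the coefficient sum of \<open>P\<close>, the price of the
  prescribed zeros.\<close>

lemma wronskian_lower_raw:
  assumes M: "\<bar>E\<bar> + BV * exp_sum (\<epsilon>/2) + 2 \<le> M"
    and \<delta>: "\<And>x::real. norm (wr x) \<le> \<delta>" "2 * (\<eta> * B) * exp_sum (\<epsilon>/2) ^ 2 \<le> \<delta>"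
    and S: "S = {l. \<bar>l\<bar> \<le> int d \<and> dist_Z (2 * \<theta> + of_int l * \<alpha>) < rad}" and "rad > 0"
    and nz: "\<And>l. l \<in> S \<Longrightarrow> dist_Z (2 * \<theta> + of_int l * \<alpha>) > 0"
    and Q: "(\<Prod>l\<in>S. 1 / (dist_Z (2 * \<theta> + of_int l * \<alpha>))\<^sup>2) \<le> Q"
  shows "1 \<le> Q * (B\<^sup>2 * exp_sum \<epsilon> * (exp (- (rad\<^sup>2 * T)) + exp (- (\<epsilon> * d)))) + Q * (M ^ (T + 2 * d + 1) * \<delta>)"
proof -
  define y where "y = (\<lambda>l::int. - \<theta> - of_int l * \<alpha>)"
  \<comment> \<open>Normalises each squared sine to the value 1 at \<theta>; positive on S because
    the node differs from \<theta> modulo 1.\<close>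
  define q where "q = (\<lambda>l. (sin (pi * (\<theta> - y l)))\<^sup>2)"
  define P where "P = (\<lambda>x. (\<Prod>l\<in>S. (sin (pi * (x - y l)))\<^sup>2 / q l) * ((cos (pi * (x - \<theta>)))\<^sup>2) ^ T)"
  define s where "s = (\<lambda>l::int. dist_Z (2 * \<theta> + of_int l * \<alpha>))"
  have Ssub: "S \<subseteq> {- int d..int d}" unfolding S by auto
  hence fS: "finite S" by (rule finite_subset) simp
  have \<theta>y: "\<theta> - y l = 2 * \<theta> + of_int l * \<alpha>" for l by (simp add: y_def)
  have qs: "(s l)\<^sup>2 \<le> q l" for l
    unfolding q_def \<theta>y s_def using power_mono[OF abs_sin_pi_ge[of "2 * \<theta> + of_int l * \<alpha>"] dist_Z_nonneg, of 2]
        by simp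
  have q0: "q l > 0" if "l \<in> S" for l
    using qs[of l] nz[OF that] by (smt (verit) s_def zero_less_power)
  have P0: "P x \<ge> 0" for x unfolding P_def by (intro mult_nonneg_nonneg prod_nonneg) (auto simp: q_def)
  have P1: "P \<theta> = 1" unfolding P_def using q0 by (auto simp: q_def intro!: prod.neutral)
  define A where "A = (\<Prod>l\<in>S. 1 / q l)"
  have A0: "A \<ge> 0" unfolding A_def by (intro prod_nonneg) (auto simp: q_def)
  have AQ: "A \<le> Q"
  proof -
    have "A \<le> (\<Prod>l\<in>S. 1 / (s l)\<^sup>2)"
      unfolding A_def
    proof (intro prod_mono conjI)
      fix l assume "l \<in> S"
      thus "1 / q l \<le> 1 / (s l)\<^sup>2" using qs[of l] nz[of l] q0[of l]
          by (intro divide_left_mono) (auto simp: s_def)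
      show "0 \<le> 1 / q l" by (simp add: q_def)
    qed
    thus ?thesis using Q by (simp add: s_def)
  qed
  have Pbound: "P (- \<phi> l) \<le> A * (exp (- (rad\<^sup>2 * T)) + (if \<bar>l\<bar> \<le> int d then 0 else 1))" for l
  proof (cases "l \<in> S")
    case True
    have "- \<phi> l - y l = 0" by (simp add: \<phi>_def y_def)
    hence "P (- \<phi> l) = 0" unfolding P_def using True fS by (auto intro!: prod_zero bexI[of _ l])
    thus ?thesis using A0 by simp
  next
    case False
    have "(\<Prod>l'\<in>S. (sin (pi * (- \<phi> l - y l')))\<^sup>2 / q l') \<le> A"
      unfolding A_def using q0
      by (intro prod_mono conjI divide_right_mono) (auto simp: q_def abs_square_le_1 less_imp_le)
    hence 1: "P (- \<phi> l) \<le> A * ((cos (pi * (- \<phi> l - \<theta>)))\<^sup>2) ^ T"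
      unfolding P_def by (intro mult_right_mono) auto
    show ?thesis
    proof (cases "\<bar>l\<bar> \<le> int d")
      case True
      hence sl: "s l \<ge> rad" using False by (auto simp: S s_def)
      have eq: "- \<phi> l - \<theta> = - (2 * \<theta> + of_int l * \<alpha>)" by (simp add: \<phi>_def)
      have "(cos (pi * (- \<phi> l - \<theta>)))\<^sup>2 = 1 - (sin (pi * (2 * \<theta> + of_int l * \<alpha>)))\<^sup>2"
        unfolding eq mult_minus_right cos_minus by (rule cos_squared_eq)
      also have "\<dots> = 1 - q l" by (simp add: q_def \<theta>y)
      also have "\<dots> \<le> 1 - rad\<^sup>2" using qs[of l] power_mono[OF sl, of 2] \<open>rad > 0\<close> by simp
      also have "\<dots> \<le> exp (- (rad\<^sup>2))" using exp_ge_add_one_self[of "- (rad\<^sup>2)"] by simp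
      finally have "((cos (pi * (- \<phi> l - \<theta>)))\<^sup>2) ^ T \<le> exp (- (rad\<^sup>2)) ^ T" by (intro power_mono) auto
      also have "\<dots> = exp (- (rad\<^sup>2 * T))" by (simp flip: exp_of_nat_mult add: mult_ac)
      finally show ?thesis using 1 A0 True by (smt (verit) mult_left_mono)
    next
      case False
      have "((cos (pi * (- \<phi> l - \<theta>)))\<^sup>2) ^ T \<le> 1" by (rule power_le_one) (auto simp: abs_square_le_1)
      also have "\<dots> \<le> exp (- (rad\<^sup>2 * T)) + (if \<bar>l\<bar> \<le> int d then 0 else 1)" using False by simp
      finally show ?thesis using 1 A0 by (smt (verit) mult_left_mono)
    qed
  qed
  define err where "err = exp (- (rad\<^sup>2 * T)) + exp (- (\<epsilon> * d))"
  have tbound: "w2 l * P (- \<phi> l) \<le> (A * (B\<^sup>2 * err)) * exp (- (\<epsilon> * \<bar>of_int l\<bar>))" for l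
  proof -
    have "w2 l * P (- \<phi> l) \<le> (B\<^sup>2 * exp (- (2 * \<epsilon> * \<bar>of_int l\<bar>))) * (A * (exp (- (rad\<^sup>2 * T)) + (if \<bar>l\<bar>
        \<le> int d then 0 else 1)))"
      by (intro mult_mono w2_bound Pbound) (use P0 in auto)
    also have "\<dots> = A * B\<^sup>2 * (exp (- (2 * \<epsilon> * \<bar>of_int l\<bar>)) * (exp (- (rad\<^sup>2 * T)) + (if \<bar>l\<bar>
        \<le> int d then 0 else 1)))"
      by (simp only: mult_ac)
    also have "\<dots> \<le> A * B\<^sup>2 * (exp (- (\<epsilon> * \<bar>of_int l\<bar>)) * err)"
    proof (intro mult_left_mono)
      have a: "exp (- (2 * \<epsilon> * \<bar>of_int l\<bar>)) = exp (- (\<epsilon> * \<bar>of_int l\<bar>)) * exp (- (\<epsilon> * \<bar>of_int l\<bar>))"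
        unfolding mult_exp_exp by simp
      have b: "exp (- (\<epsilon> * \<bar>of_int l\<bar>)) * (exp (- (rad\<^sup>2 * T)) + (if \<bar>l\<bar> \<le> int d then 0 else 1)) \<le> err"
      proof (cases "\<bar>l\<bar> \<le> int d")
        case True
        have "exp (- (\<epsilon> * \<bar>of_int l\<bar>)) * exp (- (rad\<^sup>2 * T)) \<le> 1 * exp (- (rad\<^sup>2 * T))"
          using \<epsilon>_pos by (intro mult_right_mono) auto
        thus ?thesis using True by (simp add: err_def add_increasing2)
      next
        case False
        hence ld: "real d \<le> \<bar>real_of_int l\<bar>" by linarith
        have g1: "exp (- (\<epsilon> * \<bar>of_int l\<bar>)) * exp (- (rad\<^sup>2 * T)) \<le> 1 * exp (- (rad\<^sup>2 * T))"
          using \<epsilon>_pos by (intro mult_right_mono) auto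
        have g2: "exp (- (\<epsilon> * \<bar>of_int l\<bar>)) \<le> exp (- (\<epsilon> * d))" using ld \<epsilon>_pos by simp
        have g3: "(if \<bar>l\<bar> \<le> int d then 0 else 1) = (1::real)" using False by simp
        show ?thesis unfolding g3 err_def distrib_left mult_1_right using g1 g2 by linarith
      qed
      show "exp (- (2 * \<epsilon> * \<bar>of_int l\<bar>)) * (exp (- (rad\<^sup>2 * T)) + (if \<bar>l\<bar> \<le> int d then 0 else 1))
          \<le> exp (- (\<epsilon> * \<bar>of_int l\<bar>)) * err"
        unfolding a by (subst mult.assoc, rule mult_left_mono[OF b]) simp
    qed (use A0 in auto)
    finally show ?thesis by (simp only: mult_ac)
  qed
  have sumE: "(\<lambda>l. (A * (B\<^sup>2 * err)) * exp (- (\<epsilon> * \<bar>of_int l\<bar>))) summable_on (UNIV :: int set)"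
    by (intro summable_on_cmult_right exp_sum_summable \<epsilon>_pos)
  have sum_minus: "(\<lambda>l. w2 l * P (- \<phi> l)) summable_on UNIV"
    by (rule summable_on_comparison_test[OF sumE]) (use tbound P0 w2_nonneg in auto)
  have Pup: "P x \<le> A" for x
  proof -
    have "(\<Prod>l'\<in>S. (sin (pi * (x - y l')))\<^sup>2 / q l') \<le> A"
      unfolding A_def using q0
      by (intro prod_mono conjI divide_right_mono) (auto simp: q_def abs_square_le_1 less_imp_le)
    moreover have "((cos (pi * (x - \<theta>)))\<^sup>2) ^ T \<le> 1" by (rule power_le_one) (auto simp: abs_square_le_1)
    ultimately have "P x \<le> A * 1" unfolding P_def using A0 by (intro mult_mono) auto
    thus ?thesis by simp
  qed
  have sum_plus: "(\<lambda>l. w2 l * P (\<phi> l)) summable_on UNIV"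
  proof (rule summable_on_comparison_test)
    show "(\<lambda>l. (B\<^sup>2 * A) * exp (- ((2 * \<epsilon>) * \<bar>of_int l\<bar>))) summable_on (UNIV :: int set)"
      using \<epsilon>_pos by (intro summable_on_cmult_right exp_sum_summable) auto
    show "w2 l * P (\<phi> l) \<le> (B\<^sup>2 * A) * exp (- ((2 * \<epsilon>) * \<bar>of_int l\<bar>))" for l
    proof -
      have "w2 l * P (\<phi> l) \<le> (B\<^sup>2 * exp (- (2 * \<epsilon> * \<bar>of_int l\<bar>))) * A"
        by (intro mult_mono w2_bound Pup) (use P0 in auto)
      thus ?thesis by (simp only: mult_ac)
    qed
  qed (use P0 w2_nonneg in auto)
  \<comment> \<open>All terms are non-negative, and the one at l = 0 alone contributes 1.\<close>
  have "1 = (\<Sum>\<^sub>\<infinity>l\<in>{0}. w2 l * P (\<phi> l))" by (simp add: w2_0 \<phi>_def P1)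
  also have "\<dots> \<le> (\<Sum>\<^sub>\<infinity>l. w2 l * P (\<phi> l))"
    by (rule infsum_mono_neutral) (use sum_plus P0 w2_nonneg in auto)
  also have "\<dots> = (\<Sum>\<^sub>\<infinity>l. w2 l * P (- \<phi> l)) + (\<Sum>\<^sub>\<infinity>l. w2 l * (P (\<phi> l) - P (- \<phi> l)))"
  proof -
    have s2: "(\<lambda>l. w2 l * P (\<phi> l) + - (w2 l * P (- \<phi> l))) summable_on UNIV"
      by (rule summable_on_add[OF sum_plus summable_on_uminus[THEN iffD2, OF sum_minus]])
    have "(\<Sum>\<^sub>\<infinity>l. w2 l * P (\<phi> l)) = (\<Sum>\<^sub>\<infinity>l. w2 l * P (- \<phi> l) + (w2 l * P (\<phi> l) + - (w2 l * P (- \<phi> l))))"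
      by simp
    also have "\<dots> = (\<Sum>\<^sub>\<infinity>l. w2 l * P (- \<phi> l)) + (\<Sum>\<^sub>\<infinity>l. w2 l * P (\<phi> l) + - (w2 l * P (- \<phi> l)))"
      by (rule infsum_add[OF sum_minus s2])
    finally show ?thesis by (simp add: right_diff_distrib)
  qed
  also have "\<dots> \<le> A * (B\<^sup>2 * exp_sum \<epsilon> * err) + A * (M ^ (card S + T) * \<delta>)"
  proof (rule add_mono)
    have "(\<Sum>\<^sub>\<infinity>l. w2 l * P (- \<phi> l)) \<le> (\<Sum>\<^sub>\<infinity>l::int. (A * (B\<^sup>2 * err)) * exp (- (\<epsilon> * \<bar>of_int l\<bar>)))"
      by (rule infsum_mono[OF sum_minus sumE tbound])
    also have "\<dots> = A * (B\<^sup>2 * exp_sum \<epsilon> * err)"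
      by (simp add: infsum_cmult_right' exp_sum_def)
    finally show "(\<Sum>\<^sub>\<infinity>l. w2 l * P (- \<phi> l)) \<le> A * (B\<^sup>2 * exp_sum \<epsilon> * err)" .
    have tp: "trig_poly (card S + T) A P"
      unfolding P_def A_def by (rule trig_poly_product[OF fS q0])
    have "(\<Sum>\<^sub>\<infinity>l. w2 l * (P (\<phi> l) - P (- \<phi> l))) \<le> norm (complex_of_real (\<Sum>\<^sub>\<infinity>l. w2 l * (P (\<phi> l) - P (- \<phi> l))))"
      by simp
    also have "complex_of_real (\<Sum>\<^sub>\<infinity>l. w2 l * (P (\<phi> l) - P (- \<phi> l))) =
        (\<Sum>\<^sub>\<infinity>l. of_real (w2 l) * of_real (P (\<phi> l) - P (- \<phi> l)))"
    proof -
      have "(\<lambda>l. w2 l * P (\<phi> l) + - (w2 l * P (- \<phi> l))) summable_on UNIV"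
        by (rule summable_on_add[OF sum_plus summable_on_uminus[THEN iffD2, OF sum_minus]])
      hence "(\<lambda>l. w2 l * (P (\<phi> l) - P (- \<phi> l))) summable_on UNIV" by (simp add: right_diff_distrib)
      from has_sum_of_real[OF has_sum_infsum[OF this], where ?'a = complex] show ?thesis
        by (simp only: of_real_mult[symmetric] infsumI)
    qed
    also have "norm \<dots> \<le> A * (M ^ (card S + T) * \<delta>)"
      by (rule trig_poly_functional[OF M \<delta> tp])
    finally show "(\<Sum>\<^sub>\<infinity>l. w2 l * (P (\<phi> l) - P (- \<phi> l))) \<le> A * (M ^ (card S + T) * \<delta>)" .
  qed
  also have "\<dots> \<le> Q * (B\<^sup>2 * exp_sum \<epsilon> * err) + Q * (M ^ (T + 2 * d + 1) * \<delta>)"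
  proof -
    have nn: "exp_sum (\<epsilon>/2) \<ge> 0" "BV \<ge> 0" "exp_sum \<epsilon> \<ge> 0"
      using V_dec exp_decaying_nonneg exp_sum_ge_1[of "\<epsilon>/2"] exp_sum_ge_1[of \<epsilon>] \<epsilon>_pos by auto
    have M1: "M \<ge> 1" using M nn mult_nonneg_nonneg[OF nn(2,1)] by linarith
    have \<delta>0: "\<delta> \<ge> 0" using \<delta>(1)[of 0] norm_ge_zero order_trans by blast
    have "card S \<le> card {- int d..int d}" by (rule card_mono[OF _ Ssub]) auto
    hence cS: "card S + T \<le> T + 2 * d + 1" by simp
    have h: "M ^ (card S + T) * \<delta> \<le> M ^ (T + 2 * d + 1) * \<delta>"
      by (intro mult_right_mono power_increasing cS M1 \<delta>0)
    have "err \<ge> 0" by (simp add: err_def)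
    hence "A * (B\<^sup>2 * exp_sum \<epsilon> * err) \<le> Q * (B\<^sup>2 * exp_sum \<epsilon> * err)"
      using nn by (intro mult_right_mono AQ) auto
    moreover have "A * (M ^ (card S + T) * \<delta>) \<le> Q * (M ^ (T + 2 * d + 1) * \<delta>)"
      by (rule mult_mono[OF AQ h]) (use A0 AQ M1 \<delta>0 in auto)
    ultimately show ?thesis by (rule add_mono)
  qed
  finally show ?thesis by (simp add: err_def)
qed

end

text \<open>\<open>wronskian_lower_raw\<close> with window d and cosine power T both proportional to
  ln L. Every exponential in d or T is then a power of L, including the growth of
  \<open>M ^ (T + 2 * d + 1)\<close>, and the localisation errors can be made at most 1/2.\<close>

lemma wronskian_lower:
  fixes \<epsilon> \<kappa> \<tau> M b :: real
  assumes pos: "\<epsilon> > 0" "\<kappa> > 0" "\<tau> > 0" "b > 0" "M \<ge> 2"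
  obtains C L0 where "C > 0" "L0 > 1"
    "\<And>\<alpha> \<theta> E B \<eta> BV V w r L j \<delta>. \<lbrakk>dual_quasi \<alpha> \<theta> E \<epsilon> B \<eta> BV V w r; \<bar>E\<bar> + BV * exp_sum (\<epsilon>/2) + 2 \<le> M;
       \<forall>k::int. k \<noteq> 0 \<longrightarrow> \<kappa> * \<bar>of_int k\<bar> powr (- \<tau>) \<le> dist_Z (of_int k * \<alpha>);
       dist_Z (2 * \<theta> - of_int j * \<alpha>) = 1 / L; \<bar>of_int j\<bar> \<le> b * ln L; B \<le> L powr b; L \<ge> L0;
       \<forall>x::real. norm (dual_quasi.wr \<alpha> \<theta> w (of_real x)) \<le> \<delta>; 2 * (\<eta> * B) * exp_sum (\<epsilon>/2) ^ 2 \<le> \<delta>\<rbrakk>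
     \<Longrightarrow> L powr (- C) \<le> \<delta>"
proof -
  \<comment> \<open>The rate \<epsilon>/4 makes the inverse square of the product cost
    exp(\<epsilon> d / 2), half of what the decay of \<open>w2\<close> retains at the edge of the
    window.\<close>
  obtain rad where rad: "rad > 0"
    "\<And>d S m y. spaced \<kappa> \<tau> rad d m S y \<Longrightarrow> exp (- (\<epsilon>/4 * real d)) \<le> (\<Prod>l\<in>S. y l)"
    using near_product[OF pos(2,3), of "\<epsilon>/4"] pos by auto
  \<comment> \<open>The errors carry \<open>Q\<close>, which is L^2 exp(\<epsilon> d / 2), and B^2
    <= L^(2b); p leaves one spare power of L. \<open>D1\<close> makes exp(-\<epsilon> d / 2) at most
    L^(-p) and, being at least b, puts the resonance into the window. \<open>T1\<close> lets the
    cosine power beat L^p and exp(\<epsilon> d / 2) together, up to a constant.\<close>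
  define p where "p = 3 + 2 * b"
  define D1 where "D1 = 2 * p / \<epsilon> + b"
  define T1 where "T1 = (\<epsilon> * D1 / 2 + p) / rad\<^sup>2"
  \<comment> \<open>Chosen so that 2 a d <= (ln L)/2 + 2a: the Diophantine loss (2d)^\<tau> is then
    at most a constant times the square root of L.\<close>
  define a where "a = 1 / (4 * D1)"
  define K0 where "K0 = (\<tau> / a) powr \<tau>"
  define c1 where "c1 = 2 + \<epsilon> * D1 / 2 + (T1 + 2 * D1) * ln M"
  define c2 where "c2 = \<epsilon>/2 + 4 * ln M"
  define C where "C = c1 + c2 + 1"
  \<comment> \<open>The three entries ensure ln L >= 1, localisation errors of at most 1/2, and that
    no distance in the window is smaller than 1/L.\<close>
  define L0 where "L0 = max (exp 1) (max (2 * (exp_sum \<epsilon> * (exp (\<epsilon>/2) + 1))) ((2 * K0 * exp (2 * a) / \<kappa>)\<^sup>2))"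
  have p0: "p > 0" using pos by (simp add: p_def)
  have D1: "D1 > 0" "b \<le> D1" "p \<le> \<epsilon> * D1 / 2"
    using pos p0 by (auto simp: D1_def field_simps intro!: add_pos_pos)
  have T1: "T1 > 0" "rad\<^sup>2 * T1 = \<epsilon> * D1 / 2 + p"
    using pos p0 D1 rad by (auto simp: T1_def intro!: divide_pos_pos add_pos_pos)
  have a0: "a > 0" "K0 > 0" using D1 pos by (auto simp: a_def K0_def)
  have lnM: "ln M \<ge> 0" using pos by simp
  have cpos: "c1 > 0" "c2 > 0" "C > 0"
    using pos D1 T1 lnM by (auto simp: c1_def c2_def C_def intro!: add_pos_nonneg add_nonneg_nonneg)
  have L01: "L0 > 1"
  proof -
    have "(1::real) < exp 1" by simp
    also have "\<dots> \<le> L0" by (simp add: L0_def)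
    finally show ?thesis .
  qed
  have main: "L powr (- C) \<le> \<delta>"
    if dq: "dual_quasi \<alpha> \<theta> E \<epsilon> B \<eta> BV V w r" and M: "\<bar>E\<bar> + BV * exp_sum (\<epsilon>/2) + 2 \<le> M"
      and dc: "\<forall>k::int. k \<noteq> 0 \<longrightarrow> \<kappa> * \<bar>of_int k\<bar> powr (- \<tau>) \<le> dist_Z (of_int k * \<alpha>)"
      and dj: "dist_Z (2 * \<theta> - of_int j * \<alpha>) = 1 / L" and jb: "\<bar>of_int j\<bar> \<le> b * ln L"
      and BL: "B \<le> L powr b" and LL0: "L \<ge> L0"
      and \<delta>1: "\<forall>x::real. norm (dual_quasi.wr \<alpha> \<theta> w (of_real x)) \<le> \<delta>"
          and \<delta>2: "2 * (\<eta> * B) * exp_sum (\<epsilon>/2) ^ 2 \<le> \<delta>"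
    for \<alpha> \<theta> E B \<eta> BV V w r L j \<delta>
  proof -
    interpret dual_quasi \<alpha> \<theta> E \<epsilon> B \<eta> BV V w r by (rule dq)
    define l where "l = ln L"
    have L1: "L > 1" using LL0 L01 by simp
    have Lexp: "L = exp l" using L1 by (simp add: l_def)
    have l1: "l \<ge> 1"
    proof -
      have "exp 1 \<le> L" using LL0 by (simp add: L0_def)
      thus ?thesis unfolding Lexp by simp
    qed
    define d where "d = nat \<lceil>D1 * l\<rceil>"
    define T where "T = nat \<lceil>T1 * l\<rceil>"
    have dl: "D1 * l \<le> real d" "real d \<le> D1 * l + 1"
    proof -
      have "D1 * l > 0" using D1 l1 by (intro mult_pos_pos) auto
      hence "real d = of_int \<lceil>D1 * l\<rceil>" unfolding d_def by simp
      thus "D1 * l \<le> real d" "real d \<le> D1 * l + 1" by linarith+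
    qed
    have Tl: "T1 * l \<le> real T" "real T \<le> T1 * l + 1"
    proof -
      have "T1 * l > 0" using T1 l1 by (intro mult_pos_pos) auto
      hence "real T = of_int \<lceil>T1 * l\<rceil>" unfolding T_def by simp
      thus "T1 * l \<le> real T" "real T \<le> T1 * l + 1" by linarith+
    qed
    have d0: "d > 0"
    proof -
      have "D1 * l > 0" using D1 l1 by (intro mult_pos_pos) auto
      thus ?thesis using dl by (intro gr0I) auto
    qed
    define y where "y = (\<lambda>k::int. dist_Z (2 * \<theta> + of_int k * \<alpha>))"
    \<comment> \<open>The window is indexed by 2\<theta> + k\<alpha>, the resonance by 2\<theta> -
      j\<alpha>.\<close>
    define m where "m = - j"
    have ym: "y m = 1 / L" using dj by (simp add: y_def m_def)
    have mrange: "m \<in> {- int d..int d}"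
    proof -
      have "b * l \<le> D1 * l" using D1(2) l1 by (intro mult_right_mono) auto
      hence "\<bar>of_int j\<bar> \<le> D1 * l" using jb by (simp add: l_def)
      hence "\<bar>real_of_int j\<bar> \<le> real d" using dl by linarith
      thus ?thesis unfolding m_def by auto
    qed
    have sep: "\<kappa> * \<bar>of_int (k - k')\<bar> powr (- \<tau>) \<le> y k + y k'" if "k \<noteq> k'" for k k'
    proof -
      have "\<kappa> * \<bar>of_int (k - k')\<bar> powr (- \<tau>) \<le> dist_Z (of_int (k - k') * \<alpha>)"
          by (rule dc[rule_format]) (use that in simp)
      also have "of_int (k - k') * \<alpha> = (2 * \<theta> + of_int k * \<alpha>) - (2 * \<theta> + of_int k' * \<alpha>)"
          by (simp add: algebra_simps)
      also have "dist_Z \<dots> \<le> y k + y k'" unfolding y_def by (rule dist_Z_diff)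
      finally show ?thesis .
    qed
    \<comment> \<open>The Diophantine condition makes the distances at k and m add up to at least
      2/L, and the one at m is exactly 1/L.\<close>
    have closest: "1 / L \<le> y k" if k: "k \<in> {- int d..int d}" "k \<noteq> m" for k
    proof -
      define x where "x = real (2 * d)"
      have x: "x > 0" using d0 by (simp add: x_def)
      have kx: "\<bar>real_of_int (k - m)\<bar> \<le> x" "\<bar>real_of_int (k - m)\<bar> > 0"
      proof -
        have "\<bar>k - m\<bar> \<le> 2 * int d" using k mrange by auto
        hence "real_of_int \<bar>k - m\<bar> \<le> real_of_int (2 * int d)" by (rule of_int_le_iff[THEN iffD2])
        thus "\<bar>real_of_int (k - m)\<bar> \<le> x" by (simp add: x_def)
        show "\<bar>real_of_int (k - m)\<bar> > 0" using k by simp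
      qed
      have "x powr \<tau> \<le> K0 * exp (a * x)" unfolding K0_def by (rule powr_le_exp[OF x a0(1) pos(3)])
      also have "\<dots> \<le> K0 * exp (l / 2 + 2 * a)"
      proof -
        have "a * x \<le> a * (2 * (D1 * l + 1))" using dl a0 by (intro mult_left_mono) (auto simp: x_def)
        also have "\<dots> = l / 2 + 2 * a" using D1 by (simp add: a_def field_simps)
        finally show ?thesis using a0 by (intro mult_left_mono) auto
      qed
      also have "\<dots> = (K0 * exp (2 * a)) * exp (l/2)" by (simp add: exp_add)
      finally have xt: "x powr \<tau> \<le> (K0 * exp (2 * a)) * exp (l/2)" .
      have "2 * K0 * exp (2 * a) / \<kappa> \<le> exp (l / 2)"
      proof (rule power2_le_imp_le)
        have "(2 * K0 * exp (2 * a) / \<kappa>)\<^sup>2 \<le> L" using LL0 by (simp add: L0_def)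
        also have "L = (exp (l/2))\<^sup>2" by (simp add: Lexp power2_eq_square flip: exp_add)
        finally show "(2 * K0 * exp (2 * a) / \<kappa>)\<^sup>2 \<le> (exp (l/2))\<^sup>2" .
      qed auto
      hence "2 * K0 * exp (2 * a) \<le> \<kappa> * exp (l / 2)" using pos by (simp add: field_simps)
      hence "(2 * K0 * exp (2 * a)) * exp (l/2) \<le> (\<kappa> * exp (l/2)) * exp (l/2)"
        by (rule mult_right_mono) simp
      hence "2 * (x powr \<tau>) \<le> (\<kappa> * exp (l/2)) * exp (l/2)"
        using xt by linarith
      also have "\<dots> = \<kappa> * L" by (simp add: Lexp flip: exp_add)
      finally have "2 / L \<le> \<kappa> / x powr \<tau>" using L1 x by (simp add: field_simps)
      also have "\<dots> \<le> \<kappa> * \<bar>of_int (k - m)\<bar> powr (- \<tau>)"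
      proof -
        have "\<bar>of_int (k - m)\<bar> powr \<tau> \<le> x powr \<tau>" using kx pos by (intro powr_mono2) auto
        thus ?thesis using kx x pos by (simp add: powr_minus field_simps)
      qed
      also have "\<dots> \<le> y k + y m" by (rule sep[OF k(2)])
      finally show ?thesis using ym by simp
    qed
    define S where "S = {k. \<bar>k\<bar> \<le> int d \<and> dist_Z (2 * \<theta> + of_int k * \<alpha>) < rad}"
    have Sr: "S \<subseteq> {- int d..int d}" by (auto simp: S_def)
    hence fS: "finite S" by (rule finite_subset) simp
    have ypos: "y k \<ge> 1 / L" if "k \<in> {- int d..int d}" for k
      using closest[OF that] ym by (cases "k = m") auto
    have ypos': "y k > 0" if "k \<in> {- int d..int d}" for k
      by (rule less_le_trans[OF _ ypos[OF that]]) (use L1 in simp)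
    have "spaced \<kappa> \<tau> rad d m (S - {m}) y"
      unfolding spaced_def using Sr mrange ypos ypos' ym sep by (auto simp: S_def y_def subset_iff)
    hence prod': "exp (- (\<epsilon>/4 * real d)) \<le> (\<Prod>l\<in>S - {m}. y l)" by (rule rad(2))
    \<comment> \<open>The index m is the only one that \<open>near_product\<close> leaves out; it
      costs a single factor 1/L, the origin of the L^2 in \<open>Q\<close>.\<close>
    have prodS: "exp (- (\<epsilon>/4 * real d)) / L \<le> (\<Prod>l\<in>S. y l)"
    proof (cases "m \<in> S")
      case True
      have "(\<Prod>l\<in>S. y l) = y m * (\<Prod>l\<in>S - {m}. y l)" by (rule prod.remove[OF fS True])
      thus ?thesis using prod' L1 by (simp add: ym divide_right_mono)
    next
      case False
      have "exp (- (\<epsilon>/4 * real d)) / L \<le> exp (- (\<epsilon>/4 * real d))" using L1 by (simp add: field_simps)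
      thus ?thesis using prod' False by simp
    qed
    define Q where "Q = L\<^sup>2 * exp (\<epsilon> * d / 2)"
    have Q: "(\<Prod>l\<in>S. 1 / (dist_Z (2 * \<theta> + of_int l * \<alpha>))\<^sup>2) \<le> Q"
    proof -
      have "(\<Prod>l\<in>S. 1 / (y l)\<^sup>2) = 1 / (\<Prod>l\<in>S. y l)\<^sup>2"
        by (simp add: prod_dividef prod_power_distrib)
      also have "\<dots> \<le> 1 / (exp (- (\<epsilon>/4 * real d)) / L)\<^sup>2"
        using prodS L1 by (intro divide_left_mono power_mono mult_pos_pos zero_less_power)
           (auto intro: less_le_trans[OF _ prodS])
      also have "\<dots> = L\<^sup>2 * (exp (\<epsilon>/4 * real d))\<^sup>2" by (simp add: power_divide exp_minus field_simps)
      also have "(exp (\<epsilon>/4 * real d))\<^sup>2 = exp (\<epsilon> * d / 2)" by (simp add: power2_eq_square flip: exp_add)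
      finally show ?thesis by (simp add: Q_def y_def)
    qed
    have "1 \<le> Q * (B\<^sup>2 * exp_sum \<epsilon> * (exp (- (rad\<^sup>2 * T)) + exp (- (\<epsilon> * d)))) + Q * (M ^ (T + 2 * d + 1) * \<delta>)"
    proof -
      have \<delta>1': "norm (wr (complex_of_real x)) \<le> \<delta>" for x using \<delta>1 by blast
      have nz: "0 < dist_Z (2 * \<theta> + of_int l * \<alpha>)" if "l \<in> S" for l
        using ypos'[of l] that Sr unfolding y_def by blast
      show ?thesis by (rule wronskian_lower_raw[OF M \<delta>1' \<delta>2 S_def rad(1) nz Q])
    qed
    moreover have "Q * (B\<^sup>2 * exp_sum \<epsilon> * (exp (- (rad\<^sup>2 * T)) + exp (- (\<epsilon> * d)))) \<le> 1/2"
    proof -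
      have B0: "B \<ge> 0" using w_dec by (rule exp_decaying_nonneg)
      have B2: "B\<^sup>2 \<le> exp (2 * b * l)"
      proof -
        have "B\<^sup>2 \<le> (L powr b)\<^sup>2" using BL B0 by (intro power_mono)
        also have "\<dots> = exp (2 * b * l)" by (simp add: Lexp powr_def power2_eq_square flip: exp_add)
        finally show ?thesis .
      qed
      have Qe: "Q = exp (2 * l + \<epsilon> * d / 2)" by (simp add: Q_def Lexp exp_add power2_eq_square flip: exp_add)
      have E1: "Q * exp (2 * b * l) * exp (- (rad\<^sup>2 * T)) \<le> exp (\<epsilon>/2 - l)"
      proof -
        have "rad\<^sup>2 * T \<ge> rad\<^sup>2 * (T1 * l)" using Tl by (intro mult_left_mono) auto
        moreover have "rad\<^sup>2 * (T1 * l) = (\<epsilon> * D1 / 2 + p) * l" using T1(2) by (simp add: mult.assoc[symmetric])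
        moreover have "\<epsilon> * d / 2 \<le> \<epsilon> * (D1 * l + 1) / 2" using dl pos
            by (intro divide_right_mono mult_left_mono) auto
        ultimately have "2 * l + \<epsilon> * d / 2 + 2 * b * l - rad\<^sup>2 * T
            \<le> 2 * l + \<epsilon> * (D1 * l + 1) / 2 + 2 * b * l - (\<epsilon> * D1 / 2 + p) * l"
          by linarith
        also have "\<dots> = \<epsilon>/2 - l" by (simp add: p_def field_simps)
        finally show ?thesis unfolding Qe mult_exp_exp by simp
      qed
      have E2: "Q * exp (2 * b * l) * exp (- (\<epsilon> * d)) \<le> exp (- l)"
      proof -
        have "p * l \<le> \<epsilon> * D1 / 2 * l" using D1(3) l1 by (intro mult_right_mono) auto
        also have "\<dots> = \<epsilon> * (D1 * l) / 2" by simp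
        also have "\<dots> \<le> \<epsilon> * d / 2" using dl pos by (intro divide_right_mono mult_left_mono) auto
        finally have "2 * l + \<epsilon> * d / 2 + 2 * b * l - \<epsilon> * d \<le> 2 * l + 2 * b * l - p * l" by simp
        also have "\<dots> = - l" by (simp add: p_def algebra_simps)
        finally show ?thesis unfolding Qe mult_exp_exp by simp
      qed
      have Q0: "Q \<ge> 0" by (simp add: Q_def)
      have ES: "exp_sum \<epsilon> \<ge> 0" using exp_sum_ge_1[OF \<epsilon>_pos] by simp
      have "Q * (B\<^sup>2 * exp_sum \<epsilon> * (exp (- (rad\<^sup>2 * T)) + exp (- (\<epsilon> * d)))) \<le>
         Q * (exp (2 * b * l) * exp_sum \<epsilon> * (exp (- (rad\<^sup>2 * T)) + exp (- (\<epsilon> * d))))"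
        using B2 Q0 ES by (intro mult_left_mono mult_right_mono) auto
      also have "\<dots> = exp_sum \<epsilon> * (Q * exp (2 * b * l) * exp (- (rad\<^sup>2 * T)) + Q * exp (2 * b * l)
          * exp (- (\<epsilon> * d)))"
        by (simp add: algebra_simps)
      also have "\<dots> \<le> exp_sum \<epsilon> * (exp (\<epsilon>/2 - l) + exp (- l))"
        using E1 E2 ES by (intro mult_left_mono add_mono)
      also have "\<dots> = exp_sum \<epsilon> * (exp (\<epsilon>/2) + 1) / L" unfolding Lexp exp_diff exp_minus
          by (simp add: field_simps)
      also have "\<dots> \<le> 1/2"
      proof -
        have "2 * (exp_sum \<epsilon> * (exp (\<epsilon>/2) + 1)) \<le> L" using LL0 by (simp add: L0_def)
        thus ?thesis using L1 by (simp add: field_simps)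
      qed
      finally show ?thesis .
    qed
    ultimately have half: "1/2 \<le> Q * (M ^ (T + 2 * d + 1) * \<delta>)" by linarith
    have QM: "Q * M ^ (T + 2 * d + 1) \<le> exp (c1 * l + c2)"
    proof -
      have Qe: "Q = exp (2 * l + \<epsilon> * d / 2)" by (simp add: Q_def Lexp exp_add power2_eq_square flip: exp_add)
      have Me: "M ^ (T + 2 * d + 1) = exp (real (T + 2 * d + 1) * ln M)"
        using pos unfolding exp_of_nat_mult by simp
      have "real (T + 2 * d + 1) * ln M \<le> ((T1 + 2 * D1) * l + 4) * ln M"
        using Tl dl lnM by (intro mult_right_mono) (auto simp: algebra_simps)
      moreover have "\<epsilon> * d / 2 \<le> \<epsilon> * (D1 * l + 1) / 2" using dl pos
          by (intro divide_right_mono mult_left_mono) auto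
      ultimately have "(2 * l + \<epsilon> * d / 2) + real (T + 2 * d + 1) * ln M \<le>
          (2 * l + \<epsilon> * (D1 * l + 1) / 2) + ((T1 + 2 * D1) * l + 4) * ln M" by linarith
      also have "\<dots> = c1 * l + c2" by (simp add: c1_def c2_def field_simps)
      finally show ?thesis unfolding Qe Me mult_exp_exp by simp
    qed
    have \<delta>0: "\<delta> \<ge> 0" using \<delta>1 norm_ge_zero order_trans by blast
    have "1/2 \<le> exp (c1 * l + c2) * \<delta>"
      using half mult_right_mono[OF QM \<delta>0] by (simp add: mult.assoc)
    moreover have "2 * exp (c1 * l + c2) \<le> exp (C * l)"
    proof -
      have "(2::real) \<le> exp 1" using exp_ge_add_one_self[of 1] by simp
      hence "2 * exp (c1 * l + c2) \<le> exp 1 * exp (c1 * l + c2)" by (intro mult_right_mono) auto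
      also have "\<dots> = exp (c1 * l + (c2 + 1) * 1)" by (simp flip: exp_add add: algebra_simps)
      also have "\<dots> \<le> exp (c1 * l + (c2 + 1) * l)" using l1 cpos unfolding exp_le_cancel_iff
          by (intro add_mono mult_left_mono) auto
      also have "c1 * l + (c2 + 1) * l = C * l" by (simp add: C_def algebra_simps)
      finally show ?thesis .
    qed
    ultimately have "1 \<le> exp (C * l) * \<delta>"
      using mult_right_mono[of "2 * exp (c1 * l + c2)" "exp (C * l)" \<delta>] \<delta>0 by linarith
    hence "exp (- (C * l)) \<le> \<delta>" by (simp add: exp_minus field_simps)
    thus ?thesis by (simp add: Lexp powr_def)
  qed
  show ?thesis by (rule that[OF cpos(3) L01 main])
qed

section \<open>Zeros on a strip and the degree of a loop\<close>

text \<open>After a is moved to 0 by a Moebius map, the Schwarz lemma bounds F by B times the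
  Moebius factor. The quotient therefore keeps the bound B, at a itself by continuity.\<close>

lemma blaschke_divide:
  assumes hol: "F holomorphic_on ball 0 1" and bd: "\<And>z. z \<in> ball 0 1 \<Longrightarrow> norm (F z) \<le> B"
    and a: "norm a < 1" "F a = 0"
  shows "\<exists>G. G holomorphic_on ball 0 1 \<and> (\<forall>z\<in>ball 0 1. norm (G z) \<le> B) \<and>
    (\<forall>z\<in>ball 0 1. F z = Moebius_function 0 a z * G z)"
proof -
  define Q where "Q = (\<lambda>z. if z = a then deriv F a else (F z - F a) / (z - a))"
  define G where "G = (\<lambda>z. Q z * (1 - cnj a * z))"
  have am: "norm (- a) < 1" using a by simp
  have Qhol: "Q holomorphic_on ball 0 1"
    unfolding Q_def by (rule pole_lemma_open[OF hol]) simp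
  hence Ghol: "G holomorphic_on ball 0 1"
    unfolding G_def by (intro holomorphic_intros)
  have den: "1 - cnj a * z \<noteq> 0" if "norm z < 1" for z
  proof
    assume "1 - cnj a * z = 0"
    hence "norm (cnj a * z) = 1" by (metis eq_iff_diff_eq_0 norm_one)
    moreover have "norm a * norm z < 1 * 1" using a that by (intro mult_strict_mono') auto
    ultimately show False by (simp add: norm_mult)
  qed
  have FG: "F z = Moebius_function 0 a z * G z" if "z \<in> ball 0 1" for z
    using den[of z] that a by (cases "z = a") (auto simp: Moebius_function_simple G_def Q_def)
  have schwarz: "norm (F z) \<le> B * norm (Moebius_function 0 a z)" if z: "norm z < 1" for z
  proof (rule field_le_epsilon)
    fix e :: real assume e: "e > 0"
    have B: "B \<ge> 0" by (rule order_trans[OF norm_ge_zero bd[of 0]]) simp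
    \<comment> \<open>The Schwarz lemma asks for a strict bound by 1, hence \<open>B + e\<close> in
      the denominator; this also covers B = 0.\<close>
    define f where "f = (\<lambda>w. F (Moebius_function 0 (- a) w) / of_real (B + e))"
    have nf: "norm (f w) = norm (F (Moebius_function 0 (- a) w)) / (B + e)" for w
      unfolding f_def norm_divide norm_of_real using B e by simp
    have f: "norm (f w) \<le> norm w" if "norm w < 1" for w
    proof (rule Schwarz_Lemma(1))
      show "f holomorphic_on ball 0 1"
        unfolding f_def
        by (intro holomorphic_intros holomorphic_on_compose_gen[OF Moebius_function_holomorphic[OF am] hol,
            unfolded o_def])
           (use Moebius_function_norm_lt_1[OF am] B e in auto)
      show "f 0 = 0" by (simp add: f_def Moebius_function_of_zero a)
      fix w :: complex assume "norm w < 1"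
      hence "norm (F (Moebius_function 0 (- a) w)) \<le> B"
        using Moebius_function_norm_lt_1[OF am] by (intro bd) simp
      thus "norm (f w) < 1" using e B by (simp add: nf)
    qed (rule that)
    have "norm (f (Moebius_function 0 a z)) \<le> norm (Moebius_function 0 a z)"
      by (rule f) (rule Moebius_function_norm_lt_1[OF a(1) z])
    moreover have "Moebius_function 0 (- a) (Moebius_function 0 a z) = z"
      by (rule Moebius_function_compose) (use a z in auto)
    ultimately have "norm (F z) \<le> (B + e) * norm (Moebius_function 0 a z)"
      using e B by (simp add: nf pos_divide_le_eq mult.commute)
    also have "\<dots> \<le> B * norm (Moebius_function 0 a z) + e * 1"
      using Moebius_function_norm_lt_1[OF a(1) z, of 0] e by (simp add: distrib_right)
    finally show "norm (F z) \<le> B * norm (Moebius_function 0 a z) + e" by simp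
  qed
  have G1: "norm (G z) \<le> B" if z: "norm z < 1" "z \<noteq> a" for z
  proof -
    have "Moebius_function 0 a z \<noteq> 0" using den[OF z(1)] z by (simp add: Moebius_function_simple)
    moreover have "norm (Moebius_function 0 a z) * norm (G z) \<le> B * norm (Moebius_function 0 a z)"
      using schwarz[OF z(1)] FG[of z] z by (simp add: norm_mult)
    ultimately show ?thesis by (simp add: mult.commute[of B])
  qed
  have "norm (G a) \<le> B"
  proof (rule tendsto_upperbound)
    have "isCont G a"
      by (rule continuous_on_interior[OF holomorphic_on_imp_continuous_on[OF Ghol]]) (use a in auto)
    thus "((\<lambda>z. norm (G z)) \<longlongrightarrow> norm (G a)) (at a)" by (intro tendsto_norm) (simp add: isCont_def)
    have "eventually (\<lambda>z. z \<in> ball 0 1) (at a)" by (rule eventually_at_in_open') (use a in auto)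
    moreover have "eventually (\<lambda>z. z \<noteq> a) (at a)" by (rule eventually_neq_at_within)
    ultimately show "\<forall>\<^sub>F z in at a. norm (G z) \<le> B" by eventually_elim (use G1 in auto)
  qed auto
  hence "norm (G z) \<le> B" if "z \<in> ball 0 1" for z using G1[of z] that by (cases "z = a") auto
  thus ?thesis using Ghol FG by (intro exI[of _ G]) simp
qed

text \<open>The Moebius factor of a zero a vanishes nowhere else in the disc, so the remaining zeros
  pass to the quotient. At the origin each zero contributes a factor of modulus at most q.\<close>

lemma blaschke_zeros:
  assumes "finite Z" "F holomorphic_on ball 0 1" "\<And>z. z \<in> ball 0 1 \<Longrightarrow> norm (F z) \<le> B"
    and "\<And>a. a \<in> Z \<Longrightarrow> norm a \<le> q \<and> F a = 0" "q < 1"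
  shows "norm (F 0) \<le> B * q ^ card Z"
  using assms
proof (induction Z arbitrary: F rule: finite_induct)
  case (insert a Z)
  have a: "norm a \<le> q" "F a = 0" "norm a < 1" using insert.prems(3)[of a] \<open>q < 1\<close> by auto
  obtain G where G: "G holomorphic_on ball 0 1" "\<And>z. z \<in> ball 0 1 \<Longrightarrow> norm (G z) \<le> B"
    "\<And>z. z \<in> ball 0 1 \<Longrightarrow> F z = Moebius_function 0 a z * G z"
  proof -
    have "\<exists>G. G holomorphic_on ball 0 1 \<and> (\<forall>z\<in>ball 0 1. norm (G z) \<le> B) \<and>
      (\<forall>z\<in>ball 0 1. F z = Moebius_function 0 a z * G z)"
      by (rule blaschke_divide[OF insert.prems(1) _ a(3,2)]) (rule insert.prems(2))
    thus ?thesis using that by blast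
  qed
  have "norm (G 0) \<le> B * q ^ card Z"
  proof (rule insert.IH[OF G(1,2)])
    fix b assume b: "b \<in> Z"
    hence nb: "norm b \<le> q" "F b = 0" "b \<noteq> a" using insert.prems(3)[of b] insert.hyps by auto
    hence "Moebius_function 0 a b * G b = 0" using G(3)[of b] \<open>q < 1\<close> by simp
    moreover have "Moebius_function 0 a b \<noteq> 0"
    proof
      assume "Moebius_function 0 a b = 0"
      hence "cnj a * b = 1" using nb by (auto simp: Moebius_function_simple)
      hence "norm a * norm b = 1" by (metis complex_mod_cnj norm_mult norm_one)
      moreover have "norm a * norm b < 1 * 1" using a nb \<open>q < 1\<close> by (intro mult_strict_mono') auto
      ultimately show False by simp
    qed
    ultimately show "norm b \<le> q \<and> G b = 0" using nb by simp
  qed (use \<open>q < 1\<close> in auto)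
  moreover have "norm (F 0) = norm a * norm (G 0)"
    using G(3)[of 0] by (simp add: norm_mult Moebius_function_of_zero)
  ultimately have "norm (F 0) \<le> q * (B * q ^ card Z)"
    using a by (auto intro!: mult_mono intro: order_trans[OF norm_ge_zero])
  thus ?case using insert.hyps by (simp add: mult_ac)
qed auto

text \<open>The map \<open>(2 \<delta> / pi) Ln ((1 + w) / (1 - w))\<close> takes the unit disc onto the strip of half width \<open>\<delta>\<close>,
  and real points at distance at most 1 from each other correspond to points in a fixed smaller disc.\<close>

lemma strip_zeros_bound:
  assumes "\<delta> > 0"
  shows "\<exists>C>0. \<forall>f B Z x1. f holomorphic_on strip \<delta> \<longrightarrow> (\<forall>z\<in>strip \<delta>. norm (f z) \<le> B) \<longrightarrow>
    finite Z \<longrightarrow> Z \<subseteq> {0..1} \<longrightarrow> (\<forall>x\<in>Z. f (of_real x) = 0) \<longrightarrow> x1 \<in> {0..1} \<longrightarrow>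
    norm (f (of_real x1)) \<ge> 1 \<longrightarrow> real (card Z) \<le> C * ln B"
proof -
  define E1 where "E1 = exp (pi / (2 * \<delta>))"
  \<comment> \<open>This is tanh(pi / (4 \<delta>)), the modulus of the image of a real point at
    distance 1 from the base point.\<close>
  define q where "q = (E1 - 1) / (E1 + 1)"
  have E1: "E1 > 1" using assms by (simp add: E1_def)
  have q: "0 < q" "q < 1" using E1 by (auto simp: q_def field_simps)
  define C where "C = 1 / (- ln q)"
  have C: "C > 0" using q by (simp add: C_def)
  have main: "real (card Z) \<le> C * ln B"
    if f: "f holomorphic_on strip \<delta>" "\<forall>z\<in>strip \<delta>. norm (f z) \<le> B"
      and Z: "finite Z" "Z \<subseteq> {0..1}" "\<forall>x\<in>Z. f (of_real x) = 0"
      and x1: "x1 \<in> {0..1}" "norm (f (of_real x1)) \<ge> 1" for f B Z x1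
  proof -
    define h where "h = (\<lambda>w. of_real x1 + of_real (2 * \<delta> / pi) * Ln ((1 + w) / (1 - w)))"
    have Re: "Re ((1 + w) / (1 - w)) > 0" if "norm w < 1" for w :: complex
    proof -
      have "Re ((1 + w) * cnj (1 - w)) = 1 - (norm w)\<^sup>2"
        unfolding cmod_power2 by (simp add: power2_eq_square algebra_simps)
      moreover have "(norm w)\<^sup>2 < 1" using that by (simp add: power_less_one_iff)
      ultimately show ?thesis using that by (subst Re_complex_div_gt_0) auto
    qed
    have hstrip: "h w \<in> strip \<delta>" if "norm w < 1" for w
    proof -
      have "\<bar>Im (Ln ((1 + w) / (1 - w)))\<bar> < pi / 2" by (rule Re_Ln_pos_lt_imp[OF Re[OF that]])
      hence "(2 * \<delta> / pi) * \<bar>Im (Ln ((1 + w) / (1 - w)))\<bar> < (2 * \<delta> / pi) * (pi / 2)"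
        using assms by (intro mult_strict_left_mono) auto
      thus ?thesis using assms by (simp add: strip_def h_def abs_mult)
    qed
    have hhol: "h holomorphic_on ball 0 1"
      unfolding h_def
    proof (intro holomorphic_intros)
      fix w :: complex assume w: "w \<in> ball 0 1"
      thus "1 - w \<noteq> 0" by auto
      have "Re ((1 + w) / (1 - w)) > 0" using w by (intro Re) auto
      thus "(1 + w) / (1 - w) \<notin> \<real>\<^sub>\<le>\<^sub>0" by (simp add: complex_nonpos_Reals_iff)
    qed
    define t where "t = (\<lambda>x::real. exp (pi * (x - x1) / (2 * \<delta>)))"
    \<comment> \<open>The inverse of \<open>h\<close> along the real axis. The base point x1, where
      f is large, goes to the centre of the disc.\<close>
    define \<omega> where "\<omega> = (\<lambda>x::real. complex_of_real ((t x - 1) / (t x + 1)))"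
    have t0: "t x > 0" for x by (simp add: t_def)
    have h\<omega>: "h (\<omega> x) = of_real x" for x
    proof -
      have tp: "t x + 1 \<noteq> 0" using t0[of x] by linarith
      have "(1 + \<omega> x) / (1 - \<omega> x) = of_real ((1 + (t x - 1) / (t x + 1)) / (1 - (t x - 1) / (t x + 1)))"
        by (simp add: \<omega>_def)
      also have "(1 + (t x - 1) / (t x + 1)) / (1 - (t x - 1) / (t x + 1)) = t x"
        using tp by (simp add: field_simps)
      finally have "h (\<omega> x) = of_real x1 + of_real (2 * \<delta> / pi) * of_real (ln (t x))"
        using t0[of x] by (simp add: h_def Ln_of_real)
      also have "ln (t x) = pi * (x - x1) / (2 * \<delta>)" by (simp add: t_def)
      also have "complex_of_real x1 + of_real (2 * \<delta> / pi) * of_real (pi * (x - x1) / (2 * \<delta>)) =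
          of_real (x1 + (2 * \<delta> / pi) * (pi * (x - x1) / (2 * \<delta>)))" by simp
      also have "x1 + (2 * \<delta> / pi) * (pi * (x - x1) / (2 * \<delta>)) = x" using assms by (simp add: field_simps)
      finally show ?thesis .
    qed
    have \<omega>q: "norm (\<omega> x) \<le> q" if "x \<in> Z" for x
    proof -
      have "x \<in> {0..1}" using that Z(2) by (rule rev_subsetD)
      hence d: "x - x1 \<le> 1" "- 1 \<le> x - x1" using x1(1) by auto
      have "pi * (x - x1) / (2 * \<delta>) \<le> pi * 1 / (2 * \<delta>)" "pi * (- 1) / (2 * \<delta>) \<le> pi * (x - x1) / (2 * \<delta>)"
        using assms d by (intro divide_right_mono mult_left_mono; simp)+
      hence le: "t x \<le> E1" "exp (- (pi / (2 * \<delta>))) \<le> t x" unfolding t_def E1_def exp_le_cancel_iff by simp_all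
      have "1 = exp (- (pi / (2 * \<delta>))) * E1" by (simp add: E1_def flip: exp_add)
      also have "\<dots> \<le> t x * E1" using le(2) E1 by (intro mult_right_mono) auto
      finally have ge: "1 \<le> t x * E1" .
      have "(t x - 1) * (E1 + 1) \<le> (E1 - 1) * (t x + 1)" "- (E1 - 1) * (t x + 1) \<le> (t x - 1) * (E1 + 1)"
        using le(1) ge by (simp_all add: algebra_simps)
      hence "(t x - 1) / (t x + 1) \<le> q" "- q \<le> (t x - 1) / (t x + 1)"
        using E1 t0[of x] unfolding q_def minus_divide_left by (simp_all add: divide_le_eq le_divide_eq)
      hence "\<bar>(t x - 1) / (t x + 1)\<bar> \<le> q" by linarith
      thus ?thesis unfolding \<omega>_def norm_of_real .
    qed
    have "norm (f (h 0)) \<le> B * q ^ card (\<omega> ` Z)"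
    proof (rule blaschke_zeros[where F = "\<lambda>w. f (h w)" and Z = "\<omega> ` Z" and q = q])
      show "(\<lambda>w. f (h w)) holomorphic_on ball 0 1"
        by (rule holomorphic_on_compose_gen[OF hhol f(1), unfolded o_def]) (use hstrip in auto)
      show "norm (f (h w)) \<le> B" if "w \<in> ball 0 1" for w using that by (intro f(2)[rule_format] hstrip) auto
      show "norm a \<le> q \<and> f (h a) = 0" if "a \<in> \<omega> ` Z" for a using that \<omega>q h\<omega> Z(3) by auto
    qed (use Z q in auto)
    moreover have "inj_on \<omega> Z" by (rule inj_on_inverseI[where g = "\<lambda>w. Re (h w)"]) (simp add: h\<omega>)
    hence "card (\<omega> ` Z) = card Z" by (rule card_image)
    moreover have "h 0 = of_real x1" by (simp add: h_def)
    ultimately have *: "1 \<le> B * q ^ card Z" using x1(2) by simp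
    have B0: "B > 0"
    proof (rule ccontr)
      assume "\<not> B > 0"
      hence "B * q ^ card Z \<le> 0" using q by (intro mult_nonpos_nonneg) auto
      thus False using * by linarith
    qed
    have "0 \<le> ln (B * q ^ card Z)" using * by simp
    also have "\<dots> = ln B + real (card Z) * ln q" using B0 q by (simp add: ln_mult ln_realpow)
    finally have "real (card Z) * (- ln q) \<le> ln B" by simp
    moreover have "- ln q > 0" using q by simp
    ultimately show ?thesis by (simp add: C_def field_simps)
  qed
  show ?thesis using C main by blast
qed

section \<open>Two by two matrices and winding numbers\<close>

definition mat2 :: "'a \<Rightarrow> 'a \<Rightarrow> 'a \<Rightarrow> 'a \<Rightarrow> 'a::zero^2^2" where
  "mat2 a b c d = vector [vector [a, b], vector [c, d]]"

lemma mat2_nth [simp]: "mat2 a b c d $ 1 $ 1 = a" "mat2 a b c d $ 1 $ 2 = b" "mat2 a b c d $ 2 $ 1 = c"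
    "mat2 a b c d $ 2 $ 2 = d"
  by (simp_all add: mat2_def)

lemma mat2_eq_iff:
  fixes A B :: "'a^2^2"
  shows "A = B \<longleftrightarrow> A $ 1 $ 1 = B $ 1 $ 1 \<and> A $ 1 $ 2 = B $ 1 $ 2 \<and> A $ 2 $ 1 = B $ 2 $ 1 \<and> A $ 2 $ 2 = B $ 2 $ 2"
  unfolding vec_eq_iff[of A B] forall_2 vec_eq_iff[of "A $ 1"] vec_eq_iff[of "A $ 2"] by blast

lemma mat2_mult: "mat2 a b c d ** mat2 a' b' c' d'
    = mat2 (a * a' + b * c') (a * b' + b * d') (c * a' + d * c') (c * b' + d * d' :: 'a::semiring_1)"
  by (simp add: mat2_eq_iff matrix_matrix_mult_def sum_2)

lemma mat2_1: "mat 1 = mat2 1 0 0 1"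
  by (simp add: mat2_eq_iff mat_def)

lemma det_mat2: "det (mat2 a b c d) = a * d - b * c"
  by (simp add: det_2)

lemma rot_mat2: "rot t = mat2 (cos (2 * pi * t)) (- sin (2 * pi * t)) (sin (2 * pi * t)) (cos (2 * pi * t))"
  by (simp add: rot_def mat2_def)

lemma continuous_on_mat2:
  fixes a :: "'a::topological_space \<Rightarrow> real"
  assumes "continuous_on S a" "continuous_on S b" "continuous_on S c" "continuous_on S d"
  shows "continuous_on S (\<lambda>x. mat2 (a x) (b x) (c x) (d x))"
proof -
  have "mat2 (a x) (b x) (c x) (d x) = (\<chi> i j. if i = 1 then (if j = 1 then a x else b x) else (if j
      = 1 then c x else d x))" for x
    by (simp add: mat2_eq_iff)
  moreover have "continuous_on S (\<lambda>x. \<chi> i j. if i = (1::2) then (if j = (1::2) then a x else b x) else (if j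
      = 1 then c x else d x))"
  proof (intro continuous_on_vec_lambda)
    fix i j :: 2
    show "continuous_on S (\<lambda>x. if i = 1 then (if j = 1 then a x else b x) else (if j = 1 then c x else d x))"
      using assms by (cases "i = 1"; cases "j = 1") auto
  qed
  ultimately show ?thesis by simp
qed

text \<open>The cosine vanishes where \<psi> lies in 1/4 + Z/2. For m >= 0, the first m such values
  from \<psi>(0) upwards, spaced by 1/2, do not exceed \<psi>(1) and are attained by the
  intermediate value theorem; a negative m is reduced to this by changing the sign of
  \<psi>.\<close>

lemma cos_zeros_of_winding:
  fixes \<psi> :: "real \<Rightarrow> real"
  assumes cont: "continuous_on {0..1} \<psi>" and m: "\<psi> 1 - \<psi> 0 = of_int m"
  obtains Z where "finite Z" "Z \<subseteq> {0..1}" "\<And>x. x \<in> Z \<Longrightarrow> cos (2 * pi * \<psi> x) = 0" "int (card Z) = \<bar>m\<bar>"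
proof -
  have pos: "\<exists>Z. finite Z \<and> Z \<subseteq> {0..1} \<and> (\<forall>x\<in>Z. cos (2 * pi * \<psi> x) = 0) \<and> card Z = n"
    if cont: "continuous_on {0..1} \<psi>" and n: "\<psi> 1 - \<psi> 0 = real n" for \<psi> :: "real \<Rightarrow> real" and n
  proof -
    define k0 where "k0 = \<lceil>2 * \<psi> 0 - 1/2\<rceil>"
    define v where "v = (\<lambda>i::nat. (real_of_int k0 + real i) / 2 + 1/4)"
    have k0: "2 * \<psi> 0 - 1/2 \<le> of_int k0" "of_int k0 < 2 * \<psi> 0 + 1/2" unfolding k0_def by linarith+
    have "\<exists>x\<in>{0..1}. \<psi> x = v i" if i: "i < n" for i
    proof -
      have "real i \<le> real n - 1" using i by linarith
      have vi: "v i = of_int k0 / 2 + real i / 2 + 1/4" by (simp add: v_def add_divide_distrib)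
      have "0 \<le> real i / 2" "0 \<le> real n / 2" by simp_all
      hence "\<psi> 0 \<le> v i" using k0 unfolding vi by linarith
      moreover have "v i \<le> \<psi> 1"
        using k0 n \<open>real i \<le> real n - 1\<close> \<open>0 \<le> real n / 2\<close> unfolding vi by linarith
      ultimately show ?thesis using IVT'[of \<psi> 0 "v i" 1] cont by auto
    qed
    then obtain x where x: "\<And>i. i < n \<Longrightarrow> x i \<in> {0..1} \<and> \<psi> (x i) = v i" by metis
    have inj: "inj_on x {..<n}"
    proof (rule inj_onI)
      fix i j assume "i \<in> {..<n}" "j \<in> {..<n}" "x i = x j"
      hence "v i = v j" using x by (metis lessThan_iff)
      thus "i = j" by (simp add: v_def)
    qed
    have "cos (2 * pi * v i) = 0" for i
    proof -
      have "2 * pi * v i = of_int (2 * (k0 + int i) + 1) * (pi / 2)" by (simp add: v_def field_simps)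
      thus ?thesis unfolding cos_zero_iff_int by (intro exI[of _ "2 * (k0 + int i) + 1"]) simp
    qed
    hence "\<forall>y\<in>x ` {..<n}. cos (2 * pi * \<psi> y) = 0" using x by auto
    thus ?thesis using x card_image[OF inj] by (intro exI[of _ "x ` {..<n}"]) auto
  qed
  show ?thesis
  proof (cases "m \<ge> 0")
    case True
    from pos[OF cont, of "nat m"] m True obtain Z
        where "finite Z" "Z \<subseteq> {0..1}" "\<forall>x\<in>Z. cos (2 * pi * \<psi> x) = 0" "card Z = nat m" by auto
    thus ?thesis using that[of Z] True by simp
  next
    case False
    have "continuous_on {0..1} (\<lambda>x. - \<psi> x)" by (intro continuous_intros cont)
    from pos[OF this, of "nat (- m)"] m False obtain Z
        where "finite Z" "Z \<subseteq> {0..1}" "\<forall>x\<in>Z. cos (2 * pi * \<psi> x) = 0" "card Z = nat (- m)" by auto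
    thus ?thesis using that[of Z] False by simp
  qed
qed

text \<open>The first column, read as a complex number, never vanishes and so has a continuous
  logarithm. This yields the Iwasawa factorisation into a rotation by \<psi> and an upper triangular
  matrix with positive diagonal. The triangular factor contracts to the identity while \<psi> is
  deformed to m x; and a vanishes where the cosine does.\<close>

lemma SL2_loop_degree:
  fixes a b c d :: "real \<Rightarrow> real"
  assumes cont: "continuous_on {0..1} a" "continuous_on {0..1} b" "continuous_on {0..1} c"
      "continuous_on {0..1} d"
    and det: "\<And>x. a x * d x - b x * c x = 1"
    and per: "a 1 = a 0" "b 1 = b 0" "c 1 = c 0" "d 1 = d 0"
  shows "\<exists>m Z. has_degree (\<lambda>x. mat2 (a x) (b x) (c x) (d x)) m \<and>
    finite Z \<and> Z \<subseteq> {0..1} \<and> (\<forall>x\<in>Z. a x = 0) \<and> int (card Z) = \<bar>m\<bar>"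
proof -
  define g where "g = (\<lambda>x. Complex (a x) (c x))"
  have contg: "continuous_on {0..1} g"
    unfolding g_def using cont by (intro continuous_on_Complex)
  have g0: "g x \<noteq> 0" for x using det[of x] by (auto simp: g_def complex_eq_iff)
  obtain h where h: "continuous_on {0..1} h" "\<And>x. x \<in> {0..1} \<Longrightarrow> g x = exp (h x)"
    using continuous_logarithm_on_contractible[OF contg convex_imp_contractible[OF convex_real_interval(5)]] g0
        by blast
  define \<psi> where "\<psi> = (\<lambda>x. Im (h x) / (2 * pi))"
  define r where "r = (\<lambda>x. exp (Re (h x)))"
  define s where "s = (\<lambda>x. cos (2 * pi * \<psi> x) * b x + sin (2 * pi * \<psi> x) * d x)"
  have cont\<psi>: "continuous_on {0..1} \<psi>" unfolding \<psi>_def by (intro continuous_intros h) auto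
  have conts: "continuous_on {0..1} s" unfolding s_def by (intro continuous_intros cont cont\<psi>)
  have r0: "r x > 0" for x by (simp add: r_def)
  have ac: "a x = r x * cos (2 * pi * \<psi> x)" "c x = r x * sin (2 * pi * \<psi> x)" if "x \<in> {0..1}" for x
    using h(2)[OF that] by (auto simp: g_def r_def \<psi>_def complex_eq_iff Re_exp Im_exp)
  have "exp (h 1) = exp (h 0)" using h(2)[of 0] h(2)[of 1] per by (simp add: g_def)
  then obtain m :: int where m: "h 1 = h 0 + of_int (2 * m) * of_real pi * \<i>" unfolding exp_eq by auto
  have \<psi>m: "\<psi> 1 - \<psi> 0 = of_int m" by (simp add: \<psi>_def m field_simps)
  have cs1: "cos (2 * pi * (t + of_int m)) = cos (2 * pi * t)" "sin (2 * pi * (t + of_int m))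
      = sin (2 * pi * t)" for t
  proof -
    have eq: "2 * pi * (t + of_int m) = 2 * pi * t + 2 * pi * of_int m" by (simp add: algebra_simps)
    show "cos (2 * pi * (t + of_int m)) = cos (2 * pi * t)" "sin (2 * pi * (t + of_int m)) = sin (2 * pi * t)"
      unfolding eq cos_add sin_add by simp_all
  qed
  have \<psi>1: "\<psi> 1 = \<psi> 0 + of_int m" using \<psi>m by simp
  have s1: "s 1 = s 0" unfolding s_def \<psi>1 cs1 per ..
  \<comment> \<open>\<psi> and x -> m x both gain m over a period, hence so does every convex
    combination, and all intermediate loops close.\<close>
  define \<Theta> where "\<Theta> = (\<lambda>p :: real \<times> real. (1 - fst p) * \<psi> (snd p) + fst p * (of_int m * snd p))"
  define R where "R = (\<lambda>p :: real \<times> real. exp ((1 - fst p) * Re (h (snd p))))"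
  define H where "H = (\<lambda>p. mat2 (cos (2 * pi * \<Theta> p) * R p)
     (cos (2 * pi * \<Theta> p) * ((1 - fst p) * s (snd p)) - sin (2 * pi * \<Theta> p) * (1 / R p))
     (sin (2 * pi * \<Theta> p) * R p)
     (sin (2 * pi * \<Theta> p) * ((1 - fst p) * s (snd p)) + cos (2 * pi * \<Theta> p) * (1 / R p)))"
  have snd: "continuous_on ({0..1} \<times> {0..1::real}) (\<lambda>p. f (snd p))" if "continuous_on {0..1} f"
      for f :: "real \<Rightarrow> 'b::topological_space"
    by (rule continuous_on_compose2[OF that]) (auto intro!: continuous_intros)
  have contH: "continuous_on ({0..1} \<times> {0..1}) H"
    unfolding H_def \<Theta>_def R_def
    by (intro continuous_on_mat2 continuous_intros snd cont\<psi> h conts) auto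
  have "has_degree (\<lambda>x. mat2 (a x) (b x) (c x) (d x)) m"
    unfolding has_degree_def homotopic_loops
  proof (intro exI[of _ H] conjI ballI contH)
    show "H \<in> {0..1} \<times> {0..1} \<rightarrow> SL2"
    proof
      fix p
      define co si where "co = cos (2 * pi * \<Theta> p)" and "si = sin (2 * pi * \<Theta> p)"
      have "co * co + si * si = 1" using sin_cos_squared_add2[of "2 * pi * \<Theta> p"]
          by (simp add: co_def si_def power2_eq_square)
      moreover have "R p * (1 / R p) = 1" by (simp add: R_def)
      moreover have "co * R p * (si * t + co * (1 / R p)) - (co * t - si * (1 / R p)) * (si * R p)
          = (co * co + si * si) * (R p * (1 / R p))" for t by (simp add: algebra_simps)
      ultimately show "H p \<in> SL2"
        unfolding SL2_def H_def co_def[symmetric] si_def[symmetric] mem_Collect_eq det_mat2 by simp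
    qed
    fix x :: real assume x: "x \<in> {0..1}"
    have R0: "R (0, x) = r x" by (simp add: R_def r_def)
    have T0: "\<Theta> (0, x) = \<psi> x" by (simp add: \<Theta>_def)
    define co si where "co = cos (2 * pi * \<psi> x)" and "si = sin (2 * pi * \<psi> x)"
    have cs: "co * co + si * si = 1" using sin_cos_squared_add2[of "2 * pi * \<psi> x"]
        by (simp add: co_def si_def power2_eq_square)
    have ax: "a x = r x * co" "c x = r x * si" using ac[OF x] by (simp_all add: co_def si_def)
    have dr: "1 / r x = co * d x - si * b x"
      using det[of x] r0[of x] unfolding ax by (simp add: field_simps)
    have e1: "co * s x - si * (1 / r x) = b x"
    proof -
      have "co * s x - si * (1 / r x) = (co * co + si * si) * b x"
          unfolding dr s_def co_def[symmetric] si_def[symmetric] by algebra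
      thus ?thesis by (simp add: cs)
    qed
    have e2: "si * s x + co * (1 / r x) = d x"
    proof -
      have "si * s x + co * (1 / r x) = (co * co + si * si) * d x"
          unfolding dr s_def co_def[symmetric] si_def[symmetric] by algebra
      thus ?thesis by (simp add: cs)
    qed
    show "H (0, x) = mat2 (a x) (b x) (c x) (d x)"
      unfolding H_def T0 R0 co_def[symmetric] si_def[symmetric] using e1 e2 by (simp add: ax mult.commute)
    show "H (1, x) = rot (of_int m * x)"
      by (simp add: H_def \<Theta>_def R_def rot_mat2)
  next
    fix t :: real assume "t \<in> {0..1}"
    have T1: "\<Theta> (t, 1) = \<Theta> (t, 0) + of_int m" by (simp add: \<Theta>_def \<psi>1 algebra_simps)
    have R1: "R (t, 1) = R (t, 0)" by (simp add: R_def m)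
    have "H (t, 1) = H (t, 0)" unfolding H_def T1 R1 cs1 by (simp add: s1)
    thus "pathfinish (H \<circ> Pair t) = pathstart (H \<circ> Pair t)" by (simp add: pathfinish_def pathstart_def)
  qed
  moreover obtain Z where Z: "finite Z" "Z \<subseteq> {0..1}" "\<And>x. x \<in> Z \<Longrightarrow> cos (2 * pi * \<psi> x) = 0" "int (card Z) = \<bar>m\<bar>"
    by (rule cos_zeros_of_winding[OF cont\<psi> \<psi>m]) (rule that)
  moreover have "\<forall>x\<in>Z. a x = 0" using ac(1) Z(2,3) by auto
  ultimately show ?thesis using Z by blast
qed

text \<open>On SL2 the inverse is the adjugate, a continuous map that sends the rotation by m x to
  the one by -m x. It is needed because \<open>W\<close> is the inverse of the matrix whose first
  column is counted.\<close>

lemma has_degree_adjugate: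
  assumes "has_degree (\<lambda>x. mat2 (a x) (b x) (c x) (d x)) m"
  shows "has_degree (\<lambda>x. mat2 (d x) (- b x) (- c x) (a x)) (- m)"
proof -
  define adj :: "real^2^2 \<Rightarrow> real^2^2"
      where "adj = (\<lambda>M. mat2 (M $ 2 $ 2) (- (M $ 1 $ 2)) (- (M $ 2 $ 1)) (M $ 1 $ 1))"
  have "homotopic_loops SL2 (adj \<circ> (\<lambda>x. mat2 (a x) (b x) (c x) (d x))) (adj \<circ> (\<lambda>x. rot (of_int m * x)))"
  proof (rule homotopic_loops_continuous_image[OF assms[unfolded has_degree_def]])
    show "continuous_on SL2 adj"
      unfolding adj_def by (intro continuous_on_mat2 continuous_intros)
    show "adj \<in> SL2 \<rightarrow> SL2"
      by (auto simp: SL2_def adj_def det_2 algebra_simps)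
  qed
  moreover have "adj \<circ> (\<lambda>x. mat2 (a x) (b x) (c x) (d x)) = (\<lambda>x. mat2 (d x) (- b x) (- c x) (a x))"
    by (simp add: adj_def fun_eq_iff)
  moreover have "adj \<circ> (\<lambda>x. rot (of_int m * x)) = (\<lambda>x. rot (of_int (- m) * x))"
    by (simp add: adj_def fun_eq_iff rot_mat2)
  ultimately show ?thesis by (simp add: has_degree_def)
qed

section \<open>Conjugation to a rotation\<close>

lemma matrix_inv_mat2:
  fixes a b c d :: real
  assumes "a * d - b * c = 1"
  shows "matrix_inv (mat2 a b c d) = mat2 d (- b) (- c) a"
proof -
  have 1: "mat2 a b c d ** mat2 d (- b) (- c) a = mat 1" "mat2 d (- b) (- c) a ** mat2 a b c d = mat 1"
    using assms by (simp_all add: mat2_mult mat2_1 mult.commute)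
  show ?thesis
    unfolding matrix_inv_def
  proof (rule some_equality)
    show "mat2 a b c d ** mat2 d (- b) (- c) a = mat 1 \<and> mat2 d (- b) (- c) a ** mat2 a b c d = mat 1"
      using 1 by blast
    fix M assume M: "mat2 a b c d ** M = mat 1 \<and> M ** mat2 a b c d = mat 1"
    have "M = (mat2 d (- b) (- c) a ** mat2 a b c d) ** M" by (simp add: 1)
    also have "\<dots> = mat2 d (- b) (- c) a" using M by (simp add: matrix_mul_assoc[symmetric])
    finally show "M = mat2 d (- b) (- c) a" .
  qed
qed

section \<open>Operator norms and strip norms of two by two matrix functions\<close>

lemma norm_vec2_le: "norm (x :: 'a::real_normed_vector^2) \<le> norm (x $ 1) + norm (x $ 2)"
proof -
  have "norm x \<le> (\<Sum>i\<in>UNIV. \<bar>norm (x $ i)\<bar>)" unfolding norm_vec_def by (rule L2_set_le_sum_abs)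
  thus ?thesis by (simp add: sum_2)
qed

lemma onorm_complex_2x2_le:
  fixes M :: "complex^2^2"
  assumes "\<And>i j. norm (M $ i $ j) \<le> K"
  shows "onorm ((*v) M) \<le> 4 * K"
proof (rule onorm_le)
  fix x :: "complex^2"
  have K: "K \<ge> 0" using assms[of 1 1] norm_ge_zero order_trans by blast
  have comp: "norm ((M *v x) $ i) \<le> 2 * (K * norm x)" for i
  proof -
    have "norm ((M *v x) $ i) \<le> norm (M $ i $ 1) * norm (x $ 1) + norm (M $ i $ 2) * norm (x $ 2)"
      unfolding matrix_vector_mult_def by (simp add: sum_2 norm_mult[symmetric] norm_triangle_ineq)
    also have "\<dots> \<le> K * norm x + K * norm x"
      using K by (intro add_mono mult_mono assms Finite_Cartesian_Product.norm_nth_le) auto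
    finally show ?thesis by simp
  qed
  show "norm (M *v x) \<le> 4 * K * norm x"
    using norm_vec2_le[of "M *v x"] comp[of 1] comp[of 2] by simp
qed

lemma connected_strip: "connected (strip s)"
proof -
  have "strip s = {z. Im z < s} \<inter> {z. Im z > - s}" by (auto simp: strip_def)
  hence "convex (strip s)" by (simp add: convex_Int convex_halfspace_Im_lt convex_halfspace_Im_gt)
  thus ?thesis by (rule convex_connected)
qed

text \<open>The extension picked by the choice operator agrees with \<open>F\<close> on the real
  axis, hence on the connected strip, so a bound for one extension suffices.\<close>

lemma strip_norm_le:
  assumes F: "strip_extension s f F" and s: "s > 0" and K: "\<And>z i j. z \<in> strip s \<Longrightarrow> norm (F z $ i $ j) \<le> K"
  shows "strip_norm s f \<le> 4 * K"
proof -
  define G where "G = (SOME F. strip_extension s f F)"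
  have G: "strip_extension s f G" unfolding G_def by (rule someI[where P = "strip_extension s f", OF F])
  have eq: "G z $ i $ j = F z $ i $ j" if "z \<in> strip s" for z i j
  proof (rule holomorphic_eq_on_reals[where F = "\<lambda>z. G z $ i $ j" and G = "\<lambda>z. F z $ i $
      j" and S = "strip s" and p = 0])
    show "(\<lambda>z. G z $ i $ j) holomorphic_on strip s" "(\<lambda>z. F z $ i $ j) holomorphic_on strip s"
      using F G by (auto simp: strip_extension_def)
    show "G (of_real x) $ i $ j = F (of_real x) $ i $ j" for x
      using F G by (simp add: strip_extension_def)
    show "of_real 0 \<in> strip s" using s by (simp add: strip_def)
  qed (rule open_strip connected_strip that)+
  have "onorm ((*v) (G z)) \<le> 4 * K" if "z \<in> strip s" for z
    by (rule onorm_complex_2x2_le) (use eq[OF that] K[OF that] in simp)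
  moreover have "0 \<in> strip s" using s by (simp add: strip_def)
  hence "strip s \<noteq> {}" by blast
  ultimately show ?thesis unfolding strip_norm_def G_def[symmetric] by (intro cSUP_least)
qed

lemma strip_extension_mat2:
  assumes hol: "a holomorphic_on strip s" "b holomorphic_on strip s" "c holomorphic_on strip s"
      "d holomorphic_on strip s"
    and bd: "\<And>z. z \<in> strip s \<Longrightarrow> norm (a z) \<le> K \<and> norm (b z) \<le> K \<and> norm (c z) \<le> K \<and> norm (d z) \<le> K"
    and re: "\<And>x. a (of_real x) = of_real (f x $ 1 $ 1)" "\<And>x. b (of_real x) = of_real (f x $ 1 $ 2)"
      "\<And>x. c (of_real x) = of_real (f x $ 2 $ 1)" "\<And>x. d (of_real x) = of_real (f x $ 2 $ 2)"
    and s: "s > 0"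
  shows "strip_extendable s f" "strip_norm s f \<le> 4 * K"
proof -
  define F where "F = (\<lambda>z. mat2 (a z) (b z) (c z) (d z))"
  have ij: "P i j" if "P 1 1" "P 1 2" "P 2 1" "P 2 2" for P and i j :: 2
    using that exhaust_2[of i] exhaust_2[of j] by auto
  have Fb: "norm (F z $ i $ j) \<le> K" if "z \<in> strip s" for z i j
    by (rule ij[of "\<lambda>i j. norm (F z $ i $ j) \<le> K"]) (use bd[OF that] in \<open>simp_all add: F_def\<close>)
  have F: "strip_extension s f F"
    unfolding strip_extension_def
  proof (intro conjI allI)
    show "(\<lambda>z. F z $ i $ j) holomorphic_on strip s" for i j
      by (rule ij[of "\<lambda>i j. (\<lambda>z. F z $ i $ j) holomorphic_on strip s"]) (use hol in \<open>simp_all add: F_def\<close>)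
    show "F (of_real x) $ i $ j = of_real (f x $ i $ j)" for x i j
      by (rule ij[of "\<lambda>i j. F (of_real x) $ i $ j = of_real (f x $ i $ j)"]) (use re in \<open>simp_all add: F_def\<close>)
    show "bounded (F ` strip s)"
      unfolding bounded_iff
    proof (intro exI[of _ "4 * K"] ballI)
      fix M assume "M \<in> F ` strip s"
      then obtain z where z: "z \<in> strip s" "M = F z" by blast
      have "norm M \<le> norm (M $ 1) + norm (M $ 2)" by (rule norm_vec2_le)
      also have "\<dots> \<le> (norm (M $ 1 $ 1) + norm (M $ 1 $ 2)) + (norm (M $ 2 $ 1) + norm (M $ 2 $ 2))"
        by (intro add_mono norm_vec2_le)
      also have "\<dots> \<le> (K + K) + (K + K)" unfolding z(2) by (intro add_mono Fb z(1))
      finally show "norm M \<le> 4 * K" by simp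
    qed
  qed
  thus "strip_extendable s f" unfolding strip_extendable_def by blast
  show "strip_norm s f \<le> 4 * K" by (rule strip_norm_le[OF F s Fb])
qed

text \<open>Since f is real, the Taylor coefficients at a real point may be replaced by their real
  parts.\<close>

lemma holomorphic_imp_real_analytic:
  assumes "F holomorphic_on strip s" "s > 0" "\<And>x. F (of_real x) = of_real (f x)"
  shows "real_analytic f"
  unfolding real_analytic_def
proof
  fix x
  have sub: "ball (of_real x) s \<subseteq> strip s"
  proof
    fix z :: complex assume "z \<in> ball (of_real x) s"
    hence "norm (z - of_real x) < s" by (simp add: dist_norm norm_minus_commute)
    thus "z \<in> strip s" using abs_Im_le_cmod[of "z - of_real x"] by (simp add: strip_def)
  qed
  define a where "a = (\<lambda>m. Re ((deriv ^^ m) F (of_real x) / fact m))"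
  have "(\<lambda>m. a m * (y - x) ^ m) sums f y" if "\<bar>y - x\<bar> < s" for y
  proof -
    have "of_real y \<in> ball (of_real x :: complex) s" using that by (simp add: dist_real_def abs_minus_commute)
    from holomorphic_power_series[OF holomorphic_on_subset[OF assms(1) sub] this]
    have "(\<lambda>m. Re ((deriv ^^ m) F (of_real x) / fact m * (of_real y - of_real x) ^ m)) sums Re (F (of_real y))"
      by (rule sums_Re)
    moreover have "Re ((deriv ^^ m) F (of_real x) / fact m * (of_real y - of_real x) ^ m) = a m * (y - x) ^ m"
        for m
    proof -
      have "(of_real y - of_real x :: complex) ^ m = of_real ((y - x) ^ m)" by simp
      thus ?thesis unfolding a_def by (simp only: times_complex.sel Re_complex_of_real Im_complex_of_real)
    qed
    ultimately show ?thesis by (simp add: assms(3))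
  qed
  thus "\<exists>r>0. \<exists>a. \<forall>y. \<bar>y - x\<bar> < r \<longrightarrow> (\<lambda>m. a m * (y - x) ^ m) sums f y" using assms(2) by blast
qed

lemma Re_csqrt_ge:
  assumes "Re z \<ge> 0"
  shows "Re (csqrt z) \<ge> sqrt (Re z)"
  using complex_Re_le_cmod[of z] assms by (simp add: real_sqrt_le_mono)

section \<open>The real frame carried by the Bloch wave\<close>

context dual_quasi
begin

text \<open>X and Y are the real and imaginary parts of U on the real axis, written through
  \<open>us\<close> so that they remain holomorphic: X1 + \<i> Y1 is \<open>u\<close>, and X2 + \<i>
  Y2 is \<open>ee(-\<theta>) u(. - \<alpha>)\<close>.\<close>

definition X1 where "X1 z = (u z + us z) / 2"
definition Y1 where "Y1 z = (u z - us z) / (2 * \<i>)"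
definition X2 where "X2 z = (ee (- of_real \<theta>) * u (z - of_real \<alpha>) + ee (of_real \<theta>) * us (z - of_real \<alpha>)) / 2"
definition Y2 where "Y2 z
    = (ee (- of_real \<theta>) * u (z - of_real \<alpha>) - ee (of_real \<theta>) * us (z - of_real \<alpha>)) / (2 * \<i>)"
definition D where "D z = X1 z * Y2 z - X2 z * Y1 z"
definition \<rho>X where "\<rho>X z = (\<rho> z + \<rho>s z) / 2"
definition \<rho>Y where "\<rho>Y z = (\<rho> z - \<rho>s z) / (2 * \<i>)"

abbreviation co :: complex where "co \<equiv> of_real (cos (2 * pi * \<theta>))"
abbreviation si :: complex where "si \<equiv> of_real (sin (2 * pi * \<theta>))"

lemma D_wr: "D z = \<i> / 2 * wr z"
  unfolding D_def X1_def Y1_def X2_def Y2_def wr_def by (simp add: field_simps)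

lemma ee_\<theta>: "ee (of_real \<theta>) = co + \<i> * si" "ee (- of_real \<theta>) = co - \<i> * si"
  using ee_of_real[of \<theta>] ee_of_real[of "- \<theta>"] by (simp_all add: complex_eq_iff)

text \<open>The first two equations split the one for \<open>u\<close> into its parts, which turns
  the Bloch factor into a rotation. The last two are exact, because the second component of U at z +
  \<alpha> is by construction the first at z times a phase.\<close>

lemma A_action:
  fixes z :: complex
  assumes z: "8 * pi * \<bar>Im z\<bar> \<le> \<epsilon>"
  shows "(of_real E - fser V z) * X1 z - X2 z = co * X1 (z + of_real \<alpha>) - si * Y1 (z + of_real \<alpha>) - \<rho>X z"
    "(of_real E - fser V z) * Y1 z - Y2 z = co * Y1 (z + of_real \<alpha>) + si * X1 (z + of_real \<alpha>) - \<rho>Y z"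
    "X1 z = co * X2 (z + of_real \<alpha>) - si * Y2 (z + of_real \<alpha>)"
    "Y1 z = co * Y2 (z + of_real \<alpha>) + si * X2 (z + of_real \<alpha>)"
proof -
  define a b where "a = u (z + of_real \<alpha>)" and "b = us (z + of_real \<alpha>)"
  define p m where "p = ee (- of_real \<theta>) * u (z - of_real \<alpha>)" and "m = ee (of_real \<theta>) * us (z - of_real \<alpha>)"
  have 1: "(of_real E - fser V z) * u z - p = (co + \<i> * si) * a - \<rho> z"
    using u_eq[OF z] unfolding a_def p_def ee_\<theta>(1)[symmetric] by (simp add: algebra_simps)
  have 2: "(of_real E - fser V z) * us z - m = (co - \<i> * si) * b - \<rho>s z"
    using us_eq[OF z] unfolding b_def m_def ee_\<theta>(2)[symmetric] by (simp add: algebra_simps)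
  have "(of_real E - fser V z) * X1 z - X2 z
      = (((of_real E - fser V z) * u z - p) + ((of_real E - fser V z) * us z - m)) / 2"
    by (simp add: X1_def X2_def p_def m_def field_simps)
  also have "\<dots> = co * X1 (z + of_real \<alpha>) - si * Y1 (z + of_real \<alpha>) - \<rho>X z"
    unfolding 1 2 X1_def Y1_def \<rho>X_def a_def[symmetric] b_def[symmetric] by (simp add: field_simps)
  finally show "(of_real E - fser V z) * X1 z - X2 z = co * X1 (z + of_real \<alpha>) - si * Y1 (z + of_real \<alpha>) - \<rho>X z"
      .
  have "(of_real E - fser V z) * Y1 z - Y2 z
      = (((of_real E - fser V z) * u z - p) - ((of_real E - fser V z) * us z - m)) / (2 * \<i>)"
    by (simp add: Y1_def Y2_def p_def m_def field_simps)
  also have "\<dots> = co * Y1 (z + of_real \<alpha>) + si * X1 (z + of_real \<alpha>) - \<rho>Y z"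
    unfolding 1 2 X1_def Y1_def \<rho>Y_def a_def[symmetric] b_def[symmetric] by (simp add: field_simps)
  finally show "(of_real E - fser V z) * Y1 z - Y2 z = co * Y1 (z + of_real \<alpha>) + si * X1 (z + of_real \<alpha>) - \<rho>Y z"
      .
  have cs: "co * co + si * si = 1"
    using sin_cos_squared_add2[of "2 * pi * \<theta>"] by (simp flip: of_real_mult of_real_add add: power2_eq_square)
  have X2': "X2 (z + of_real \<alpha>) = ((co - \<i> * si) * u z + (co + \<i> * si) * us z) / 2"
    "Y2 (z + of_real \<alpha>) = ((co - \<i> * si) * u z - (co + \<i> * si) * us z) / (2 * \<i>)"
    by (simp_all add: X2_def Y2_def ee_\<theta>)
  have "co * X2 (z + of_real \<alpha>) - si * Y2 (z + of_real \<alpha>) = (co * co + si * si) * X1 z"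
    unfolding X2' X1_def by (simp add: field_simps)
  thus "X1 z = co * X2 (z + of_real \<alpha>) - si * Y2 (z + of_real \<alpha>)" by (simp only: cs mult_1)
  have "co * Y2 (z + of_real \<alpha>) + si * X2 (z + of_real \<alpha>) = (co * co + si * si) * Y1 z"
    unfolding X2' Y1_def by (simp add: field_simps)
  thus "Y1 z = co * Y2 (z + of_real \<alpha>) + si * X2 (z + of_real \<alpha>)" by (simp only: cs mult_1)
qed

lemma real_parts:
  "X1 (of_real x) \<in> \<real>" "Y1 (of_real x) \<in> \<real>" "X2 (of_real x) \<in> \<real>" "Y2 (of_real x) \<in> \<real>"
proof -
  have c: "us (of_real y) = cnj (u (of_real y))" for y by (simp add: us_cnj)
  have e: "ee (of_real \<theta>) = cnj (ee (- of_real \<theta>))" by (simp add: cnj_ee)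
  have eq: "of_real x - of_real \<alpha> = (of_real (x - \<alpha>) :: complex)" by simp
  have 2: "(a + cnj a) / 2 \<in> \<real>" "(a - cnj a) / (2 * \<i>) \<in> \<real>" for a
    by (auto simp: complex_is_Real_iff)
  show "X1 (of_real x) \<in> \<real>" "Y1 (of_real x) \<in> \<real>" unfolding X1_def Y1_def c by (rule 2)+
  show "X2 (of_real x) \<in> \<real>" "Y2 (of_real x) \<in> \<real>"
    unfolding X2_def Y2_def eq c e complex_cnj_mult[symmetric] by (rule 2)+
qed

lemma D_real: "D (of_real x) \<in> \<real>"
  unfolding D_def using real_parts by (intro Reals_diff Reals_mult)

lemma plus_1:
  fixes z :: complex
  shows "u (z + 1) = u z" "us (z + 1) = us z" "X1 (z + 1) = X1 z" "Y1 (z + 1) = Y1 z" "X2 (z + 1) = X2 z"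
      "Y2 (z + 1) = Y2 z" "D (z + 1) = D z"
proof -
  show 1: "u (z + 1) = u z" "us (z + 1) = us z" for z by (simp_all add: u_def us_def fser_plus_1)
  have 2: "z + 1 - of_real \<alpha> = (z - of_real \<alpha>) + 1" by simp
  show "X1 (z + 1) = X1 z" "Y1 (z + 1) = Y1 z" "X2 (z + 1) = X2 z" "Y2 (z + 1) = Y2 z"
    by (simp_all only: X1_def Y1_def X2_def Y2_def 1 2)
  thus "D (z + 1) = D z" by (simp add: D_def)
qed

lemma parts_holomorphic:
  assumes "4 * pi * s \<le> \<epsilon>"
  shows "X1 holomorphic_on strip s" "Y1 holomorphic_on strip s" "X2 holomorphic_on strip s"
      "Y2 holomorphic_on strip s"
    "D holomorphic_on strip s" "fser V holomorphic_on strip s"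
proof -
  have u: "u holomorphic_on strip s" "us holomorphic_on strip s"
    unfolding u_def us_def
        by (rule fser_holomorphic[OF w_dec \<epsilon>_pos assms] fser_holomorphic[OF ws_dec \<epsilon>_pos assms])+
  have sh: "(\<lambda>z. f (z - of_real \<alpha>)) holomorphic_on strip s" if "f holomorphic_on strip s" for f
    by (rule holomorphic_on_compose_gen[OF _ that, unfolded o_def])
        (auto intro!: holomorphic_intros simp: strip_def)
  show X: "X1 holomorphic_on strip s" "Y1 holomorphic_on strip s" "X2 holomorphic_on strip s"
      "Y2 holomorphic_on strip s"
    unfolding X1_def[abs_def] Y1_def[abs_def] X2_def[abs_def] Y2_def[abs_def]
    by (intro holomorphic_intros u sh; simp)+
  show "D holomorphic_on strip s" unfolding D_def[abs_def] by (intro holomorphic_intros X)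
  show "fser V holomorphic_on strip s" by (rule fser_holomorphic[OF V_dec \<epsilon>_pos assms])
qed

lemma parts_bound:
  assumes z: "4 * pi * \<bar>Im z\<bar> \<le> \<epsilon>"
  shows "norm (X1 z) \<le> B * exp_sum (\<epsilon>/2)" "norm (Y1 z) \<le> B * exp_sum (\<epsilon>/2)"
    "norm (X2 z) \<le> B * exp_sum (\<epsilon>/2)" "norm (Y2 z) \<le> B * exp_sum (\<epsilon>/2)"
    "norm (\<rho>X z) \<le> \<eta> * exp_sum (\<epsilon>/2)" "norm (\<rho>Y z) \<le> \<eta> * exp_sum (\<epsilon>/2)"
proof -
  have half: "norm ((a + b) / 2) \<le> K" "norm ((a - b) / (2 * \<i>)) \<le> K" if "norm a \<le> K" "norm b \<le> K"
      for a b :: complex and K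
    using norm_triangle_ineq[of a b] norm_triangle_ineq4[of a b] that by (simp_all add: norm_divide norm_mult)
  have z': "4 * pi * \<bar>Im (z - of_real \<alpha>)\<bar> \<le> \<epsilon>" using z by simp
  show "norm (X1 z) \<le> B * exp_sum (\<epsilon>/2)" "norm (Y1 z) \<le> B * exp_sum (\<epsilon>/2)"
    unfolding X1_def Y1_def by (rule half[OF u_bound(1,2)[OF z]])+
  show "norm (\<rho>X z) \<le> \<eta> * exp_sum (\<epsilon>/2)" "norm (\<rho>Y z) \<le> \<eta> * exp_sum (\<epsilon>/2)"
    unfolding \<rho>X_def \<rho>Y_def by (rule half[OF u_bound(3,4)[OF z]])+
  have e: "norm (ee (of_real \<theta>)) = 1" "norm (ee (- of_real \<theta>)) = 1" by simp_all
  show "norm (X2 z) \<le> B * exp_sum (\<epsilon>/2)" "norm (Y2 z) \<le> B * exp_sum (\<epsilon>/2)"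
    unfolding X2_def Y2_def by (rule half; simp only: norm_mult e mult_1 u_bound(1,2)[OF z'])+
qed

text \<open>The mean of the real part of \<open>u\<close> over a period is the real part of
  \<open>w 0\<close>, that is 1. This supplies the base point for counting the zeros of
  \<open>X1\<close>.\<close>

lemma X1_large: "\<exists>x\<in>{0..1}. norm (X1 (of_real x)) \<ge> 1"
proof (rule ccontr)
  assume neg: "\<not> ?thesis"
  have cont: "continuous_on {0..1} (\<lambda>x. Re (u (of_real x)))"
    unfolding u_def by (intro continuous_intros fser_continuous_on_reals[OF w_dec \<epsilon>_pos])
  have X1re: "X1 (of_real x) = of_real (Re (u (of_real x)))" for x
    by (simp add: X1_def us_cnj complex_eq_iff)
  obtain x0 where x0: "x0 \<in> {0..1}" "\<forall>x\<in>{0..1}. Re (u (of_real x)) \<le> Re (u (of_real x0))"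
    using continuous_attains_sup[OF compact_Icc _ cont] by auto
  have "((\<lambda>x. u (of_real x)) has_integral w 0) {0..1}"
    unfolding u_def by (rule fser_mean[OF w_dec \<epsilon>_pos])
  hence "((\<lambda>x. Re (u (of_real x))) has_integral Re (w 0)) {0..1}"
    by (rule has_integral_linear[OF _ bounded_linear_Re, unfolded o_def])
  moreover have "((\<lambda>x. Re (u (of_real x0))) has_integral Re (u (of_real x0))) {0..1::real}"
    using has_integral_const_real[of "Re (u (of_real x0))" 0 1] by simp
  ultimately have "Re (w 0) \<le> Re (u (of_real x0))"
    by (rule has_integral_le) (use x0 in auto)
  moreover have "norm (X1 (of_real x0)) < 1" using neg x0(1) by force
  ultimately show False by (simp add: w_0 X1re)
qed

text \<open>\<open>W\<close> is the inverse of the matrix with columns \<open>(X1, X2)\<close> and \<open>sg (Y1, Y2)\<close>, normalised by the square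
  root of its determinant, which is nearly constant.\<close>

lemma conjugation:
  assumes s: "s > 0" "16 * pi * s \<le> \<epsilon>" and \<beta>: "\<beta> = norm (D 0)" "\<beta> > 0"
    and near: "\<And>z. z \<in> strip s \<Longrightarrow> norm (D z - D 0) \<le> \<beta> / 2"
    and v: "\<And>x. fser V (of_real x) = of_real (lam * v x)"
  obtains W sg Z where "analytic_SL2_loop W" "strip_extendable s W" "sg \<in> {-1, 1}"
    "strip_norm s W \<le> 4 * (B * exp_sum (\<epsilon>/2) / sqrt (\<beta>/2))"
    "strip_extendable s (\<lambda>x. W (x + \<alpha>) ** schroedinger_cocycle v lam E x ** matrix_inv (W x) - rot (sg * \<theta>))"
    "strip_norm s (\<lambda>x. W (x + \<alpha>) ** schroedinger_cocycle v lam E x ** matrix_inv (W x) - rot (sg * \<theta>))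
       \<le> 4 * (3 * (\<eta> * exp_sum (\<epsilon>/2)) * (B * exp_sum (\<epsilon>/2)) / \<beta>)"
    "finite Z" "Z \<subseteq> {0..1}" "\<And>x. x \<in> Z \<Longrightarrow> X1 (of_real x) = 0" "\<exists>m. has_degree W m \<and> \<bar>m\<bar> = int (card Z)"
proof -
  define Bu where "Bu = B * exp_sum (\<epsilon>/2)"
  define Ru where "Ru = \<eta> * exp_sum (\<epsilon>/2)"
  have s4: "4 * pi * s \<le> \<epsilon>" "8 * pi * s \<le> \<epsilon>"
    using s \<epsilon>_pos by (auto intro: order_trans[rotated])
  have zin: "4 * pi * \<bar>Im z\<bar> \<le> \<epsilon>" "8 * pi * \<bar>Im z\<bar> \<le> \<epsilon>" if "z \<in> strip s" for z
  proof -
    have "pi * \<bar>Im z\<bar> \<le> pi * s" using that by (intro mult_left_mono) (auto simp: strip_def)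
    thus "4 * pi * \<bar>Im z\<bar> \<le> \<epsilon>" "8 * pi * \<bar>Im z\<bar> \<le> \<epsilon>" using s4 by linarith+
  qed
  have zsh: "z + of_real \<alpha> \<in> strip s" if "z \<in> strip s" for z using that by (simp add: strip_def)
  have nn: "Bu \<ge> 0" "Ru \<ge> 0"
    using w_dec r_dec exp_decaying_nonneg exp_sum_ge_1[of "\<epsilon>/2"] \<epsilon>_pos by (auto simp: Bu_def Ru_def)
  note pb = parts_bound[folded Bu_def Ru_def]
  define d0 where "d0 = Re (D 0)"
  have "D 0 \<in> \<real>" using D_real[of 0] by simp
  hence D0: "D 0 = of_real d0" by (simp add: d0_def)
  have "\<bar>d0\<bar> = \<beta>" unfolding \<beta>(1) D0 by simp
  note d0 = D0 this
  \<comment> \<open>Membership in SL2 requires determinant +1, so the second column is multiplied by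
    the sign of \<open>D 0\<close>. The two signs in the conclusion come from here.\<close>
  define g where "g = sgn d0"
  have g: "g \<in> {-1, 1}" "g * g = 1" "g * d0 = \<beta>" using d0 \<beta>(2) by (auto simp: g_def sgn_if)
  define G where "G = complex_of_real g"
  have GG: "G * G = 1" using g(2) by (simp add: G_def flip: of_real_mult)
  have Gn: "norm G = 1" using g(1) by (auto simp: G_def)
  \<comment> \<open>\<open>G * D z\<close> stays in the half plane of real part at least \<beta>/2,
    so the principal root is holomorphic and nonzero there, and real on the real axis.\<close>
  define q where "q = (\<lambda>z. csqrt (G * D z))"
  have ReD: "Re (G * D z) \<ge> \<beta> / 2" if "z \<in> strip s" for z
  proof -
    have "norm (G * D z - of_real \<beta>) = norm (D z - D 0)"
    proof -
      have "G * of_real d0 = of_real \<beta>" by (simp add: G_def g(3) flip: of_real_mult)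
      hence "G * D z - of_real \<beta> = G * (D z - D 0)" unfolding d0(1) by (simp only: right_diff_distrib)
      thus ?thesis by (simp add: norm_mult Gn)
    qed
    also have "\<dots> \<le> \<beta> / 2" by (rule near[OF that])
    finally have "\<bar>Re (G * D z - of_real \<beta>)\<bar> \<le> \<beta> / 2" using abs_Re_le_cmod order_trans by blast
    hence "\<bar>Re (G * D z) - \<beta>\<bar> \<le> \<beta> / 2" by (simp only: minus_complex.sel Re_complex_of_real)
    thus ?thesis by linarith
  qed
  have qq: "q z * q z = G * D z" for z using power2_csqrt[of "G * D z"] by (simp add: q_def power2_eq_square)
  have Req: "Re (q z) \<ge> sqrt (\<beta>/2)" if "z \<in> strip s" for z
  proof -
    have "sqrt (\<beta>/2) \<le> sqrt (Re (G * D z))" using ReD[OF that] by (rule real_sqrt_le_mono)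
    also have "\<dots> \<le> Re (q z)" unfolding q_def by (rule Re_csqrt_ge) (use ReD[OF that] \<beta>(2) in linarith)
    finally show ?thesis .
  qed
  have sb: "sqrt (\<beta>/2) > 0" "sqrt (\<beta>/2) * sqrt (\<beta>/2) = \<beta>/2" using \<beta>(2) by auto
  have qn: "norm (q z) \<ge> sqrt (\<beta>/2)" "q z \<noteq> 0" if "z \<in> strip s" for z
  proof -
    show *: "norm (q z) \<ge> sqrt (\<beta>/2)" using Req[OF that] complex_Re_le_cmod order_trans by blast
    show "q z \<noteq> 0" using * sb by auto
  qed
  note hol = parts_holomorphic[OF s4(1)]
  have qhol: "q holomorphic_on strip s"
    unfolding q_def
  proof (intro holomorphic_intros hol)
    fix z assume "z \<in> strip s"
    from ReD[OF this] show "G * D z \<notin> \<real>\<^sub>\<le>\<^sub>0" using \<beta>(2) unfolding complex_nonpos_Reals_iff by linarith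
  qed
  have real_in: "complex_of_real x \<in> strip s" for x using s by (simp add: strip_def)
  have Greal: "G \<in> \<real>" by (simp add: G_def)
  have qreal: "q (of_real x) \<in> \<real>" for x
  proof -
    obtain t where t: "G * D (of_real x) = of_real t" using Reals_mult[OF Greal D_real]
        by (auto elim: Reals_cases)
    hence "t \<ge> 0" using ReD[OF real_in[of x]] \<beta>(2) by simp
    thus ?thesis by (simp add: q_def t csqrt_of_real)
  qed
  define a where "a = (\<lambda>z. X1 z / q z)"
  define b where "b = (\<lambda>z. G * Y1 z / q z)"
  define c where "c = (\<lambda>z. X2 z / q z)"
  define d where "d = (\<lambda>z. G * Y2 z / q z)"
  have abcd_hol: "a holomorphic_on strip s" "b holomorphic_on strip s" "c holomorphic_on strip s"
      "d holomorphic_on strip s"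
    unfolding a_def b_def c_def d_def by (intro holomorphic_intros hol qhol; use qn in simp)+
  have abcd_real: "a (of_real x) \<in> \<real>" "b (of_real x) \<in> \<real>" "c (of_real x) \<in> \<real>" "d (of_real x) \<in> \<real>" for x
    unfolding a_def b_def c_def d_def by (intro Reals_divide Reals_mult Greal qreal real_parts)+
  have abcd_det: "a z * d z - b z * c z = 1" if "z \<in> strip s" for z
  proof -
    have "a z * d z - b z * c z = G * D z / (q z * q z)"
      unfolding a_def b_def c_def d_def D_def times_divide_times_eq diff_divide_distrib[symmetric]
      by (simp add: algebra_simps)
    moreover have "G * D z \<noteq> 0" using ReD[OF that] \<beta>(2) by auto
    ultimately show ?thesis by (simp add: qq)
  qed
  have abcd_bd: "norm (a z) \<le> Bu / sqrt (\<beta>/2)" "norm (b z) \<le> Bu / sqrt (\<beta>/2)"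
    "norm (c z) \<le> Bu / sqrt (\<beta>/2)" "norm (d z) \<le> Bu / sqrt (\<beta>/2)" if z: "z \<in> strip s" for z
    unfolding a_def b_def c_def d_def norm_divide norm_mult Gn mult_1
    by (intro frac_le pb zin z nn qn sb)+
  have per: "a (z + 1) = a z" "b (z + 1) = b z" "c (z + 1) = c z" "d (z + 1) = d z" for z
    by (simp_all add: a_def b_def c_def d_def q_def plus_1)
  define ar where "ar = (\<lambda>x. Re (a (of_real x)))"
  define br where "br = (\<lambda>x. Re (b (of_real x)))"
  define cr where "cr = (\<lambda>x. Re (c (of_real x)))"
  define dr where "dr = (\<lambda>x. Re (d (of_real x)))"
  have cr: "a (of_real x) = of_real (ar x)" "b (of_real x) = of_real (br x)" "c (of_real x) = of_real (cr x)"
      "d (of_real x) = of_real (dr x)" for x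
    using abcd_real[of x] by (simp_all add: ar_def br_def cr_def dr_def)
  have det: "ar x * dr x - br x * cr x = 1" for x
  proof -
    have "complex_of_real (ar x * dr x - br x * cr x) = of_real 1"
      using abcd_det[OF real_in[of x]] by (simp add: cr)
    thus ?thesis by (simp only: of_real_eq_iff)
  qed
  have perr: "ar (x + 1) = ar x" "br (x + 1) = br x" "cr (x + 1) = cr x" "dr (x + 1) = dr x" for x
    using per[of "of_real x"] by (simp_all add: ar_def br_def cr_def dr_def)
  define W where "W = (\<lambda>x. mat2 (dr x) (- br x) (- cr x) (ar x))"
  have ra: "real_analytic ar" "real_analytic br" "real_analytic cr" "real_analytic dr"
    by (rule holomorphic_imp_real_analytic[OF abcd_hol(1) s(1)] holomorphic_imp_real_analytic[OF abcd_hol(2)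
        s(1)]
        holomorphic_imp_real_analytic[OF abcd_hol(3) s(1)] holomorphic_imp_real_analytic[OF abcd_hol(4) s(1)],
            rule cr)+
  have nra: "real_analytic (\<lambda>x. - br x)" "real_analytic (\<lambda>x. - cr x)"
  proof -
    have nb: "(\<lambda>z. - b z) holomorphic_on strip s" and nc: "(\<lambda>z. - c z) holomorphic_on strip s"
      by (intro holomorphic_intros abcd_hol)+
    show "real_analytic (\<lambda>x. - br x)" by (rule holomorphic_imp_real_analytic[OF nb s(1)]) (simp add: cr)
    show "real_analytic (\<lambda>x. - cr x)" by (rule holomorphic_imp_real_analytic[OF nc s(1)]) (simp add: cr)
  qed
  have loop: "analytic_SL2_loop W"
    unfolding analytic_SL2_loop_def
  proof (intro conjI allI)
    show "periodic1 W" by (simp add: periodic1_def W_def perr)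
    show "range W \<subseteq> SL2"
    proof
      fix M assume "M \<in> range W"
      then obtain x where "M = W x" by blast
      thus "M \<in> SL2" using det[of x] by (simp add: SL2_def W_def det_mat2 algebra_simps)
    qed
    fix i j :: 2
    show "real_analytic (\<lambda>x. W x $ i $ j)"
      using exhaust_2[of i] exhaust_2[of j] ra nra by (auto simp: W_def)
  qed
  have inv: "matrix_inv (W x) = mat2 (ar x) (br x) (cr x) (dr x)" for x
    using matrix_inv_mat2[of "dr x" "ar x" "- br x" "- cr x"] det[of x] by (simp add: W_def algebra_simps)
  have Wn: "strip_extendable s W" "strip_norm s W \<le> 4 * (Bu / sqrt (\<beta>/2))"
    by (rule strip_extension_mat2[where a = d and b = "\<lambda>z. - b z" and c = "\<lambda>z. - c z" and d = a];
        use abcd_bd s(1) in \<open>auto simp: W_def cr intro!: abcd_hol holomorphic_intros\<close>)+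
  \<comment> \<open>By \<open>A_action\<close> the cocycle rotates the frame (X, Y) by -\<theta>; a
    change of sign of Y reverses the rotation.\<close>
  define sg where "sg = - g"
  define Df where "Df = (\<lambda>x. W (x + \<alpha>) ** schroedinger_cocycle v lam E x ** matrix_inv (W x) - rot (sg * \<theta>))"
  define sh where "sh = (\<lambda>f (z::complex). f (z + of_real \<alpha>) :: complex)"
  have sh_hol: "sh f holomorphic_on strip s" if "f holomorphic_on strip s" for f
    unfolding sh_def by (rule holomorphic_on_compose_gen[OF _ that, unfolded o_def])
       (auto intro!: holomorphic_intros simp: strip_def)
  define tt where "tt = (\<lambda>z. of_real E - fser V z)"
  have tt_hol: "tt holomorphic_on strip s" unfolding tt_def by (intro holomorphic_intros hol)
  define F11 where "F11 = (\<lambda>z. (sh d z * tt z - sh b z) * a z + (- sh d z) * c z - co)"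
  define F12 where "F12 = (\<lambda>z. (sh d z * tt z - sh b z) * b z + (- sh d z) * d z - G * si)"
  define F21 where "F21 = (\<lambda>z. (- sh c z * tt z + sh a z) * a z + sh c z * c z + G * si)"
  define F22 where "F22 = (\<lambda>z. (- sh c z * tt z + sh a z) * b z + sh c z * d z - co)"
  have Fhol: "F11 holomorphic_on strip s" "F12 holomorphic_on strip s" "F21 holomorphic_on strip s"
      "F22 holomorphic_on strip s"
    unfolding F11_def F12_def F21_def F22_def by (intro holomorphic_intros sh_hol abcd_hol tt_hol)+
  have trig: "cos (2 * pi * (sg * \<theta>)) = cos (2 * pi * \<theta>)" "sin (2 * pi * (sg * \<theta>)) = - g * sin (2 * pi * \<theta>)"
    using g(1) by (auto simp: sg_def)
  have schr: "schroedinger_cocycle v lam E x = mat2 (E - lam * v x) (- 1) 1 0" for x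
    by (simp add: schroedinger_cocycle_def mat2_def)
  have sub2: "mat2 x1 x2 x3 x4 - mat2 y1 y2 y3 y4 = mat2 (x1 - y1) (x2 - y2) (x3 - y3) (x4 - y4)"
      for x1 x2 x3 x4 y1 y2 y3 y4 :: real
    by (simp add: mat2_eq_iff)
  have Dfr: "Df x = mat2
       ((dr (x + \<alpha>) * (E - lam * v x) - br (x + \<alpha>)) * ar x + (- dr (x + \<alpha>)) * cr x - cos (2 * pi * \<theta>))
       ((dr (x + \<alpha>) * (E - lam * v x) - br (x + \<alpha>)) * br x + (- dr (x + \<alpha>)) * dr x - g * sin (2 * pi * \<theta>))
       ((- cr (x + \<alpha>) * (E - lam * v x) + ar (x + \<alpha>)) * ar x + cr (x + \<alpha>) * cr x + g * sin (2 * pi * \<theta>))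
       ((- cr (x + \<alpha>) * (E - lam * v x) + ar (x + \<alpha>)) * br x + cr (x + \<alpha>) * dr x - cos (2 * pi * \<theta>))" for x
    unfolding Df_def inv schr rot_mat2 trig unfolding W_def mat2_mult sub2 by simp
  have shr: "sh f (of_real x) = f (of_real (x + \<alpha>))" for f x by (simp add: sh_def)
  have ttr: "tt (of_real x) = of_real (E - lam * v x)" for x by (simp add: tt_def v)
  have Freal: "F11 (of_real x) = of_real (Df x $ 1 $ 1)" "F12 (of_real x) = of_real (Df x $ 1 $ 2)"
    "F21 (of_real x) = of_real (Df x $ 2 $ 1)" "F22 (of_real x) = of_real (Df x $ 2 $ 2)" for x
    unfolding F11_def F12_def F21_def F22_def Dfr mat2_nth shr ttr cr G_def
    by (simp_all only: of_real_mult of_real_add of_real_diff of_real_minus)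
  have Fbd: "norm (F11 z) \<le> 3 * Ru * Bu / \<beta> \<and> norm (F12 z) \<le> 3 * Ru * Bu / \<beta> \<and>
     norm (F21 z) \<le> 3 * Ru * Bu / \<beta> \<and> norm (F22 z) \<le> 3 * Ru * Bu / \<beta>" if z: "z \<in> strip s" for z
  proof -
    define z' where "z' = z + of_real \<alpha>"
    have z': "z' \<in> strip s" unfolding z'_def by (rule zsh[OF z])
    note A = A_action[OF zin(2)[OF z], folded z'_def tt_def]
    have q0: "q z \<noteq> 0" "q z' \<noteq> 0" using qn z z' by auto
    have D': "G * (X1 z' * Y2 z' - X2 z' * Y1 z') = q z' * q z'" by (simp only: qq D_def)
    have tA: "tt z * X1 z - X2 z = co * X1 z' - si * Y1 z' - \<rho>X z" "tt z * Y1 z - Y2 z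
        = co * Y1 z' + si * X1 z' - \<rho>Y z"
      using A(1,2) by (simp_all add: tt_def)
    \<comment> \<open>Two sources of error: the frames at z and z' are normalised by different
      roots, which produces \<open>q z' / q z - 1\<close>, and the dual equation has residuals,
      which produce the second terms.\<close>
    have key: "F11 z = (q z' / q z - 1) * co - G * Y2 z' * \<rho>X z / (q z' * q z)"
      "F12 z = (q z' / q z - 1) * (G * si) - Y2 z' * \<rho>Y z / (q z' * q z)"
      "F21 z = - ((q z' / q z - 1) * (G * si)) + X2 z' * \<rho>X z / (q z' * q z)"
      "F22 z = (q z' / q z - 1) * co + G * X2 z' * \<rho>Y z / (q z' * q z)"
    proof -
      have solve: "F = (q z' / q z - 1) * k - e / (q z' * q z)"
        if "(F + k) * (q z' * q z) = k * (q z' * q z') - e" for F k e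
      proof -
        have "F + k = (k * (q z' * q z') - e) / (q z' * q z)" using that q0 by (simp add: nonzero_eq_divide_eq)
        also have "\<dots> = k * (q z' / q z) - e / (q z' * q z)" using q0 by (simp add: diff_divide_distrib)
        finally show ?thesis by (simp add: algebra_simps)
      qed
      have "(F11 z + co) * (q z' * q z) = G * (Y2 z' * (tt z * X1 z - X2 z) - Y1 z' * X1 z)"
        using q0 by (simp add: F11_def sh_def z'_def[symmetric] a_def b_def c_def d_def field_simps)
      also have "\<dots> = co * (G * (X1 z' * Y2 z' - X2 z' * Y1 z')) - G * Y2 z' * \<rho>X z"
        unfolding tA unfolding A(3) by (simp add: algebra_simps)
      also have "\<dots> = co * (q z' * q z') - G * Y2 z' * \<rho>X z" by (simp only: D')
      finally show "F11 z = (q z' / q z - 1) * co - G * Y2 z' * \<rho>X z / (q z' * q z)" by (rule solve)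
      have "(F12 z + G * si) * (q z' * q z) = (G * G) * (Y2 z' * (tt z * Y1 z - Y2 z) - Y1 z' * Y1 z)"
        using q0 by (simp add: F12_def sh_def z'_def[symmetric] a_def b_def c_def d_def field_simps)
      also have "\<dots> = si * (X1 z' * Y2 z' - X2 z' * Y1 z') - Y2 z' * \<rho>Y z"
        unfolding tA GG unfolding A(4) by (simp add: algebra_simps)
      also have "\<dots> = si * (G * (G * (X1 z' * Y2 z' - X2 z' * Y1 z'))) - Y2 z' * \<rho>Y z"
        by (simp only: mult.assoc[of G G, symmetric] GG mult_1)
      also have "\<dots> = (G * si) * (q z' * q z') - Y2 z' * \<rho>Y z" by (simp only: D') (simp only: mult_ac)
      finally show "F12 z = (q z' / q z - 1) * (G * si) - Y2 z' * \<rho>Y z / (q z' * q z)" by (rule solve)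
      have "(F21 z + - (G * si)) * (q z' * q z) = - X2 z' * (tt z * X1 z - X2 z) + X1 z' * X1 z"
        using q0 by (simp add: F21_def sh_def z'_def[symmetric] a_def b_def c_def d_def field_simps)
      also have "\<dots> = - si * (X1 z' * Y2 z' - X2 z' * Y1 z') + X2 z' * \<rho>X z"
        unfolding tA unfolding A(3) by (simp add: algebra_simps)
      also have "\<dots> = - si * (G * (G * (X1 z' * Y2 z' - X2 z' * Y1 z'))) + X2 z' * \<rho>X z"
        by (simp only: mult.assoc[of G G, symmetric] GG mult_1)
      also have "\<dots> = - (G * si) * (q z' * q z') - (- (X2 z' * \<rho>X z))" by (simp only: D') simp
      finally have "F21 z = (q z' / q z - 1) * (- (G * si)) - (- (X2 z' * \<rho>X z)) / (q z' * q z)" by (rule solve)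
      thus "F21 z = - ((q z' / q z - 1) * (G * si)) + X2 z' * \<rho>X z / (q z' * q z)" by simp
      have "(F22 z + co) * (q z' * q z) = G * (- X2 z' * (tt z * Y1 z - Y2 z) + X1 z' * Y1 z)"
        using q0 by (simp add: F22_def sh_def z'_def[symmetric] a_def b_def c_def d_def field_simps)
      also have "\<dots> = co * (G * (X1 z' * Y2 z' - X2 z' * Y1 z')) + G * X2 z' * \<rho>Y z"
        unfolding tA unfolding A(4) by (simp add: algebra_simps)
      also have "\<dots> = co * (q z' * q z') - (- (G * X2 z' * \<rho>Y z))" by (simp only: D') simp
      finally have "F22 z = (q z' / q z - 1) * co - (- (G * X2 z' * \<rho>Y z)) / (q z' * q z)" by (rule solve)
      thus "F22 z = (q z' / q z - 1) * co + G * X2 z' * \<rho>Y z / (q z' * q z)" by simp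
    qed
    \<comment> \<open>Difference of squares: both roots have real part at least sqrt(\<beta>/2), so
      their sum is bounded below, and \<open>D z' - D z\<close> is one step of the Wronskian, which
      involves no small divisor.\<close>
    have qr: "norm (q z' / q z - 1) \<le> Ru * Bu / \<beta>"
    proof -
      have "norm (D z' - D z) \<le> Ru * Bu"
      proof -
        have "norm (wr z' - wr z) \<le> norm (\<rho> z * us z) + norm (\<rho>s z * u z)"
          unfolding z'_def wr_step[OF zin(2)[OF z]] by (rule norm_triangle_ineq4)
        also have "\<dots> \<le> Ru * Bu + Ru * Bu"
          unfolding norm_mult Bu_def Ru_def
              by (intro add_mono mult_mono u_bound zin[OF z] norm_ge_zero nn[unfolded Bu_def Ru_def])
        finally have "norm (wr z' - wr z) / 2 \<le> Ru * Bu" by linarith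
        moreover have Deq: "D z' - D z = \<i> / 2 * (wr z' - wr z)" unfolding D_wr
            by (simp add: right_diff_distrib)
        have "norm (D z' - D z) = norm (wr z' - wr z) / 2" unfolding Deq norm_mult by (simp add: norm_divide)
        ultimately show ?thesis by simp
      qed
      moreover have "(q z' - q z) * (q z' + q z) = G * (D z' - D z)"
        using qq[of z'] qq[of z] by (simp add: algebra_simps)
      ultimately have 1: "norm (q z' - q z) * norm (q z' + q z) \<le> Ru * Bu"
        by (metis norm_mult Gn mult_1)
      have "2 * sqrt (\<beta>/2) \<le> Re (q z' + q z)" using Req[OF z] Req[OF z'] by simp
      also have "\<dots> \<le> norm (q z' + q z)" by (rule complex_Re_le_cmod)
      finally have 2: "2 * sqrt (\<beta>/2) \<le> norm (q z' + q z)" .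
      have "norm (q z' - q z) * (2 * sqrt (\<beta>/2)) \<le> Ru * Bu"
        by (rule order_trans[OF mult_left_mono[OF 2] 1]) simp
      hence "norm (q z' - q z) \<le> Ru * Bu / (2 * sqrt (\<beta>/2))" using sb(1) by (simp add: field_simps)
      hence "norm (q z' - q z) / norm (q z) \<le> (Ru * Bu / (2 * sqrt (\<beta>/2))) / sqrt (\<beta>/2)"
        using qn(1)[OF z] sb(1) nn by (intro frac_le) auto
      also have "\<dots> = Ru * Bu / (2 * (sqrt (\<beta>/2) * sqrt (\<beta>/2)))"
        by (simp only: divide_divide_eq_left mult.assoc)
      also have "\<dots> = Ru * Bu / \<beta>" unfolding sb(2) by simp
      also have "norm (q z' - q z) / norm (q z) = norm (q z' / q z - 1)"
        using q0 by (simp add: norm_divide[symmetric] diff_divide_distrib)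
      finally show ?thesis .
    qed
    have err: "norm (g' * Y * R / (q z' * q z)) \<le> 2 * Ru * Bu / \<beta>" if "norm g' = 1" "norm Y \<le> Bu" "norm R \<le> Ru"
        for g' Y R
    proof -
      have "norm (g' * Y * R) \<le> Ru * Bu"
        using that nn by (simp add: norm_mult mult.commute[of Ru] mult_mono)
      moreover have "sqrt (\<beta>/2) * sqrt (\<beta>/2) \<le> norm (q z') * norm (q z)"
        using qn(1)[OF z] qn(1)[OF z'] sb(1) by (intro mult_mono) auto
      hence "\<beta>/2 \<le> norm (q z' * q z)" by (simp only: norm_mult sb(2))
      ultimately have "norm (g' * Y * R) / norm (q z' * q z) \<le> Ru * Bu / (\<beta>/2)"
        using \<beta>(2) nn by (intro frac_le) auto
      thus ?thesis by (simp add: norm_divide mult_ac)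
    qed
    have cs: "norm co \<le> 1" "norm (G * si) \<le> 1" by (simp_all add: norm_mult Gn)
    have tri: "norm (Q * k) \<le> Ru * Bu / \<beta>" if "norm Q \<le> Ru * Bu / \<beta>" "norm k \<le> 1" for Q k :: complex
    proof -
      have "norm Q * norm k \<le> (Ru * Bu / \<beta>) * 1" using that nn \<beta>(2) by (intro mult_mono) auto
      thus ?thesis by (simp add: norm_mult)
    qed
    have sum3: "Ru * Bu / \<beta> + 2 * Ru * Bu / \<beta> = 3 * Ru * Bu / \<beta>" by (simp add: field_simps)
    note pz = pb[OF zin(1)[OF z]] and pz' = pb[OF zin(1)[OF z']]
    have "norm (F11 z) \<le> 3 * Ru * Bu / \<beta>"
      unfolding key(1) sum3[symmetric]
      by (rule order_trans[OF norm_triangle_ineq4 add_mono[OF tri[OF qr cs(1)] err[OF Gn pz'(4) pz(5)]]])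
    moreover have "norm (F12 z) \<le> 3 * Ru * Bu / \<beta>"
      unfolding key(2) sum3[symmetric]
      by (rule order_trans[OF norm_triangle_ineq4 add_mono[OF tri[OF qr cs(2)] err[OF _ pz'(4) pz(6), of 1,
          simplified]]])
    moreover have "norm (F21 z) \<le> 3 * Ru * Bu / \<beta>"
      unfolding key(3) sum3[symmetric]
      by (rule order_trans[OF norm_triangle_ineq add_mono[OF _ err[OF _ pz'(3) pz(5), of 1, simplified]]])
         (unfold norm_minus_cancel, rule tri[OF qr cs(2)])
    moreover have "norm (F22 z) \<le> 3 * Ru * Bu / \<beta>"
      unfolding key(4) sum3[symmetric]
      by (rule order_trans[OF norm_triangle_ineq add_mono[OF tri[OF qr cs(1)] err[OF Gn pz'(3) pz(6)]]])
    ultimately show ?thesis by blast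
  qed
  have Dn: "strip_extendable s Df" "strip_norm s Df \<le> 4 * (3 * Ru * Bu / \<beta>)"
    using strip_extension_mat2[OF Fhol Fbd Freal s(1)] by blast+
  have contr: "continuous_on {0..1} f" if "F holomorphic_on strip s" "\<And>x. F (of_real x) = of_real (f x)" for F f
  proof -
    have "continuous_on {0..1} (\<lambda>x. Re (F (of_real x)))"
      by (intro continuous_intros continuous_on_compose2[OF holomorphic_on_imp_continuous_on[OF that(1)]])
         (use real_in in auto)
    thus ?thesis by (simp add: that(2))
  qed
  note cont = contr[OF abcd_hol(1) cr(1)] contr[OF abcd_hol(2) cr(2)] contr[OF abcd_hol(3) cr(3)]
      contr[OF abcd_hol(4) cr(4)]
  \<comment> \<open>Applied to the inverse of \<open>W\<close>, whose upper left entry is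
    \<open>X1\<close> over a nonvanishing function.\<close>
  obtain m Z where mZ: "has_degree (\<lambda>x. mat2 (ar x) (br x) (cr x) (dr x)) m"
    "finite Z" "Z \<subseteq> {0..1}" "\<forall>x\<in>Z. ar x = 0" "int (card Z) = \<bar>m\<bar>"
    using SL2_loop_degree[OF cont det perr[of 0, simplified]] by blast
  have zero: "X1 (of_real x) = 0" if "x \<in> Z" for x
  proof -
    have "a (of_real x) = 0" using mZ(4) that by (simp add: cr)
    thus ?thesis using qn(2)[OF real_in[of x]] by (simp add: a_def)
  qed
  have deg: "\<exists>m. has_degree W m \<and> \<bar>m\<bar> = int (card Z)"
    using has_degree_adjugate[OF mZ(1)] mZ(5) by (intro exI[of _ "- m"]) (simp add: W_def)
  have sg: "sg \<in> {-1, 1}" using g(1) by (auto simp: sg_def)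
  show ?thesis
    using that[OF loop Wn(1) sg _ _ _ mZ(2,3) zero deg] Wn(2) Dn by (simp add: Bu_def Ru_def Df_def)
qed

end

section \<open>Resonances\<close>

text \<open>For |n| <= R/2 the untruncated equation is exact, so the error is the removed tail,
  which V must bridge over a distance of at least R/2. For |n| > R/2 each term is small by itself,
  with rate at least \<epsilon>/2. In both cases the decay is shared out as exp(-\<epsilon> R / 8)
  and exp(-\<epsilon> |n| / 4).\<close>

lemma quasi_residual_decay:
  fixes \<epsilon> R :: real
  assumes \<epsilon>: "\<epsilon> > 0" and V: "exp_decaying BV \<epsilon> V" and w: "exp_decaying B \<epsilon> w" and B: "B \<ge> 1" and M: "\<bar>E\<bar> \<le> M"
      and R: "R > 0"
    and sol: "\<And>n. (\<Sum>\<^sub>\<infinity>k. V k * uh (n - k)) + of_real (2 * cos (a n)) * uh n = of_real E * uh n"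
    and uh: "\<And>k. norm (uh k) \<le> 1"
    and w_def: "\<And>k. w k = (if \<bar>of_int k\<bar> < R then uh k else 0)"
  shows "exp_decaying ((BV * exp_sum (\<epsilon>/2) + 2 + M) * B * exp (- (\<epsilon>/8 * R))) (\<epsilon>/4)
    (\<lambda>n. conv V w n + of_real (2 * cos (a n)) * w n - of_real E * w n)"
  unfolding exp_decaying_def
proof
  fix n :: int
  define r where "r = conv V w n + of_real (2 * cos (a n)) * w n - of_real E * w n"
  define K where "K = BV * exp_sum (\<epsilon>/2) + 2 + M"
  have nn: "BV \<ge> 0" "exp_sum (\<epsilon>/2) \<ge> 0" "M \<ge> 0"
    using V exp_decaying_nonneg exp_sum_ge_1[of "\<epsilon>/2"] \<epsilon> M by auto
  have K0: "K \<ge> 0" "BV * exp_sum (\<epsilon>/2) \<le> K" using nn by (auto simp: K_def)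
  have "norm r \<le> K * B * exp (- (\<epsilon>/8 * R)) * exp (- (\<epsilon>/4 * \<bar>of_int n\<bar>))"
  proof (cases "\<bar>real_of_int n\<bar> \<le> R / 2")
    case True
    hence nR: "\<bar>real_of_int n\<bar> < R" using R by linarith
    define e where "e = (\<lambda>k. V k * (w (n - k) - uh (n - k)))"
    have s: "(\<lambda>k. V k * uh (n - k)) summable_on UNIV"
      by (rule exp_decaying_summable(2)[OF exp_decaying_mult[OF V uh] \<epsilon>]) simp
    have wb: "norm (w k) \<le> B" for k
    proof -
      have "norm (w k) \<le> B * exp (- (\<epsilon> * \<bar>of_int k\<bar>))" by (rule exp_decayingD[OF w])
      also have "\<dots> \<le> B * 1" using \<epsilon> B by (intro mult_left_mono) auto
      finally show ?thesis by simp
    qed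
    have s': "(\<lambda>k. V k * w (n - k)) summable_on UNIV"
      by (rule exp_decaying_summable(2)[OF exp_decaying_mult[OF V wb] \<epsilon>]) (use B in auto)
    have "r = conv V w n - (\<Sum>\<^sub>\<infinity>k. V k * uh (n - k))"
      using sol[of n] nR by (simp add: r_def w_def algebra_simps)
    also have "\<dots> = infsum e UNIV"
      unfolding conv_def e_def right_diff_distrib by (rule infsum_diff'[OF s' s, symmetric])
    finally have re: "r = infsum e UNIV" .
    have "exp_decaying (BV * exp (- (\<epsilon>/4 * R))) (\<epsilon>/2) e"
      unfolding exp_decaying_def
    proof
      fix k
      show "norm (e k) \<le> BV * exp (- (\<epsilon>/4 * R)) * exp (- (\<epsilon>/2 * \<bar>of_int k\<bar>))"
      proof (cases "\<bar>real_of_int (n - k)\<bar> < R")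
        case True thus ?thesis using nn by (simp add: e_def w_def)
      next
        case False
        have kR: "R / 2 \<le> \<bar>real_of_int k\<bar>" using False \<open>\<bar>real_of_int n\<bar> \<le> R / 2\<close> by simp
        have "norm (e k) \<le> norm (V k)" using False uh[of "n - k"]
            by (simp add: e_def w_def norm_mult mult_left_le)
        also have "\<dots> \<le> BV * exp (- (\<epsilon> * \<bar>of_int k\<bar>))" by (rule exp_decayingD[OF V])
        also have "\<dots> \<le> BV * exp (- (\<epsilon>/4 * R) + - (\<epsilon>/2 * \<bar>of_int k\<bar>))"
        proof (rule mult_left_mono[OF _ nn(1)])
          have "\<epsilon>/2 * (R/2) \<le> \<epsilon>/2 * \<bar>of_int k\<bar>" using kR \<epsilon> by (intro mult_left_mono) auto
          thus "exp (- (\<epsilon> * \<bar>of_int k\<bar>)) \<le> exp (- (\<epsilon>/4 * R) + - (\<epsilon>/2 * \<bar>of_int k\<bar>))"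
            by (simp add: field_simps)
        qed
        finally show ?thesis by (simp only: exp_add mult.assoc)
      qed
    qed
    from exp_decaying_summable(3)[OF this] \<epsilon> have "norm r \<le> BV * exp (- (\<epsilon>/4 * R)) * exp_sum (\<epsilon>/2)"
      by (simp add: re)
    also have "\<dots> = (BV * exp_sum (\<epsilon>/2)) * exp (- (\<epsilon>/4 * R))" by simp
    also have "\<dots> \<le> (K * B) * exp (- (\<epsilon>/8 * R) + - (\<epsilon>/4 * \<bar>of_int n\<bar>))"
    proof (rule mult_mono)
      have "BV * exp_sum (\<epsilon>/2) \<le> K * 1" using K0 by simp
      also have "\<dots> \<le> K * B" using B K0 by (intro mult_left_mono)
      finally show "BV * exp_sum (\<epsilon>/2) \<le> K * B" .
      have "\<epsilon>/4 * \<bar>of_int n\<bar> \<le> \<epsilon>/4 * (R/2)" using True \<epsilon> by (intro mult_left_mono) auto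
      thus "exp (- (\<epsilon>/4 * R)) \<le> exp (- (\<epsilon>/8 * R) + - (\<epsilon>/4 * \<bar>of_int n\<bar>))" by simp
    qed (use K0 B in auto)
    finally show ?thesis by (simp only: exp_add mult.assoc)
  next
    case False
    have c: "norm (conv V w n) \<le> BV * B * exp_sum (\<epsilon>/2) * exp (- (\<epsilon>/2 * \<bar>of_int n\<bar>))"
      by (rule exp_decayingD[OF exp_decaying_conv[OF V w \<epsilon>]])
    have wn: "norm (w n) \<le> B * exp (- (\<epsilon>/2 * \<bar>of_int n\<bar>))"
      by (rule exp_decayingD[OF exp_decaying_mono[OF w]]) (use \<epsilon> in auto)
    have "norm r \<le> norm (conv V w n) + norm (of_real (2 * cos (a n)) * w n) + norm (of_real E * w n)"
      unfolding r_def by (rule order_trans[OF norm_triangle_ineq4])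
          (intro add_mono norm_triangle_ineq order_refl)
    also have "\<dots> \<le> BV * B * exp_sum (\<epsilon>/2) * exp (- (\<epsilon>/2 * \<bar>of_int n\<bar>)) + 2 * (B * exp (- (\<epsilon>/2 * \<bar>of_int n\<bar>)))
        + M * (B * exp (- (\<epsilon>/2 * \<bar>of_int n\<bar>)))"
    proof -
      have "\<bar>2 * cos (a n)\<bar> \<le> 2" using abs_cos_le_one[of "a n"] by (simp add: abs_mult)
      thus ?thesis unfolding norm_mult norm_of_real using c wn M nn by (intro add_mono mult_mono) auto
    qed
    also have "\<dots> = (K * B) * exp (- (\<epsilon>/2 * \<bar>of_int n\<bar>))" by (simp add: K_def algebra_simps)
    also have "\<dots> \<le> (K * B) * exp (- (\<epsilon>/8 * R) + - (\<epsilon>/4 * \<bar>of_int n\<bar>))"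
    proof (rule mult_left_mono)
      have "\<epsilon>/4 * (R/2) \<le> \<epsilon>/4 * \<bar>of_int n\<bar>" using False \<epsilon> by (intro mult_left_mono) auto
      thus "exp (- (\<epsilon>/2 * \<bar>of_int n\<bar>)) \<le> exp (- (\<epsilon>/8 * R) + - (\<epsilon>/4 * \<bar>of_int n\<bar>))"
        by (simp add: field_simps)
    qed (use K0 B in auto)
    finally show ?thesis by (simp only: exp_add mult.assoc)
  qed
  thus "norm (conv V w n + of_real (2 * cos (a n)) * w n - of_real E * w n) \<le>
      (BV * exp_sum (\<epsilon>/2) + 2 + M) * B * exp (- (\<epsilon>/8 * R)) * exp (- (\<epsilon>/4 * \<bar>of_int n\<bar>))"
    by (simp add: r_def K_def)
qed

lemma resonance_min:
  assumes "k \<in> resonances \<alpha> \<epsilon>0 \<theta>" "\<bar>j\<bar> \<le> \<bar>k\<bar>"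
  shows "dist_Z (2 * \<theta> - of_int k * \<alpha>) \<le> dist_Z (2 * \<theta> - of_int j * \<alpha>)"
proof -
  have "{j :: int. \<bar>j\<bar> \<le> \<bar>k\<bar>} \<subseteq> {- \<bar>k\<bar>..\<bar>k\<bar>}" by auto
  hence "finite {j :: int. \<bar>j\<bar> \<le> \<bar>k\<bar>}" by (rule finite_subset) simp
  hence "Min ((\<lambda>j. dist_Z (2 * \<theta> - of_int j * \<alpha>)) ` {j. \<bar>j\<bar> \<le> \<bar>k\<bar>}) \<le> dist_Z (2 * \<theta> - of_int j * \<alpha>)"
    using assms(2) by (intro Min_le) auto
  thus ?thesis using assms(1) by (simp add: resonances_def)
qed

text \<open>The next resonance is at least as strong as the current one, so their difference is a good
  approximate period of the rotation and must be long.\<close>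

lemma next_resonance:
  assumes r: "res_enum \<alpha> \<epsilon>0 \<theta> r" and j: "j \<in> res_index \<alpha> \<epsilon>0 \<theta>" "Suc j \<in> res_index \<alpha> \<epsilon>0 \<theta>"
    and dc: "\<And>k::int. k \<noteq> 0 \<Longrightarrow> \<kappa> * \<bar>of_int k\<bar> powr (- \<tau>) \<le> dist_Z (of_int k * \<alpha>)" and pos: "\<kappa> > 0" "\<tau> > 0"
  shows "real_of_int \<bar>r (Suc j)\<bar> > 0"
    "\<kappa> * (2 * real_of_int \<bar>r (Suc j)\<bar>) powr (- \<tau>) \<le> 2 * dist_Z (2 * \<theta> - of_int (r j) * \<alpha>)"
proof -
  have le: "\<bar>r j\<bar> \<le> \<bar>r (Suc j)\<bar>" and res: "r (Suc j) \<in> resonances \<alpha> \<epsilon>0 \<theta>"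
    using r j by (auto simp: res_enum_def bij_betw_def)
  have inj: "inj_on r (res_index \<alpha> \<epsilon>0 \<theta>)" using r by (simp add: res_enum_def bij_betw_def)
  have ne: "r j \<noteq> r (Suc j)" using inj_onD[OF inj _ j] by auto
  have "\<bar>r (Suc j)\<bar> > 0" using le ne by auto
  thus "real_of_int \<bar>r (Suc j)\<bar> > 0" by simp
  define k where "k = r j - r (Suc j)"
  have "\<bar>k\<bar> \<le> 2 * \<bar>r (Suc j)\<bar>" using le by (simp add: k_def)
  hence k: "\<bar>real_of_int k\<bar> \<le> 2 * real_of_int \<bar>r (Suc j)\<bar>" by linarith
  have k0: "\<bar>real_of_int k\<bar> > 0" "k \<noteq> 0" using ne by (auto simp: k_def)
  have "(2 * real_of_int \<bar>r (Suc j)\<bar>) powr (- \<tau>) \<le> \<bar>real_of_int k\<bar> powr (- \<tau>)"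
    using k k0 pos by (intro powr_mono2') auto
  hence "\<kappa> * (2 * real_of_int \<bar>r (Suc j)\<bar>) powr (- \<tau>) \<le> \<kappa> * \<bar>real_of_int k\<bar> powr (- \<tau>)"
    using pos by (intro mult_left_mono) auto
  also have "\<dots> \<le> dist_Z (of_int k * \<alpha>)" by (rule dc[OF k0(2)])
  also have "of_int k * \<alpha> = (2 * \<theta> - of_int (r (Suc j)) * \<alpha>) - (2 * \<theta> - of_int (r j) * \<alpha>)"
    by (simp add: k_def algebra_simps)
  also have "dist_Z \<dots> \<le> dist_Z (2 * \<theta> - of_int (r (Suc j)) * \<alpha>) + dist_Z (2 * \<theta> - of_int (r j) * \<alpha>)"
    by (rule dist_Z_diff)
  also have "\<dots> \<le> 2 * dist_Z (2 * \<theta> - of_int (r j) * \<alpha>)"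
    using resonance_min[OF res le] by simp
  finally show "\<kappa> * (2 * real_of_int \<bar>r (Suc j)\<bar>) powr (- \<tau>) \<le> 2 * dist_Z (2 * \<theta> - of_int (r j) * \<alpha>)" .
qed

text \<open>The inequality assumed for finite N, supplied by \<open>next_resonance\<close>, says
  that L is at most a constant times N^\<tau>. A power of L is thus polynomial in N and costs half
  of the rate; for infinite N both sides are 0.\<close>

lemma powr_exp_decay:
  fixes P c \<kappa> \<tau> :: real
  assumes pos: "P > 0" "c > 0" "\<kappa> > 0" "\<tau> > 0"
  obtains Q where "Q > 0"
    "\<And>N L. L > 0 \<Longrightarrow> N = \<infinity> \<or> (\<exists>x>0. N = ereal x \<and> \<kappa> * (2 * x) powr (- \<tau>) \<le> 2 / L) \<Longrightarrow>
       L powr P * exp_decay c N \<le> Q * exp_decay (c/2) N"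
proof -
  define Q where "Q = (2 / \<kappa>) powr P * (\<tau> * P / (c / 4)) powr (\<tau> * P)"
  have Q: "Q > 0" using pos by (simp add: Q_def)
  have main: "L powr P * exp_decay c N \<le> Q * exp_decay (c/2) N"
    if L: "L > 0" and N: "N = \<infinity> \<or> (\<exists>x>0. N = ereal x \<and> \<kappa> * (2 * x) powr (- \<tau>) \<le> 2 / L)" for N L
  proof (cases "N = \<infinity>")
    case True thus ?thesis by (simp add: exp_decay_def)
  next
    case False
    then obtain x where x: "x > 0" "N = ereal x" "\<kappa> * (2 * x) powr (- \<tau>) \<le> 2 / L" using N by blast
    have "L \<le> (2 / \<kappa>) * (2 * x) powr \<tau>"
      using x(1,3) L pos by (simp add: powr_minus field_simps)
    hence "L powr P \<le> ((2 / \<kappa>) * (2 * x) powr \<tau>) powr P" using L pos by (intro powr_mono2) auto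
    also have "\<dots> = (2 / \<kappa>) powr P * (2 * x) powr (\<tau> * P)"
    proof -
      have "((2 / \<kappa>) * z powr \<tau>) powr P = (2 / \<kappa>) powr P * z powr (\<tau> * P)" if "z > 0" for z
        using pos that powr_mult[of "2 / \<kappa>" "z powr \<tau>" P] by (simp add: powr_powr)
      thus ?thesis using x(1) by simp
    qed
    also have "\<dots> \<le> (2 / \<kappa>) powr P * ((\<tau> * P / (c / 4)) powr (\<tau> * P) * exp (c / 4 * (2 * x)))"
      using powr_le_exp[of "2 * x" "c / 4" "\<tau> * P"] pos x by (intro mult_left_mono) auto
    also have "\<dots> = Q * exp (c * x / 2)" by (simp add: Q_def)
    finally have "L powr P * exp (- (c * x)) \<le> Q * exp (c * x / 2) * exp (- (c * x))"
        by (intro mult_right_mono) auto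
    also have "\<dots> = Q * exp (- (c / 2 * x))" by (simp add: mult.assoc flip: exp_add)
    finally show ?thesis by (simp add: exp_decay_def x(2))
  qed
  show ?thesis by (rule that[OF Q main])
qed

lemma exp_decay_mono:
  assumes "c \<le> c'" "N \<ge> 0"
  shows "exp_decay c' N \<le> exp_decay c N"
proof (cases "N = \<infinity>")
  case False
  then obtain x where x: "N = ereal x" "x \<ge> 0" using assms(2) by (cases N) auto
  thus ?thesis using assms(1) by (simp add: exp_decay_def mult_right_mono)
qed (simp add: exp_decay_def)

lemma exp_decay_le_1: "c > 0 \<Longrightarrow> N \<ge> 0 \<Longrightarrow> exp_decay c N \<le> 1"
  using exp_decay_mono[of 0 c N] by (auto simp: exp_decay_def split: if_splits)

lemma exp_decay_nonneg: "exp_decay c N \<ge> 0"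
  by (simp add: exp_decay_def)

lemma fourier_coeff_cnj:
  assumes "\<epsilon> > 0" "exp_decaying B \<epsilon> (fourier_coeff f)" "\<And>x. fser (fourier_coeff f) (of_real x) = of_real (f x)"
  shows "fourier_coeff f (- k) = cnj (fourier_coeff f k)"
proof -
  have "fourier_coeff f = (\<lambda>k. cnj (fourier_coeff f (- k)))"
  proof (rule fser_coeff_unique[OF assms(2) exp_decaying_reflect[OF assms(2)] assms(1,1)])
    show "fser (fourier_coeff f) (of_real x) = fser (\<lambda>k. cnj (fourier_coeff f (- k))) (of_real x)" for x
      using fser_cnj[of "fourier_coeff f" "of_real x"] by (simp add: assms(3))
  qed
  from fun_cong[OF this, of "- k"] show ?thesis by simp
qed

section \<open>Almost reducibility\<close>

theorem theorem3p5:
  fixes v :: "real \<Rightarrow> real" and lam lam0 \<alpha> C0 C1 \<epsilon>0 \<epsilon>1 :: real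
  assumes "periodic1 v" and "real_analytic v"
    and "\<alpha> \<in> DC"
    and "coupling_threshold v lam0" and "\<bar>lam\<bar> < lam0"
    and "almost_localized v lam \<alpha> C0 C1 \<epsilon>0 \<epsilon>1"
  shows "\<exists>C>0. \<exists>c>0. \<forall>E\<in>Sigma_spec v lam \<alpha>. \<forall>\<theta>. dual_phase v lam \<alpha> E \<theta> \<longrightarrow>
    (\<forall>r. res_enum \<alpha> \<epsilon>0 \<theta> r \<longrightarrow> (\<forall>j\<in>res_index \<alpha> \<epsilon>0 \<theta>. \<forall>n N L.
       n = real_of_int \<bar>r j\<bar> + 1 \<longrightarrow>
       N = res_abs \<alpha> \<epsilon>0 \<theta> r (Suc j) \<longrightarrow>
       inverse L = dist_Z (2 * \<theta> - real_of_int (r j) * \<alpha>) \<longrightarrow>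
       0 < inverse L \<longrightarrow> inverse L < c \<longrightarrow>
       (\<exists>W. analytic_SL2_loop W \<and>
          (\<exists>m. has_degree W m \<and> real_of_int \<bar>m\<bar> \<le> C * n) \<and>
          strip_extendable c W \<and> strip_norm c W \<le> C * L powr C \<and>
          (\<exists>s\<in>{-1, 1}.
             let D = (\<lambda>x. W (x + \<alpha>) ** schroedinger_cocycle v lam E x ** matrix_inv (W x)
                           - rot (s * \<theta>))
             in strip_extendable c D \<and> strip_norm c D \<le> C * exp_decay c N))))"
proof -

  \<comment> \<open>Choice of the constants, before E, \<theta> and the resonance are given\<close>
  obtain Bv \<epsilon>v where fv: "\<epsilon>v > 0" "exp_decaying Bv \<epsilon>v (fourier_coeff v)"
    "\<And>x. fser (fourier_coeff v) (of_real x) = of_real (v x)"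
    by (rule fourier_coeff_analytic[OF assms(2,1)]) (rule that)
  obtain \<kappa> \<tau> where dc: "\<kappa> > 0" "\<tau> > 0" "\<And>k::int. k \<noteq> 0 \<Longrightarrow> \<kappa> * \<bar>of_int k\<bar> powr (- \<tau>) \<le> dist_Z (of_int k * \<alpha>)"
    by (rule DC_dist_Z[OF assms(3)]) (rule that)
  have alpos: "C0 > 0" "C1 > 0" "\<epsilon>0 > 0" "\<epsilon>1 > 0" using assms(6) by (auto simp: almost_localized_def)
  have al: "norm (u k) \<le> C1 * exp (- (\<epsilon>1 * real_of_int \<bar>k\<bar>))"
    if "dual_solution v lam \<alpha> \<theta> E u" "u 0 = 1" "\<And>k. norm (u k) \<le> 1 + real_of_int \<bar>k\<bar>" "res_enum \<alpha> \<epsilon>0 \<theta> r"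
      "j \<in> res_index \<alpha> \<epsilon>0 \<theta>" "C0 * (1 + real_of_int \<bar>r j\<bar>) < real_of_int \<bar>k\<bar>"
      "ereal (real_of_int \<bar>k\<bar>) < ereal (inverse C0) * res_abs \<alpha> \<epsilon>0 \<theta> r (Suc j)" for \<theta> E u r j k
    using assms(6) that unfolding almost_localized_def by blast
  \<comment> \<open>The smaller of the decay rate of the potential and the rate of almost
    localization. One quarter of it, the rate left by \<open>quasi_residual_decay\<close>, is the
    working rate \<epsilon> below.\<close>
  define \<epsilon>2 where "\<epsilon>2 = min \<epsilon>v \<epsilon>1"
  have \<epsilon>2: "\<epsilon>2 > 0" "\<epsilon>2 \<le> \<epsilon>v" "\<epsilon>2 \<le> \<epsilon>1" using fv(1) alpos by (auto simp: \<epsilon>2_def)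
  define \<epsilon> where "\<epsilon> = \<epsilon>2 / 4"
  have \<epsilon>: "\<epsilon> > 0" "\<epsilon> \<le> \<epsilon>2" using \<epsilon>2 by (auto simp: \<epsilon>_def)
  define V where "V = (\<lambda>k. complex_of_real lam * fourier_coeff v k)"
  define BV where "BV = Bv * \<bar>lam\<bar>"
  have Vdec2: "exp_decaying BV \<epsilon>2 V"
    unfolding V_def BV_def
    by (subst mult.commute, rule exp_decaying_mult[OF exp_decaying_mono[OF fv(2) order_refl \<epsilon>2(2)]]) auto
  have Vdec: "exp_decaying BV \<epsilon> V" by (rule exp_decaying_mono[OF Vdec2 order_refl \<epsilon>(2)])
  have BV0: "BV \<ge> 0" using Vdec by (rule exp_decaying_nonneg)
  have Vx: "fser V (of_real x) = of_real (lam * v x)" for x by (simp add: V_def fser_cmult fv(3))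
  have Vreal: "V (- k) = cnj (V k)" for k by (simp add: V_def fourier_coeff_cnj[OF fv])
  define ES where "ES = exp_sum (\<epsilon>/2)"
  have ES: "ES \<ge> 1" using exp_sum_ge_1[of "\<epsilon>/2"] \<epsilon> by (simp add: ES_def)
  define M0 where "M0 = BV * exp_sum \<epsilon>2 + 2"
  have M00: "M0 \<ge> 0" using BV0 exp_sum_ge_1[OF \<epsilon>2(1)] by (simp add: M0_def)
  define M where "M = M0 + BV * ES + 2"
  have M2: "M \<ge> 2" using M00 BV0 ES by (simp add: M_def)
  \<comment> \<open>c0 >= C0 keeps the cutoff N/c0 within the range of almost localization, and
    makes |k| <= c0 n contain the range |k| <= C0 n where nothing but boundedness is known.\<close>
  define c0 where "c0 = max 1 C0"
  have c0: "c0 \<ge> 1" "c0 \<ge> C0" by (auto simp: c0_def)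
  define K where "K = BV * exp_sum (\<epsilon>2/2) + 2 + M0"
  have K0: "K \<ge> 0" using BV0 M00 exp_sum_ge_1[of "\<epsilon>2/2"] \<epsilon>2 by (simp add: K_def)
  \<comment> \<open>The rate that \<open>quasi_residual_decay\<close> gives for the cutoff R =
    N/c0.\<close>
  define c5 where "c5 = \<epsilon>2 / (8 * c0)"
  have c5: "c5 > 0" using \<epsilon>2 c0 by (simp add: c5_def)
  \<comment> \<open>The first three terms give B <= L^b, using n <= ln L / \<epsilon>0 + 1 and ln L
    >= 1; the last one gives |n_j| <= b ln L.\<close>
  define b where "b = ln (1 + C1) + \<epsilon>2 * c0 + \<epsilon>2 * c0 / \<epsilon>0 + 1 / \<epsilon>0"
  have lnC1: "ln (1 + C1) > 0" using alpos by simp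
  have b0: "b > 0" using lnC1 \<epsilon>2 c0 alpos by (auto simp: b_def intro!: add_pos_pos add_pos_nonneg)
  obtain Cw L0 where low: "Cw > 0" "L0 > 1"
    "\<And>\<alpha> \<theta> E B \<eta> BV V w r L j \<delta>. \<lbrakk>dual_quasi \<alpha> \<theta> E \<epsilon> B \<eta> BV V w r; \<bar>E\<bar> + BV * exp_sum (\<epsilon>/2) + 2 \<le> M;
       \<forall>k::int. k \<noteq> 0 \<longrightarrow> \<kappa> * \<bar>of_int k\<bar> powr (- \<tau>) \<le> dist_Z (of_int k * \<alpha>);
       dist_Z (2 * \<theta> - of_int j * \<alpha>) = 1 / L; \<bar>of_int j\<bar> \<le> b * ln L; B \<le> L powr b; L \<ge> L0;
       \<forall>x::real. norm (dual_quasi.wr \<alpha> \<theta> w (of_real x)) \<le> \<delta>; 2 * (\<eta> * B) * exp_sum (\<epsilon>/2) ^ 2 \<le> \<delta>\<rbrakk>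
     \<Longrightarrow> L powr (- Cw) \<le> \<delta>"
    by (rule wronskian_lower[OF \<epsilon>(1) dc(1,2) b0 M2]) (rule that)
  define s0 where "s0 = \<epsilon> / (16 * pi)"
  have s0: "s0 > 0" "16 * pi * s0 \<le> \<epsilon>" using \<epsilon> by (auto simp: s0_def)
  obtain Cz where Cz: "Cz > 0"
    "\<forall>f B Z x1. f holomorphic_on strip s0 \<longrightarrow> (\<forall>z\<in>strip s0. norm (f z) \<le> B) \<longrightarrow>
      finite Z \<longrightarrow> Z \<subseteq> {0..1} \<longrightarrow> (\<forall>x\<in>Z. f (of_real x) = 0) \<longrightarrow> x1 \<in> {0..1} \<longrightarrow>
      norm (f (of_real x1)) \<ge> 1 \<longrightarrow> real (card Z) \<le> Cz * ln B"
    using strip_zeros_bound[OF s0(1)] by blast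
  \<comment> \<open>Two factors \<open>B\<close> cost 2b powers of L, division by the Wronskian
    costs \<open>Cw\<close>, and one spare power beats the constants.\<close>
  define P where "P = 2 * b + Cw + 1"
  have P0: "P > 0" using b0 low(1) by (simp add: P_def)
  obtain Q where Q: "Q > 0"
    "\<And>N L. L > 0 \<Longrightarrow> N = \<infinity> \<or> (\<exists>x>0. N = ereal x \<and> \<kappa> * (2 * x) powr (- \<tau>) \<le> 2 / L) \<Longrightarrow>
       L powr P * exp_decay c5 N \<le> Q * exp_decay (c5/2) N"
    by (rule powr_exp_decay[OF P0 c5 dc(1,2)]) (rule that)
  define Kw where "Kw = 2 * exp_sum (\<epsilon>/2) * ((4 * \<tau> / \<epsilon>) powr \<tau> / \<kappa>) * exp_sum (\<epsilon>/8)"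
  have Kw0: "Kw \<ge> 0" using dc exp_sum_ge_1[of "\<epsilon>/2"] exp_sum_ge_1[of "\<epsilon>/8"] \<epsilon> by (simp add: Kw_def)
  define K1 where "K1 = (2 * Kw + 2 * ES\<^sup>2) * (K * Q)"
  define L1 where "L1 = max L0 (max (exp 1) (8 * K1))"
  have L11: "L1 > 0" "L1 \<ge> L0" "L1 \<ge> exp 1" "L1 \<ge> 8 * K1" using low(2) by (auto simp: L1_def)
  \<comment> \<open>The entry 1/L1 turns the hypothesis 1/L < c into L > L1. The others keep the
    strip inside the one of half width s0, and the rate below the c5/2 that remains once powers of L
    are absorbed.\<close>
  define c where "c = min s0 (min (c5/2) (1 / L1))"
  have c: "c > 0" "c \<le> s0" "c \<le> c5/2" "c \<le> 1 / L1" using s0 c5 L11 by (auto simp: c_def)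
  have c16: "16 * pi * c \<le> \<epsilon>" by (rule order_trans[OF mult_left_mono[OF c(2)] s0(2)]) simp
  define Ca where "Ca = Cz * (ln (1 + C1) + \<epsilon>2 * c0 + ln ES)"
  define Cb where "Cb = max (12 * ES) (b + Cw / 2)"
  define Cc where "Cc = 48 * ES\<^sup>2 * K * Q"
  define C where "C = max 1 (max Ca (max Cb Cc))"
  have C: "C \<ge> 1" "C \<ge> Ca" "C \<ge> 12 * ES" "C \<ge> b + Cw / 2" "C \<ge> Cc" by (auto simp: C_def Cb_def)
  have "\<exists>W. analytic_SL2_loop W \<and>
          (\<exists>m. has_degree W m \<and> real_of_int \<bar>m\<bar> \<le> C * n) \<and>
          strip_extendable c W \<and> strip_norm c W \<le> C * L powr C \<and>
          (\<exists>s\<in>{-1, 1}.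
             let D = (\<lambda>x. W (x + \<alpha>) ** schroedinger_cocycle v lam E x ** matrix_inv (W x)
                           - rot (s * \<theta>))
             in strip_extendable c D \<and> strip_norm c D \<le> C * exp_decay c N)"
    if phase: "dual_phase v lam \<alpha> E \<theta>" and r: "res_enum \<alpha> \<epsilon>0 \<theta> r" and j: "j \<in> res_index \<alpha> \<epsilon>0 \<theta>"
      and n: "n = real_of_int \<bar>r j\<bar> + 1" and N: "N = res_abs \<alpha> \<epsilon>0 \<theta> r (Suc j)"
      and L: "inverse L = dist_Z (2 * \<theta> - real_of_int (r j) * \<alpha>)" "0 < inverse L" "inverse L < c"
    for E \<theta> r j n N L
  proof -

    \<comment> \<open>The truncated dual solution and its residual\<close>
    obtain uh where uh: "dual_solution v lam \<alpha> \<theta> E uh" "uh 0 = 1" "\<And>k. norm (uh k) \<le> 1"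
      using phase unfolding dual_phase_def by blast
    have uhb: "norm (uh k) \<le> 1 + real_of_int \<bar>k\<bar>" for k
      by (rule order_trans[OF uh(3)]) simp
    have sol: "(\<Sum>\<^sub>\<infinity>k. V k * uh (n - k)) + of_real (2 * cos (2 * pi * (\<theta> + of_int n * \<alpha>))) * uh n
        = of_real E * uh n" for n
      using uh(1) unfolding dual_solution_def dual_op_def V_def by blast
    \<comment> \<open>The dual equation at site 0, where \<open>uh\<close> is 1 and elsewhere at
      most 1 in modulus, bounds E uniformly; this is why the constants need not depend on E.\<close>
    have E: "\<bar>E\<bar> \<le> M0"
    proof -
      have "exp_decaying (BV * 1) \<epsilon>2 (\<lambda>k. V k * uh (0 - k))"
          by (rule exp_decaying_mult[OF Vdec2]) (use uh(3) in auto)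
      hence s: "norm (\<Sum>\<^sub>\<infinity>k. V k * uh (0 - k)) \<le> BV * exp_sum \<epsilon>2" using exp_decaying_summable(3)[OF _ \<epsilon>2(1)]
          by simp
      have "complex_of_real E = (\<Sum>\<^sub>\<infinity>k. V k * uh (0 - k)) + of_real (2 * cos (2 * pi * (\<theta> + of_int 0 * \<alpha>)))"
        using sol[of 0] uh(2) by simp
      hence "norm (complex_of_real E)
          = norm ((\<Sum>\<^sub>\<infinity>k. V k * uh (0 - k)) + of_real (2 * cos (2 * pi * (\<theta> + of_int 0 * \<alpha>))))"
        by (rule arg_cong)
      hence "\<bar>E\<bar> = norm ((\<Sum>\<^sub>\<infinity>k. V k * uh (0 - k)) + of_real (2 * cos (2 * pi * (\<theta> + of_int 0 * \<alpha>))))"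
        by (simp only: norm_of_real)
      also have "\<dots> \<le> BV * exp_sum \<epsilon>2 + \<bar>2 * cos (2 * pi * (\<theta> + of_int 0 * \<alpha>))\<bar>"
        by (rule order_trans[OF norm_triangle_ineq add_mono[OF s]]) (simp only: norm_of_real)
      also have "\<dots> \<le> M0" using abs_cos_le_one[of "2 * pi * (\<theta> + of_int 0 * \<alpha>)"] by (simp add: M0_def abs_mult)
      finally show ?thesis .
    qed
    have Lpos: "L > 0" using L(2) by simp
    have LL1: "L > L1"
    proof -
      have "inverse L < 1 / L1" using L(3) c(4) by simp
      thus ?thesis using Lpos L11(1) by (simp add: field_simps)
    qed
    have L1': "L \<ge> L0" "L \<ge> exp 1" "L > 8 * K1" using LL1 L11 by auto
    have lnL: "ln L \<ge> 1" using L1'(2) Lpos by (simp add: ln_ge_iff)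
    have Lge1: "L \<ge> 1" using L1'(1) low(2) by simp
    have rj: "real_of_int \<bar>r j\<bar> \<le> ln L / \<epsilon>0"
    proof -
      have "r j \<in> resonances \<alpha> \<epsilon>0 \<theta>" using r j by (auto simp: res_enum_def bij_betw_def)
      hence "inverse L \<le> exp (- (real_of_int \<bar>r j\<bar> * \<epsilon>0))" using L(1) by (simp add: resonances_def)
      hence "exp (real_of_int \<bar>r j\<bar> * \<epsilon>0) \<le> L" using Lpos by (simp add: exp_minus field_simps)
      hence "real_of_int \<bar>r j\<bar> * \<epsilon>0 \<le> ln L" using Lpos by (simp add: ln_ge_iff)
      thus ?thesis using alpos by (simp add: field_simps)
    qed
    have n1: "n \<ge> 1" using n by simp
    have Ncases: "N = \<infinity> \<or> (\<exists>x>0. N = ereal x \<and> \<kappa> * (2 * x) powr (- \<tau>) \<le> 2 / L)"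
    proof (cases "Suc j \<in> res_index \<alpha> \<epsilon>0 \<theta>")
      case True
      from next_resonance[OF r j True dc(3,1,2)] L(1) True show ?thesis
        by (intro disjI2 exI[of _ "real_of_int \<bar>r (Suc j)\<bar>"]) (auto simp: N res_abs_def divide_inverse)
    next
      case False thus ?thesis by (simp add: N res_abs_def)
    qed
    have N0: "N \<ge> 0" using Ncases by auto
    \<comment> \<open>For |k| <= c0 n only |uh k| <= 1 is available, so exponential decay at rate
      \<epsilon>2 from the origin needs the factor exp(\<epsilon>2 c0 n).\<close>
    define B where "B = (1 + C1) * exp (\<epsilon>2 * c0 * n)"
    have B1: "B \<ge> 1"
    proof -
      have "1 * 1 \<le> B" unfolding B_def using alpos \<epsilon>2 c0 n1 by (intro mult_mono) auto
      thus ?thesis by simp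
    qed
    have lnB: "ln B = ln (1 + C1) + \<epsilon>2 * c0 * n" using alpos by (simp add: B_def ln_mult)
    have BL: "B \<le> L powr b"
    proof -
      have "\<epsilon>2 * c0 * n \<le> \<epsilon>2 * c0 * (ln L / \<epsilon>0 + 1)" using n rj \<epsilon>2 c0 by (intro mult_left_mono) auto
      hence "ln B \<le> ln (1 + C1) * 1 + \<epsilon>2 * c0 * 1 + \<epsilon>2 * c0 / \<epsilon>0 * ln L" unfolding lnB
          by (simp add: algebra_simps)
      also have "\<dots> \<le> ln (1 + C1) * ln L + \<epsilon>2 * c0 * ln L + \<epsilon>2 * c0 / \<epsilon>0 * ln L"
        using lnL lnC1 \<epsilon>2 c0 alpos by (intro add_mono mult_left_mono) auto
      also have "\<dots> \<le> b * ln L" using lnL alpos by (simp add: b_def algebra_simps)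
      finally have "exp (ln B) \<le> exp (b * ln L)" by simp
      thus ?thesis using B1 Lpos by (simp add: powr_def)
    qed
    have rjb: "\<bar>of_int (r j)\<bar> \<le> b * ln L"
    proof -
      have "1 / \<epsilon>0 \<le> b" using lnC1 \<epsilon>2 c0 alpos by (simp add: b_def)
      hence "1 / \<epsilon>0 * ln L \<le> b * ln L" using lnL by (intro mult_right_mono) auto
      thus ?thesis using rj by simp
    qed
    \<comment> \<open>The comparison is made in \<open>ereal\<close>, so that an infinite N retains
      every index.\<close>
    define I where "I = {k::int. ereal (real_of_int \<bar>k\<bar>) < ereal (inverse c0) * N}"
    define w where "w = (\<lambda>k. if k \<in> I then uh k else 0)"
    have wdec: "exp_decaying B \<epsilon>2 w"
      unfolding exp_decaying_def
    proof
      fix k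
      show "norm (w k) \<le> B * exp (- (\<epsilon>2 * \<bar>of_int k\<bar>))"
      proof (cases "k \<in> I \<and> c0 * n < \<bar>real_of_int k\<bar>")
        case True
        have "ereal (real_of_int \<bar>k\<bar>) < ereal (inverse c0) * N" using True by (simp add: I_def)
        also have "\<dots> \<le> ereal (inverse C0) * N"
          using c0 alpos N0 by (intro ereal_mult_right_mono) (auto intro: le_imp_inverse_le)
        finally have 1: "ereal (real_of_int \<bar>k\<bar>) < ereal (inverse C0) * res_abs \<alpha> \<epsilon>0 \<theta> r (Suc j)"
            by (simp add: N)
        have "C0 * (1 + real_of_int \<bar>r j\<bar>) \<le> c0 * n" unfolding n add.commute[of 1]
            by (rule mult_right_mono) (use c0 in auto)
        hence 2: "C0 * (1 + real_of_int \<bar>r j\<bar>) < real_of_int \<bar>k\<bar>" using True by simp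
        have "norm (uh k) \<le> C1 * exp (- (\<epsilon>1 * real_of_int \<bar>k\<bar>))"
          by (rule al[OF uh(1,2) uhb r j 2 1])
        also have "\<dots> \<le> B * exp (- (\<epsilon>2 * \<bar>of_int k\<bar>))"
        proof (rule mult_mono)
          have "C1 * 1 \<le> (1 + C1) * exp (\<epsilon>2 * c0 * n)" using alpos \<epsilon>2 c0 n1 by (intro mult_mono) auto
          thus "C1 \<le> B" by (simp add: B_def)
          show "exp (- (\<epsilon>1 * real_of_int \<bar>k\<bar>)) \<le> exp (- (\<epsilon>2 * \<bar>of_int k\<bar>))" using \<epsilon>2
              by (simp add: mult_right_mono)
        qed (use B1 in auto)
        finally show ?thesis using True by (simp add: w_def)
      next
        case False
        show ?thesis
        proof (cases "k \<in> I")
          case True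
          hence "\<bar>real_of_int k\<bar> \<le> c0 * n" using False by simp
          hence "\<epsilon>2 * \<bar>real_of_int k\<bar> \<le> \<epsilon>2 * (c0 * n)" using \<epsilon>2 by (intro mult_left_mono) auto
          hence "1 * 1 \<le> (1 + C1) * exp (\<epsilon>2 * c0 * n + - (\<epsilon>2 * \<bar>of_int k\<bar>))"
            using alpos by (intro mult_mono) auto
          hence "1 \<le> B * exp (- (\<epsilon>2 * \<bar>of_int k\<bar>))" unfolding B_def exp_add by (simp add: mult.assoc)
          thus ?thesis using uh(3)[of k] True by (simp add: w_def)
        qed (use B1 in \<open>simp add: w_def\<close>)
      qed
    qed
    define rr where "rr = (\<lambda>n. conv V w n + of_real (2 * cos (2 * pi * (\<theta> + of_int n * \<alpha>))) * w n - of_real E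
        * w n)"
    define \<eta> where "\<eta> = K * B * exp_decay c5 N"
    have rdec: "exp_decaying \<eta> \<epsilon> rr"
      using Ncases
    proof
      \<comment> \<open>After the last resonance nothing is cut off: the equation is exact and
        \<eta> is 0, in accordance with \<open>exp_decay c5 \<infinity> = 0\<close>.\<close>
      assume Ninf: "N = \<infinity>"
      have "w = uh" using c0 by (auto simp: w_def I_def Ninf fun_eq_iff)
      hence "rr n = 0" for n using sol[of n] by (simp add: rr_def conv_def)
      moreover have "\<eta> \<ge> 0" using K0 B1 by (simp add: \<eta>_def exp_decay_nonneg)
      ultimately show ?thesis by (simp add: exp_decaying_def)
    next
      assume "\<exists>x>0. N = ereal x \<and> \<kappa> * (2 * x) powr (- \<tau>) \<le> 2 / L"
      then obtain x where x: "x > 0" "N = ereal x" by blast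
      have w': "w k = (if \<bar>of_int k\<bar> < x / c0 then uh k else 0)" for k
        by (simp add: w_def I_def x(2) divide_inverse mult.commute)
      have "exp_decaying ((BV * exp_sum (\<epsilon>2/2) + 2 + M0) * B * exp (- (\<epsilon>2/8 * (x / c0)))) (\<epsilon>2/4) rr"
        unfolding rr_def
        by (rule quasi_residual_decay[OF \<epsilon>2(1) Vdec2 wdec B1 E _ sol uh(3) w']) (use x c0 in auto)
      moreover have "exp_decay c5 N = exp (- (\<epsilon>2/8 * (x / c0)))" by (simp add: exp_decay_def x c5_def)
      ultimately show ?thesis by (simp add: \<eta>_def K_def \<epsilon>_def)
    qed
    have w0: "w 0 = 1"
    proof -
      have "0 < ereal (inverse c0) * N" using Ncases c0 by (auto simp: zero_ereal_def)
      thus ?thesis by (simp add: w_def I_def uh(2) zero_ereal_def)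
    qed
    interpret dual_quasi \<alpha> \<theta> E \<epsilon> B \<eta> BV V w rr
      by unfold_locales (use \<epsilon> Vdec exp_decaying_mono[OF wdec order_refl \<epsilon>(2)] rdec Vreal w0 in \<open>simp_all add:
          rr_def\<close>)
    have dq: "dual_quasi \<alpha> \<theta> E \<epsilon> B \<eta> BV V w rr" by unfold_locales

    \<comment> \<open>Lower bound and near constancy of the Wronskian\<close>
    define h where "h = \<eta> * B"
    have h0: "h \<ge> 0" using K0 B1 by (simp add: h_def \<eta>_def exp_decay_nonneg)
    have LP: "L powr P * exp_decay c5 N \<le> Q * exp_decay (c5/2) N" by (rule Q(2)[OF Lpos Ncases])
    have Lpb: "L powr b * L powr b = L powr P * L powr (- Cw - 1)"
      by (simp add: P_def flip: powr_add)
    have h_le: "h \<le> K * Q * L powr (- Cw - 1) * exp_decay (c5/2) N"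
    proof -
      have "h = K * exp_decay c5 N * (B * B)" by (simp add: h_def \<eta>_def)
      also have "\<dots> \<le> K * exp_decay c5 N * (L powr b * L powr b)"
        using BL B1 K0 exp_decay_nonneg by (intro mult_left_mono mult_mono) auto
      also have "\<dots> = K * L powr (- Cw - 1) * (L powr P * exp_decay c5 N)" unfolding Lpb by simp
      also have "\<dots> \<le> K * L powr (- Cw - 1) * (Q * exp_decay (c5/2) N)" using LP K0
          by (intro mult_left_mono) auto
      finally show ?thesis by (simp add: mult_ac)
    qed
    have h_small: "(2 * Kw + 2 * ES\<^sup>2) * h \<le> L powr (- Cw) / 8"
    proof -
      have "h \<le> K * Q * L powr (- Cw - 1) * 1"
        by (rule order_trans[OF h_le mult_left_mono[OF exp_decay_le_1]]) (use c5 N0 K0 Q(1) in auto)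
      hence "(2 * Kw + 2 * ES\<^sup>2) * h \<le> (2 * Kw + 2 * ES\<^sup>2) * (K * Q * L powr (- Cw - 1) * 1)"
        using Kw0 by (intro mult_left_mono) auto
      also have "\<dots> = K1 * L powr (- Cw - 1)" by (simp add: K1_def)
      also have "L powr (- Cw - 1) = L powr (- Cw) / L" using Lpos by (simp add: powr_diff)
      also have "K1 * (L powr (- Cw) / L) \<le> (L / 8) * (L powr (- Cw) / L)"
        using L1'(3) Lpos by (intro mult_right_mono) auto
      also have "\<dots> = L powr (- Cw) / 8" using Lpos by simp
      finally show ?thesis .
    qed
    have dcee: "\<kappa> * \<bar>of_int k\<bar> powr (- \<tau>) \<le> norm (ee (of_int k * of_real \<alpha>) - 1)" if "k \<noteq> 0" for k
    proof -
      have "\<kappa> * \<bar>of_int k\<bar> powr (- \<tau>) \<le> dist_Z (of_int k * \<alpha>)" by (rule dc(3)[OF that])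
      also have "\<dots> \<le> \<bar>sin (pi * (of_int k * \<alpha>))\<bar>" by (rule abs_sin_pi_ge)
      also have "\<dots> \<le> norm (ee (of_real (of_int k * \<alpha>)) - 1)" unfolding norm_ee_minus_1 by simp
      finally show ?thesis by simp
    qed
    have near: "norm (wr z - gw 0) \<le> Kw * h" if "16 * pi * \<bar>Im z\<bar> \<le> \<epsilon>" for z
      unfolding Kw_def h_def by (rule wr_near_const[OF dcee dc(1,2) that])
    have near0: "norm (wr z - wr 0) \<le> 2 * (Kw * h)" if "16 * pi * \<bar>Im z\<bar> \<le> \<epsilon>" for z
    proof -
      have "norm (wr z - wr 0) = norm ((wr z - gw 0) - (wr 0 - gw 0))" by simp
      also have "\<dots> \<le> norm (wr z - gw 0) + norm (wr 0 - gw 0)" by (rule norm_triangle_ineq4)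
      also have "\<dots> \<le> Kw * h + Kw * h" by (intro add_mono near that) (use \<epsilon> in simp)
      finally show ?thesis by simp
    qed
    have wr0: "norm (wr 0) \<ge> L powr (- Cw) / 2"
    proof -
      \<comment> \<open>One number that dominates \<open>wr\<close> on the real axis and also the
        residual terms of the recurrence. By \<open>h_small\<close> it exceeds
        \<open>norm (wr 0)\<close> by at most L^(-Cw)/8, so the bound for \<delta> passes to
        \<open>wr 0\<close>.\<close>
      define \<delta> where "\<delta> = norm (wr 0) + (2 * Kw + 2 * ES\<^sup>2) * h"
      have split: "(2 * Kw + 2 * ES\<^sup>2) * h = 2 * (Kw * h) + 2 * (ES\<^sup>2 * h)" "Kw * h \<ge> 0" "ES\<^sup>2 * h \<ge> 0"
        using Kw0 h0 by (simp_all add: algebra_simps)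
      have "L powr (- Cw) \<le> \<delta>"
      proof (rule low(3)[OF dq _ _ _ rjb BL L1'(1)])
        show "\<bar>E\<bar> + BV * exp_sum (\<epsilon>/2) + 2 \<le> M" using E by (simp add: M_def ES_def)
        show "\<forall>k::int. k \<noteq> 0 \<longrightarrow> \<kappa> * \<bar>of_int k\<bar> powr (- \<tau>) \<le> dist_Z (of_int k * \<alpha>)" using dc(3) by blast
        show "dist_Z (2 * \<theta> - of_int (r j) * \<alpha>) = 1 / L" using L(1) by (simp add: inverse_eq_divide)
        show "\<forall>x::real. norm (wr (of_real x)) \<le> \<delta>"
        proof
          fix x :: real
          have "norm (wr (of_real x)) \<le> norm (wr (of_real x) - wr 0) + norm (wr 0)"
              using norm_triangle_ineq[of "wr (of_real x) - wr 0" "wr 0"] by simp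
          also have "\<dots> \<le> 2 * (Kw * h) + norm (wr 0)" using near0[of "of_real x"] \<epsilon> by simp
          also have "\<dots> \<le> \<delta>" using split by (simp add: \<delta>_def)
          finally show "norm (wr (of_real x)) \<le> \<delta>" .
        qed
        have "2 * (\<eta> * B) * exp_sum (\<epsilon>/2) ^ 2 = 2 * (ES\<^sup>2 * h)" by (simp add: h_def ES_def)
        also have "\<dots> \<le> \<delta>" using split norm_ge_zero[of "wr 0"] by (simp add: \<delta>_def)
        finally show "2 * (\<eta> * B) * exp_sum (\<epsilon>/2) ^ 2 \<le> \<delta>" .
      qed
      hence "L powr (- Cw) \<le> norm (wr 0) + L powr (- Cw) / 8" using h_small by (simp add: \<delta>_def)
      moreover have "L powr (- Cw) > 0" using Lpos by simp
      ultimately show ?thesis by linarith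
    qed
    define \<beta> where "\<beta> = norm (D 0)"
    have \<beta>wr: "\<beta> = norm (wr 0) / 2" by (simp add: \<beta>_def D_wr norm_mult norm_divide)
    have \<beta>L: "\<beta> \<ge> L powr (- Cw) / 4" "\<beta> > 0" using wr0 Lpos by (auto simp: \<beta>wr intro: less_le_trans[rotated])
    have Dnear: "norm (D z - D 0) \<le> \<beta> / 2" if z: "z \<in> strip c" for z
    proof -
      have "16 * pi * \<bar>Im z\<bar> \<le> 16 * pi * c" using z by (intro mult_left_mono) (auto simp: strip_def)
      hence "16 * pi * \<bar>Im z\<bar> \<le> \<epsilon>" using c16 by linarith
      from near0[OF this] have "norm (wr z - wr 0) \<le> 2 * (Kw * h)" .
      moreover have Deq: "D z - D 0 = \<i> / 2 * (wr z - wr 0)" unfolding D_wr by (simp add: right_diff_distrib)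
      have "norm (D z - D 0) = norm (wr z - wr 0) / 2" unfolding Deq norm_mult by (simp add: norm_divide)
      moreover have "2 * (Kw * h) \<le> L powr (- Cw) / 8"
      proof -
        have "2 * (Kw * h) \<le> (2 * Kw + 2 * ES\<^sup>2) * h" using h0 by (simp add: algebra_simps)
        thus ?thesis using h_small by linarith
      qed
      ultimately show ?thesis using \<beta>L(1) powr_ge_zero[of L "- Cw"] by linarith
    qed
    obtain W sg Z where W: "analytic_SL2_loop W" "strip_extendable c W" "sg \<in> {-1, 1}"
      "strip_norm c W \<le> 4 * (B * exp_sum (\<epsilon>/2) / sqrt (\<beta>/2))"
      "strip_extendable c (\<lambda>x. W (x + \<alpha>) ** schroedinger_cocycle v lam E x ** matrix_inv (W x) - rot (sg * \<theta>))"
      "strip_norm c (\<lambda>x. W (x + \<alpha>) ** schroedinger_cocycle v lam E x ** matrix_inv (W x) - rot (sg * \<theta>))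
         \<le> 4 * (3 * (\<eta> * exp_sum (\<epsilon>/2)) * (B * exp_sum (\<epsilon>/2)) / \<beta>)"
      "finite Z" "Z \<subseteq> {0..1}" "\<And>x. x \<in> Z \<Longrightarrow> X1 (of_real x) = 0" "\<exists>m. has_degree W m \<and> \<bar>m\<bar> = int (card Z)"
      by (rule conjugation[OF c(1) c16 \<beta>_def \<beta>L(2) Dnear Vx]) (assumption | rule that)+

    \<comment> \<open>Degree of the conjugacy and the two norm estimates\<close>
    have degree: "\<exists>m. has_degree W m \<and> real_of_int \<bar>m\<bar> \<le> C * n"
    proof -
      obtain x1 where x1: "x1 \<in> {0..1}" "norm (X1 (of_real x1)) \<ge> 1" using X1_large by blast
      have s04: "4 * pi * s0 \<le> \<epsilon>"
        using mult_pos_pos[OF pi_gt_zero s0(1)] s0(2) unfolding mult.assoc by linarith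
      \<comment> \<open>\<open>B\<close> is exponential in n; the logarithm in the zero count is
        what makes the degree linear in n.\<close>
      have "real (card Z) \<le> Cz * ln (B * ES)"
      proof (rule Cz(2)[rule_format, OF parts_holomorphic(1)[OF s04] _ W(7,8,9) x1])
        fix z assume "z \<in> strip s0"
        hence "4 * pi * \<bar>Im z\<bar> \<le> 4 * pi * s0" by (intro mult_left_mono) (auto simp: strip_def)
        hence "4 * pi * \<bar>Im z\<bar> \<le> \<epsilon>" using s04 by linarith
        thus "norm (X1 z) \<le> B * ES" unfolding ES_def by (rule parts_bound(1))
      qed
      also have "ln (B * ES) = (ln (1 + C1) + ln ES) * 1 + \<epsilon>2 * c0 * n" using B1 ES by (simp add: ln_mult lnB)
      also have "\<dots> \<le> (ln (1 + C1) + ln ES) * n + \<epsilon>2 * c0 * n" using lnC1 ES n1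
          by (intro add_right_mono mult_left_mono) auto
      also have "Cz * \<dots> = Ca * n" by (simp add: Ca_def algebra_simps)
      also have "\<dots> \<le> C * n" using C(2) n1 by (intro mult_right_mono) auto
      finally have "real (card Z) \<le> C * n" using Cz(1) by simp
      thus ?thesis using W(10) by auto
    qed
    have Wnorm: "strip_norm c W \<le> C * L powr C"
    proof -
      \<comment> \<open>\<beta>/2 is at least L^(-Cw)/8, and 3 stands in for the square root of
        8.\<close>
      have "sqrt (\<beta>/2) \<ge> L powr (- (Cw/2)) / 3"
      proof (rule real_le_rsqrt)
        have "(L powr (- (Cw/2)) / 3)\<^sup>2 = L powr (- Cw) / 9"
          by (simp add: power2_eq_square flip: powr_add)
        also have "\<dots> \<le> \<beta> / 2" using \<beta>L(1) powr_ge_zero[of L "- Cw"] by linarith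
        finally show "(L powr (- (Cw/2)) / 3)\<^sup>2 \<le> \<beta>/2" .
      qed
      hence "B * ES / sqrt (\<beta>/2) \<le> (L powr b * ES) / (L powr (- (Cw/2)) / 3)"
        using BL B1 ES Lpos by (intro frac_le mult_right_mono mult_nonneg_nonneg) auto
      also have "\<dots> = 3 * ES * (L powr b * L powr (Cw/2))" using Lpos by (simp add: powr_minus field_simps)
      also have "\<dots> = 3 * ES * L powr (b + Cw/2)" by (simp only: powr_add)
      finally have "4 * (B * ES / sqrt (\<beta>/2)) \<le> 12 * ES * L powr (b + Cw/2)" by simp
      also have "\<dots> \<le> C * L powr C" using C ES Lge1 by (intro mult_mono powr_mono) auto
      finally show ?thesis using W(4) by (simp add: ES_def)
    qed
    \<comment> \<open>Division by \<beta> costs L^Cw, and \<open>h\<close> was bounded with L^(-Cw -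
      1) to spare, so no power of L is left in front of the exponential.\<close>
    have Dnorm: "4 * (3 * (\<eta> * exp_sum (\<epsilon>/2)) * (B * exp_sum (\<epsilon>/2)) / \<beta>) \<le> C * exp_decay c N"
    proof -
      have "4 * (3 * (\<eta> * exp_sum (\<epsilon>/2)) * (B * exp_sum (\<epsilon>/2)) / \<beta>) = 12 * ES\<^sup>2 * h / \<beta>"
        by (simp add: ES_def h_def power2_eq_square)
      also have "\<dots> \<le> 12 * ES\<^sup>2 * h / (L powr (- Cw) / 4)"
        using \<beta>L h0 Lpos by (intro divide_left_mono) auto
      also have "\<dots> = 48 * ES\<^sup>2 * (h * L powr Cw)" by (simp add: powr_minus field_simps)
      also have "\<dots> \<le> 48 * ES\<^sup>2 * (K * Q * exp_decay (c5/2) N)"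
      proof (rule mult_left_mono)
        have "h * L powr Cw \<le> K * Q * L powr (- Cw - 1) * exp_decay (c5/2) N * L powr Cw"
          using h_le by (intro mult_right_mono) auto
        also have "\<dots> = K * Q * exp_decay (c5/2) N * (L powr (- Cw - 1) * L powr Cw)" by simp
        also have "L powr (- Cw - 1) * L powr Cw = L powr (- 1)" by (simp flip: powr_add)
        also have "K * Q * exp_decay (c5/2) N * L powr (- 1) \<le> K * Q * exp_decay (c5/2) N * 1"
          using Lge1 Lpos K0 Q(1) exp_decay_nonneg by (intro mult_left_mono) (auto simp: powr_minus field_simps)
        finally show "h * L powr Cw \<le> K * Q * exp_decay (c5/2) N" by simp
      qed simp
      also have "\<dots> = Cc * exp_decay (c5/2) N" by (simp add: Cc_def)
      also have "\<dots> \<le> C * exp_decay c N"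
        using C exp_decay_mono[OF c(3) N0] exp_decay_nonneg by (intro mult_mono) auto
      finally show ?thesis .
    qed
    show ?thesis
      using W(1,2,3,5) degree Wnorm order_trans[OF W(6) Dnorm]
      by (intro exI[of _ W] conjI bexI[of _ sg]) (simp_all add: Let_def)
  qed
  thus ?thesis using C(1) c(1)
    by (intro exI[of _ C] exI[of _ c] conjI) auto
qed

end
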